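(* Let $\alpha\in\overline{\mathbb{Q}}^{\times}$. (1) For every $r\in\mathbb{Q}^{\times}$, $M_\infty(\alpha^r) = M_\infty(\alpha)$ (for any choice of the value $\alpha^r$). (2) If $p$ is the largest rational prime such that $\alpha$ fails to be a $p$-adic unit, then $M_\infty(\alpha)\geq p$.
   Context: For a number field $K$ and a place $v$ of $K$ dividing the place $p$ of $\mathbb{Q}$ (including $p=\infty$), let $\|\cdot\|_v$ be the unique absolute value on the completion $K_v$ extending the $p$-adic (usual, if $p=\infty$) absolute value on $\mathbb{Q}_p$, and put $|\alpha|_v = \|\alpha\|_v^{[K_v:\mathbb{Q}_p]/[K:\mathbb{Q}]}$ for $\alpha\in K$. The (absolute, multiplicative) Weil height of $\alpha \in K$ is $H(\alpha) = \prod_v \max\{1,|\alpha|_v\}$, the product being over all places $v$ of $K$; it does not depend on the choice of $K$ containing $\alpha$, so $H$ is a function on $\overline{\mathbb{Q}}$. The Mahler measure of $\alpha\in\overline{\mathbb{Q}}$ is $M(\alpha) = H(\alpha)^{\deg\alpha}$, where $\deg\alpha = [\mathbb{Q}(\alpha):\mathbb{Q}]$. Let $\mathcal{X}(\overline{\mathbb{Q}}^{\times})$ be the group of sequences $(\alpha_1,\alpha_2,\ldots)$ with $\alpha_n\in\overline{\mathbb{Q}}^{\times}$ and $\alpha_n = 1$ for all but finitely many $n$, and let $\tau:\mathcal{X}(\overline{\mathbb{Q}}^{\times})\to\overline{\mathbb{Q}}^{\times}$ be $\tau(\alpha_1,\alpha_2,\ldots) = \alpha_1\alpha_2\cdots$.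 For $\alpha\in\overline{\mathbb{Q}}^{\times}$ define the non-Archimedean (strong) metric Mahler measure $$M_\infty(\alpha) = \inf\left\{\max_{n\geq 1} M(\alpha_n) : (\alpha_1,\alpha_2,\ldots)\in\tau^{-1}(\alpha)\right\}.$$ For a rational prime $p$, an element $\alpha$ of a number field $K$ is a $p$-adic unit if $|\alpha|_v = 1$ for every place $v$ of $K$ dividing $p$ (this does not depend on $K$). For $r = a/b\in\mathbb{Q}^{\times}$ with $a,b$ integers and $b>0$, $\alpha^r$ denotes any $\beta\in\overline{\mathbb{Q}}^{\times}$ with $\beta^b = \alpha^a$; all such values lie in the same coset of the group of roots of unity, and $M_\infty$ is invariant under multiplication by roots of unity. *)

theory Defs
  imports
    "HOL-Analysis.Analysis"
    "HOL-Computational_Algebra.Computational_Algebra"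
    "HOL-Algebra.Algebra"
    "HOL-Algebra.Algebraic_Closure_Type"
begin

hide_const (open) Divisibility.prime

section \<open>Number fields\<close>

text \<open>
  The algebraic closure of the rationals is taken inside the complex numbers: its elements are the
  complex numbers satisfying \<^const>\<open>algebraic\<close>, and number fields are the subfields of the field of complex
  numbers, regarded as a ring record, that have finite dimension over \<open>\<rat>\<close>. In what follows
  \<open>K\<close> is always such a number field.
\<close>

abbreviation complex_ring :: "complex ring" (\<open>\<C>\<^sub>r\<close>)
  where "\<C>\<^sub>r \<equiv> ring_of_type_algebra"

definition field_degree :: "complex set \<Rightarrow> nat" where
  "field_degree K = ring.dim \<C>\<^sub>r \<rat> K"

definition rat_adjoin :: "complex \<Rightarrow> complex set" where
  "rat_adjoin \<alpha> = generate_field \<C>\<^sub>r (\<rat> \<union> {\<alpha>})"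

definition alg_degree :: "complex \<Rightarrow> nat" where
  "alg_degree \<alpha> = field_degree (rat_adjoin \<alpha>)"


section \<open>Places\<close>

text \<open>
  Absolute values on \<open>K\<close> are required to be \<^const>\<open>extensional\<close>, so that
  two of them are equal as HOL functions exactly when they agree on \<open>K\<close>.
\<close>

definition abs_value_on :: "complex set \<Rightarrow> (complex \<Rightarrow> real) \<Rightarrow> bool" where
  "abs_value_on K v \<longleftrightarrow>
     v \<in> extensional K \<and>
     (\<forall>x\<in>K. 0 \<le> v x \<and> (v x = 0 \<longleftrightarrow> x = 0)) \<and>
     (\<forall>x\<in>K. \<forall>y\<in>K. v (x * y) = v x * v y \<and> v (x + y) \<le> v x + v y)"

definition nontrivial_abs_values :: "complex set \<Rightarrow> (complex \<Rightarrow> real) set" where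
  "nontrivial_abs_values K = {v. abs_value_on K v \<and> (\<exists>x\<in>K. x \<noteq> 0 \<and> v x \<noteq> 1)}"

definition abs_value_equiv :: "complex set \<Rightarrow> ((complex \<Rightarrow> real) \<times> (complex \<Rightarrow> real)) set" where
  "abs_value_equiv K =
     {(v, w). v \<in> nontrivial_abs_values K \<and> w \<in> nontrivial_abs_values K \<and>
              (\<exists>s>0. \<forall>x\<in>K. w x = v x powr s)}"

definition places :: "complex set \<Rightarrow> (complex \<Rightarrow> real) set set" where
  "places K = nontrivial_abs_values K // abs_value_equiv K"

datatype rat_place = Archimedean | Padic nat

definition rat_places :: "rat_place set" where
  "rat_places = insert Archimedean (Padic ` {p. prime p})"

definition padic_abs :: "nat \<Rightarrow> rat \<Rightarrow> real" where
  "padic_abs p x =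
     (if x = 0 then 0
      else case quotient_of x of (a, b) \<Rightarrow>
        real p powi (int (multiplicity (int p) b) - int (multiplicity (int p) a)))"

fun rat_place_abs :: "rat_place \<Rightarrow> rat \<Rightarrow> real" where
  "rat_place_abs Archimedean x = \<bar>real_of_rat x\<bar>"
| "rat_place_abs (Padic p) x = padic_abs p x"

text \<open>
  A place of \<open>K\<close> divides the place \<open>p\<close> of the rationals iff one of the
  equivalent absolute values in it extends the standard absolute value at \<open>p\<close>;
  that absolute value is \<open>place_norm\<close>.
\<close>

definition extends_rat_place :: "rat_place \<Rightarrow> (complex \<Rightarrow> real) \<Rightarrow> bool" where
  "extends_rat_place p w \<longleftrightarrow> (\<forall>x. w (of_rat x) = rat_place_abs p x)"

definition place_divides :: "(complex \<Rightarrow> real) set \<Rightarrow> rat_place \<Rightarrow> bool" where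
  "place_divides v p \<longleftrightarrow> (\<exists>w\<in>v. extends_rat_place p w)"

definition place_norm :: "(complex \<Rightarrow> real) set \<Rightarrow> complex \<Rightarrow> real" where
  "place_norm v = (THE w. w \<in> v \<and> (\<exists>p\<in>rat_places. extends_rat_place p w))"


section \<open>Completions and local degrees\<close>

text \<open>
  The completion \<open>K\<^sub>v\<close> is the ring of Cauchy sequences in \<open>K\<close> modulo the null
  sequences. It contains \<open>\<rat>\<^sub>p\<close>, the completion of the rationals, as the set of classes of
  rational Cauchy sequences.
\<close>

definition cauchy_ring :: "complex set \<Rightarrow> (complex \<Rightarrow> real) \<Rightarrow> (nat \<Rightarrow> complex) ring" where
  "cauchy_ring K w =
     \<lparr>carrier = {x. range x \<subseteq> K \<and>
                    (\<forall>e>0. \<exists>N. \<forall>m\<ge>N. \<forall>n\<ge>N. w (x m - x n) < e)},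
      monoid.mult = (\<lambda>x y n. x n * y n),
      one = (\<lambda>n. 1),
      ring.zero = (\<lambda>n. 0),
      add = (\<lambda>x y n. x n + y n)\<rparr>"

definition null_sequences :: "complex set \<Rightarrow> (complex \<Rightarrow> real) \<Rightarrow> (nat \<Rightarrow> complex) set" where
  "null_sequences K w = {x \<in> carrier (cauchy_ring K w). (\<lambda>n. w (x n)) \<longlonglongrightarrow> 0}"

definition completion :: "complex set \<Rightarrow> (complex \<Rightarrow> real) set \<Rightarrow> (nat \<Rightarrow> complex) set ring" where
  "completion K v =
     cauchy_ring K (place_norm v) Quot null_sequences K (place_norm v)"

definition rat_completion :: "complex set \<Rightarrow> (complex \<Rightarrow> real) set \<Rightarrow> (nat \<Rightarrow> complex) set set" where
  "rat_completion K v =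
     {null_sequences K (place_norm v) +>\<^bsub>cauchy_ring K (place_norm v)\<^esub> x | x.
        x \<in> carrier (cauchy_ring K (place_norm v)) \<and> range x \<subseteq> \<rat>}"

definition local_degree :: "complex set \<Rightarrow> (complex \<Rightarrow> real) set \<Rightarrow> nat" where
  "local_degree K v =
     ring.dim (completion K v) (rat_completion K v) (carrier (completion K v))"

definition place_abs :: "complex set \<Rightarrow> (complex \<Rightarrow> real) set \<Rightarrow> complex \<Rightarrow> real" where
  "place_abs K v \<alpha> =
     place_norm v \<alpha> powr (real (local_degree K v) / real (field_degree K))"


section \<open>Weil height, Mahler measure, and the strong metric Mahler measure\<close>

text \<open>
  \<^const>\<open>prod'\<close> is the product over the indices whose factor differs from 1. There are only
  finitely many of them here, although \<^term>\<open>places K\<close> is infinite.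
\<close>

definition weil_height_over :: "complex set \<Rightarrow> complex \<Rightarrow> real" where
  "weil_height_over K \<alpha> = prod' (\<lambda>v. max 1 (place_abs K v \<alpha>)) (places K)"

text \<open>
  The Weil height and the notion of a \<open>p\<close>-adic unit do not depend on the number field
  containing \<open>\<alpha>\<close>; the field generated by \<open>\<alpha>\<close> is used.
\<close>

definition weil_height :: "complex \<Rightarrow> real" where
  "weil_height \<alpha> = weil_height_over (rat_adjoin \<alpha>) \<alpha>"

definition mahler_measure :: "complex \<Rightarrow> real" where
  "mahler_measure \<alpha> = weil_height \<alpha> ^ alg_degree \<alpha>"

definition alg_units :: "complex set" where
  "alg_units = {\<alpha>. algebraic \<alpha> \<and> \<alpha> \<noteq> 0}"

definition fin_sequences :: "(nat \<Rightarrow> complex) set" where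
  "fin_sequences = {A. range A \<subseteq> alg_units \<and> finite {n. A n \<noteq> 1}}"

definition seq_product :: "(nat \<Rightarrow> complex) \<Rightarrow> complex" where
  "seq_product A = prod' A UNIV"

text \<open>
  The sequences below take only finitely many values, so the maximum is that of a
  finite nonempty set.
\<close>

definition strong_metric_mahler :: "complex \<Rightarrow> real" where
  "strong_metric_mahler \<alpha> =
     Inf {Max (range (\<lambda>n. mahler_measure (A n))) | A. A \<in> fin_sequences \<and> seq_product A = \<alpha>}"

definition padic_unit_in :: "complex set \<Rightarrow> nat \<Rightarrow> complex \<Rightarrow> bool" where
  "padic_unit_in K p \<alpha> \<longleftrightarrow>
     (\<forall>v\<in>places K. place_divides v (Padic p) \<longrightarrow> place_abs K v \<alpha> = 1)"

definition padic_unit :: "nat \<Rightarrow> complex \<Rightarrow> bool" where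
  "padic_unit p \<alpha> \<longleftrightarrow> padic_unit_in (rat_adjoin \<alpha>) p \<alpha>"

text \<open>The fraction \<open>a / b\<close> representing \<open>r\<close> need not be in lowest terms.\<close>

definition is_rat_power :: "complex \<Rightarrow> rat \<Rightarrow> complex \<Rightarrow> bool" where
  "is_rat_power \<alpha> r \<beta> \<longleftrightarrow>
     \<beta> \<in> alg_units \<and>
     (\<exists>(a::int) (b::nat). b > 0 \<and> r = of_int a / of_nat b \<and> \<beta> ^ b = \<alpha> powi a)"

end

(* Write K for the field of alpha. The completions of K above a place p of the rationals are
governed by the conjugates of alpha: fix an absolute value w extending p on the algebraic numbers;
then the absolute values of K above p are the restrictions of w along the embeddings of K, and the
local degree at one of them is the number of embeddings inducing it. Hence M(alpha) is the product
over p of the local factors prod_z max(1, w_p(z)), z running over the conjugates of alpha, and the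
product formula gives M(1/alpha) = M(alpha), comparison of conjugates gives M(g) <= M(g^b), and
Gauss's lemma gives M(alpha) >= p as soon as |alpha|_w is not 1 for some w above p.

For (1), powers of alpha are products of copies of its factors, and factorizations pass to inverses
and roots without increasing the maximal Mahler measure. For (2), if every factor had measure below
p, each would have absolute value 1 at every w above p, so alpha would be a p-adic unit. *)

theory Submission
  imports Defs
begin

hide_const (open) Polynomials.degree up_ring.coeff up_ring.monom
  Polynomials.lead_coeff Divisibility.irreducible module.smult

section \<open>Fields of complex numbers with an absolute value\<close>

text \<open>The local degree is defined through Cauchy sequences modulo null sequences, so it has to
  be computed as the dimension of that quotient. No factorization of the minimal polynomial over the
  p-adic numbers is used. Instead, weak approximation gives elements of K close to 1 at one absolute
  value u and close to 0 at the others induced by w. Multiplied by \<alpha>, they have conjugate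
  polynomials with rational coefficients, which converge to the product over those conjugates that
  induce u. That factor is thus a limit of rational polynomials, and Lagrange interpolation at the
  conjugates turns bounds on values into bounds on coefficients; together they show that as many
  powers of \<alpha> as there are embeddings inducing u form a basis. The same argument shows that
  every absolute value above p is induced by some embedding. At a prime, w comes from a maximal
  subring of the complex numbers in which p is not invertible. Starting Zorn's lemma from the
  valuation ring of a given absolute value makes w extend that one, which part (2) relies
  on.\<close>

locale rat_field =
  fixes K :: "complex set"
  assumes Rats_subset: "\<rat> \<subseteq> K"
    and add_mem: "x \<in> K \<Longrightarrow> y \<in> K \<Longrightarrow> x + y \<in> K"
    and mult_mem: "x \<in> K \<Longrightarrow> y \<in> K \<Longrightarrow> x * y \<in> K"
    and inverse_mem: "x \<in> K \<Longrightarrow> inverse x \<in> K"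
begin

lemma of_rat_mem [simp]: "of_rat q \<in> K"
  using Rats_subset by auto

lemma of_int_mem [simp]: "of_int q \<in> K"
  using Rats_subset by auto

lemma of_nat_mem [simp]: "of_nat q \<in> K"
  using Rats_subset by auto

lemma zero_mem [simp]: "0 \<in> K" and one_mem [simp]: "1 \<in> K"
  using Rats_subset by auto

lemma uminus_mem: "x \<in> K \<Longrightarrow> - x \<in> K"
  using mult_mem[of "of_int (-1)" x] of_int_mem[of "-1"] by simp

lemma diff_mem: "x \<in> K \<Longrightarrow> y \<in> K \<Longrightarrow> x - y \<in> K"
  using add_mem[of x "-y"] uminus_mem by simp

lemma divide_mem: "x \<in> K \<Longrightarrow> y \<in> K \<Longrightarrow> x / y \<in> K"
  using mult_mem[of x "inverse y"] inverse_mem by (simp add: divide_inverse)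

lemma power_mem: "x \<in> K \<Longrightarrow> x ^ n \<in> K"
  by (induction n) (auto intro: mult_mem)

lemma power_int_mem: "x \<in> K \<Longrightarrow> x powi n \<in> K"
  by (auto simp: power_int_def intro: power_mem inverse_mem)

lemma sum_mem: "(\<And>i. i \<in> A \<Longrightarrow> f i \<in> K) \<Longrightarrow> sum f A \<in> K"
  by (induction A rule: infinite_finite_induct) (auto intro: add_mem)

lemma prod_mem: "(\<And>i. i \<in> A \<Longrightarrow> f i \<in> K) \<Longrightarrow> prod f A \<in> K"
  by (induction A rule: infinite_finite_induct) (auto intro: mult_mem)

lemmas mem_intros = add_mem mult_mem inverse_mem uminus_mem diff_mem divide_mem power_mem
  power_int_mem sum_mem prod_mem

end

locale valued_field = rat_field +
  fixes v :: "complex \<Rightarrow> real"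
  assumes abs_value: "abs_value_on K v"
begin

lemma nonneg: "x \<in> K \<Longrightarrow> 0 \<le> v x"
  using abs_value by (simp add: abs_value_on_def)

lemma eq_0_iff: "x \<in> K \<Longrightarrow> v x = 0 \<longleftrightarrow> x = 0"
  using abs_value by (simp add: abs_value_on_def)

lemma pos: "x \<in> K \<Longrightarrow> x \<noteq> 0 \<Longrightarrow> 0 < v x"
  using nonneg eq_0_iff by (metis less_eq_real_def)

lemma mult: "x \<in> K \<Longrightarrow> y \<in> K \<Longrightarrow> v (x * y) = v x * v y"
  using abs_value by (simp add: abs_value_on_def)

lemma triangle: "x \<in> K \<Longrightarrow> y \<in> K \<Longrightarrow> v (x + y) \<le> v x + v y"
  using abs_value by (simp add: abs_value_on_def)

lemma zero [simp]: "v 0 = 0"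
  using eq_0_iff by simp

lemma one [simp]: "v 1 = 1"
  using mult[of 1 1] eq_0_iff[of 1] by simp

lemma uminus: assumes "x \<in> K" shows "v (- x) = v x"
proof -
  have "v (-1) * v (-1) = 1"
    using mult[of "-1" "-1"] uminus_mem[of 1] by simp
  then have "v (-1) = 1"
    using nonneg[of "-1"] uminus_mem[of 1]
    by (metis abs_of_nonneg abs_mult_self_eq one_mem power2_eq_square real_sqrt_abs real_sqrt_one)
  then show ?thesis
    using mult[of "-1" x] assms uminus_mem[of 1] by simp
qed

lemma triangle_diff: "x \<in> K \<Longrightarrow> y \<in> K \<Longrightarrow> v (x - y) \<le> v x + v y"
  using triangle[of x "-y"] uminus[of y] uminus_mem[of y] by simp

lemma diff_commute: "x \<in> K \<Longrightarrow> y \<in> K \<Longrightarrow> v (x - y) = v (y - x)"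
  using uminus[of "x - y"] diff_mem by simp

lemma triangle_sub: "x \<in> K \<Longrightarrow> y \<in> K \<Longrightarrow> v x \<le> v y + v (x - y)"
  using triangle[of y "x - y"] diff_mem by simp

lemma abs_diff_le: assumes "x \<in> K" "y \<in> K" shows "\<bar>v x - v y\<bar> \<le> v (x - y)"
  using triangle_sub[OF assms] triangle_sub[OF assms(2,1)] diff_commute[OF assms] by linarith

lemma dist_triangle: "x \<in> K \<Longrightarrow> y \<in> K \<Longrightarrow> z \<in> K \<Longrightarrow> v (x - z) \<le> v (x - y) + v (y - z)"
  using triangle[of "x - y" "y - z"] diff_mem by simp

lemma power: "x \<in> K \<Longrightarrow> v (x ^ n) = v x ^ n"
  by (induction n) (auto simp: mult power_mem)

lemma inverse: assumes "x \<in> K" shows "v (inverse x) = inverse (v x)"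
proof (cases "x = 0")
  case False
  then have "v x * v (inverse x) = 1"
    using mult[of x "inverse x"] assms inverse_mem by simp
  then show ?thesis
    by (metis inverse_unique)
qed simp

lemma divide: "x \<in> K \<Longrightarrow> y \<in> K \<Longrightarrow> v (x / y) = v x / v y"
  using mult[of x "inverse y"] inverse inverse_mem by (simp add: divide_inverse)

lemma power_int: "x \<in> K \<Longrightarrow> v (x powi n) = v x powi n"
  by (auto simp: power_int_def power inverse inverse_mem)

lemma sum_le: "(\<And>i. i \<in> A \<Longrightarrow> f i \<in> K) \<Longrightarrow> v (sum f A) \<le> (\<Sum>i\<in>A. v (f i))"
proof (induction A rule: infinite_finite_induct)
  case (insert x F)
  then have "v (f x + sum f F) \<le> v (f x) + v (sum f F)"
    by (intro triangle sum_mem) auto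
  with insert show ?case by (smt (verit) insertCI sum.insert)
qed auto

lemma prod: "(\<And>i. i \<in> A \<Longrightarrow> f i \<in> K) \<Longrightarrow> v (prod f A) = (\<Prod>i\<in>A. v (f i))"
  by (induction A rule: infinite_finite_induct) (auto simp: mult prod_mem)

lemma of_nat_le: "v (of_nat n) \<le> of_nat n"
proof (induction n)
  case (Suc n)
  have "v (1 + of_nat n) \<le> 1 + v (of_nat n)"
    using triangle[of 1 "of_nat n"] by simp
  with Suc show ?case by simp
qed simp

lemma of_int_eq_nat: "v (of_int a) = v (of_nat (nat \<bar>a\<bar>))"
  by (cases "a \<ge> 0") (auto simp: uminus[of "of_int a", simplified, symmetric])

end

section \<open>Algebraic numbers\<close>

definition rpoly :: "rat poly \<Rightarrow> complex \<Rightarrow> complex" where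
  "rpoly P z = poly (map_poly of_rat P) z"

lemma rpoly_0 [simp]: "rpoly 0 z = 0"
  by (simp add: rpoly_def)

lemma rpoly_pCons [simp]: "rpoly (pCons a P) z = of_rat a + z * rpoly P z"
  by (simp add: rpoly_def map_poly_pCons)

lemma rpoly_add [simp]: "rpoly (P + Q) z = rpoly P z + rpoly Q z"
  by (induction P Q rule: poly_induct2) (auto simp: of_rat_add algebra_simps)

lemma rpoly_smult [simp]: "rpoly (Polynomial.smult a P) z = of_rat a * rpoly P z"
  by (induction P) (auto simp: of_rat_mult algebra_simps)

lemma rpoly_mult [simp]: "rpoly (P * Q) z = rpoly P z * rpoly Q z"
  by (induction P) (auto simp: algebra_simps)

lemma rpoly_minus [simp]: "rpoly (- P) z = - rpoly P z"
  by (induction P) (auto simp: of_rat_minus)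

lemma rpoly_diff [simp]: "rpoly (P - Q) z = rpoly P z - rpoly Q z"
  using rpoly_add[of P "-Q" z] by simp

lemma rpoly_1 [simp]: "rpoly 1 z = 1"
  unfolding one_pCons by simp

lemma rpoly_power [simp]: "rpoly (P ^ n) z = rpoly P z ^ n"
  by (induction n) auto

lemma rpoly_monom [simp]: "rpoly (Polynomial.monom a n) z = of_rat a * z ^ n"
  by (induction n) (auto simp: monom_Suc monom_0)

lemma rpoly_sum [simp]: "rpoly (sum f A) z = (\<Sum>i\<in>A. rpoly (f i) z)"
  by (induction A rule: infinite_finite_induct) auto

lemma rpoly_altdef: "rpoly P z = (\<Sum>i\<le>degree P. of_rat (coeff P i) * z ^ i)"
  by (simp add: rpoly_def poly_altdef degree_map_poly coeff_map_poly)

lemma rpoly_pcompose [simp]: "rpoly (pcompose P Q) z = rpoly P (rpoly Q z)"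
  by (induction P) (auto simp: pcompose_pCons)

lemma algebraic_iff_rpoly: "algebraic x \<longleftrightarrow> (\<exists>P. P \<noteq> 0 \<and> rpoly P x = 0)"
proof
  assume "algebraic x"
  then obtain p where p: "\<And>i. coeff p i \<in> \<int>" "p \<noteq> 0" "poly p x = 0"
    by (auto simp: algebraic_def)
  have "\<exists>r. coeff p i = of_rat r" for i
    using p(1)[of i] by (metis Ints_cases of_rat_of_int_eq)
  then obtain r where r: "\<And>i. coeff p i = of_rat (r i)"
    by metis
  define P where "P = Abs_poly r"
  have "coeff P = r"
    unfolding P_def
  proof (rule poly.Abs_poly_inverse)
    have "\<forall>\<^sub>\<infinity>i. coeff p i = 0" by (rule MOST_coeff_eq_0)
    then show "r \<in> {f. \<forall>\<^sub>\<infinity>i. f i = 0}"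
      by (auto simp: r elim: MOST_mono)
  qed
  then have "map_poly of_rat P = p"
    by (intro poly_eqI) (simp add: coeff_map_poly r)
  with p show "\<exists>P. P \<noteq> 0 \<and> rpoly P x = 0"
    by (intro exI[of _ P]) (auto simp: rpoly_def)
next
  assume "\<exists>P. P \<noteq> 0 \<and> rpoly P x = 0"
  then obtain P where "P \<noteq> 0" "rpoly P x = 0" by auto
  then show "algebraic x"
    unfolding algebraic_altdef
    by (intro exI[of _ "map_poly of_rat P"]) (auto simp: rpoly_def coeff_map_poly map_poly_eq_0_iff)
qed

lemma field_complex_ring: "field complex_ring"
  by (rule field_from_type_algebra)

interpretation CR: domain complex_ring
  using field_complex_ring by (rule field.axioms)

lemma complex_ring_simps [simp]:
  "carrier complex_ring = UNIV" "x \<otimes>\<^bsub>complex_ring\<^esub> y = x * y" "x \<oplus>\<^bsub>complex_ring\<^esub> y = x + y"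
  "\<one>\<^bsub>complex_ring\<^esub> = 1" "\<zero>\<^bsub>complex_ring\<^esub> = 0"
  by (simp_all add: ring_of_type_algebra_def)

lemma complex_ring_uminus [simp]: "\<ominus>\<^bsub>complex_ring\<^esub> x = - x"
  by (rule CR.minus_equality) auto

lemma complex_ring_inv [simp]: "x \<noteq> 0 \<Longrightarrow> inv\<^bsub>complex_ring\<^esub> x = inverse x"
  by (rule CR.comm_inv_char) auto

lemma (in rat_field) subfield: "subfield K complex_ring"
proof (rule field.subfieldI'[OF field_complex_ring CR.subringI])
  show "inv\<^bsub>complex_ring\<^esub> k \<in> K" if "k \<in> K - {\<zero>\<^bsub>complex_ring\<^esub>}" for k
    using that inverse_mem by auto
qed (auto intro: mem_intros)

lemma (in rat_field) rpoly_mem: "x \<in> K \<Longrightarrow> rpoly P x \<in> K"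
  by (induction P) (auto intro: mem_intros)

lemma rat_field_Rats: "rat_field \<rat>"
  by unfold_locales auto

text \<open>Polynomials over a ring record are coefficient lists with the leading coefficient first,
  whereas \<open>Poly\<close> starts from the constant term; hence the \<open>rev\<close>.\<close>

lemma complex_ring_eval: "CR.eval (map of_rat (rev cs)) x = rpoly (Poly cs) x"
proof (induction cs)
  case (Cons c cs)
  have "CR.eval (map of_rat (rev cs) @ [of_rat c]) x
      = CR.eval (map of_rat (rev cs)) x * x + of_rat c"
    using CR.eval_append_aux[of "map of_rat (rev cs)" "of_rat c" x] by simp
  with Cons show ?case by simp
qed simp

text \<open>Reconciles the two notions of algebraic number, so that closure of
  \<open>Collect algebraic\<close> under the field operations can be taken from the theorem on
  algebraic elements over a subfield.\<close>

lemma algebraic_over_iff: "(CR.algebraic over \<rat>) x \<longleftrightarrow> algebraic x"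
proof
  interpret rat_field \<rat> by (rule rat_field_Rats)
  assume "(CR.algebraic over \<rat>) x"
  then obtain p where p: "p \<in> carrier (\<rat>[X]\<^bsub>complex_ring\<^esub>)" "p \<noteq> []" "CR.eval p x = 0"
    using CR.algebraicE[of \<rat> x] subfieldE(1)[OF subfield] by auto
  then have "set p \<subseteq> \<rat>" "hd p \<noteq> 0"
    by (auto simp flip: univ_poly_carrier simp: polynomial_def)
  then have "\<forall>x\<in>set p. \<exists>q. x = of_rat q"
    by (auto elim: Rats_cases)
  then obtain cs where cs: "p = map of_rat cs"
    using ex_map_conv[of p of_rat] by blast
  have "cs \<noteq> []" "hd cs \<noteq> 0"
    using \<open>hd p \<noteq> 0\<close> p(2) cs by (auto simp: hd_map)
  then have "coeff (Poly (rev cs)) (length cs - 1) \<noteq> 0"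
    by (cases cs) (auto simp: nth_default_def nth_append)
  then have "Poly (rev cs) \<noteq> 0"
    by (metis coeff_0)
  moreover have "rpoly (Poly (rev cs)) x = 0"
    using complex_ring_eval[of "rev cs" x] p(3) cs by simp
  ultimately show "algebraic x"
    by (auto simp: algebraic_iff_rpoly)
next
  assume "algebraic x"
  then obtain P where P: "P \<noteq> 0" "rpoly P x = 0"
    by (auto simp: algebraic_iff_rpoly)
  define p :: "complex list" where "p = map of_rat (rev (coeffs P))"
  have "hd p \<noteq> 0"
    using P(1) by (auto simp: p_def hd_map hd_rev last_coeffs_eq_coeff_degree)
  then have "polynomial\<^bsub>complex_ring\<^esub> \<rat> p"
    by (auto simp: polynomial_def p_def)
  moreover have "p \<noteq> []"
    using P by (simp add: p_def)
  moreover have "CR.eval p x = 0"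
    using complex_ring_eval[of "coeffs P" x] P by (simp add: p_def)
  ultimately show "(CR.algebraic over \<rat>) x"
    using CR.algebraicI[of p \<rat> x] by (simp add: univ_poly_carrier)
qed

lemma rat_field_algebraic: "rat_field (Collect algebraic)"
proof -
  have sf: "subfield (Collect algebraic) complex_ring"
    using field.subfield_of_algebraics[OF field_complex_ring rat_field.subfield[OF rat_field_Rats]]
    by (simp add: algebraic_over_iff)
  show ?thesis
    using subringE(6,7)[OF subfieldE(1)[OF sf]]
    by unfold_locales (auto intro: rat_imp_algebraic)
qed

interpretation ALG: rat_field "Collect algebraic"
  by (rule rat_field_algebraic)

section \<open>Minimal polynomials and conjugates\<close>

definition minpoly :: "complex \<Rightarrow> rat poly" where
  "minpoly \<alpha> = (SOME f. lead_coeff f = 1 \<and> rpoly f \<alpha> = 0 \<and>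
     (\<forall>P. P \<noteq> 0 \<longrightarrow> rpoly P \<alpha> = 0 \<longrightarrow> degree f \<le> degree P))"

definition conjs :: "complex \<Rightarrow> complex set" where
  "conjs \<alpha> = {z. rpoly (minpoly \<alpha>) z = 0}"

lemma minpoly_props:
  assumes "algebraic \<alpha>"
  shows "lead_coeff (minpoly \<alpha>) = 1" "rpoly (minpoly \<alpha>) \<alpha> = 0"
    "P \<noteq> 0 \<Longrightarrow> rpoly P \<alpha> = 0 \<Longrightarrow> degree (minpoly \<alpha>) \<le> degree P"
proof -
  obtain P0 where P0: "P0 \<noteq> 0" "rpoly P0 \<alpha> = 0"
    using assms by (auto simp: algebraic_iff_rpoly)
  define Q where "Q = (ARG_MIN degree P. P \<noteq> 0 \<and> rpoly P \<alpha> = 0)"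
  have Q: "Q \<noteq> 0 \<and> rpoly Q \<alpha> = 0" "\<And>P. P \<noteq> 0 \<Longrightarrow> rpoly P \<alpha> = 0 \<Longrightarrow> degree Q \<le> degree P"
    unfolding Q_def using arg_min_nat_lemma[of "\<lambda>P. P \<noteq> 0 \<and> rpoly P \<alpha> = 0" P0 degree] P0 by auto
  define f where "f = Polynomial.smult (inverse (lead_coeff Q)) Q"
  have "lead_coeff f = 1 \<and> rpoly f \<alpha> = 0 \<and> (\<forall>P. P \<noteq> 0 \<longrightarrow> rpoly P \<alpha> = 0 \<longrightarrow> degree f \<le> degree P)"
    using Q by (auto simp: f_def)
  from someI[of "\<lambda>f. lead_coeff f = 1 \<and> rpoly f \<alpha> = 0 \<and>
      (\<forall>P. P \<noteq> 0 \<longrightarrow> rpoly P \<alpha> = 0 \<longrightarrow> degree f \<le> degree P)", OF this, folded minpoly_def]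
  show "lead_coeff (minpoly \<alpha>) = 1" "rpoly (minpoly \<alpha>) \<alpha> = 0"
    "P \<noteq> 0 \<Longrightarrow> rpoly P \<alpha> = 0 \<Longrightarrow> degree (minpoly \<alpha>) \<le> degree P" by auto
qed

lemma rpoly_eq_0_iff:
  assumes "algebraic \<alpha>"
  shows "rpoly P \<alpha> = 0 \<longleftrightarrow> minpoly \<alpha> dvd P"
proof
  note mp = minpoly_props[OF assms]
  assume P: "rpoly P \<alpha> = 0"
  define r where "r = P mod minpoly \<alpha>"
  have "P = minpoly \<alpha> * (P div minpoly \<alpha>) + r"
    by (simp add: r_def)
  then have "rpoly P \<alpha> = rpoly (minpoly \<alpha>) \<alpha> * rpoly (P div minpoly \<alpha>) \<alpha> + rpoly r \<alpha>"
    by (metis rpoly_add rpoly_mult)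
  then have "rpoly r \<alpha> = 0"
    using P mp(2) by simp
  moreover have "r = 0 \<or> degree r < degree (minpoly \<alpha>)"
    using mp(1) degree_mod_less[of "minpoly \<alpha>" P] unfolding r_def by force
  ultimately have "r = 0"
    using mp(3)[of r] by fastforce
  then show "minpoly \<alpha> dvd P"
    by (simp add: r_def mod_eq_0_iff_dvd)
next
  assume "minpoly \<alpha> dvd P"
  then show "rpoly P \<alpha> = 0"
    using minpoly_props(2)[OF assms] by (auto elim!: dvdE)
qed

context
  fixes \<alpha> :: complex
  assumes alg: "algebraic \<alpha>"
begin

lemma minpoly_nonzero: "minpoly \<alpha> \<noteq> 0"
  using minpoly_props(1)[OF alg] by auto

lemma degree_minpoly_pos: "degree (minpoly \<alpha>) > 0"
proof (rule ccontr)
  assume "\<not> ?thesis"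
  then obtain c where "minpoly \<alpha> = [:c:]"
    by (auto elim: degree_eq_zeroE)
  then show False
    using minpoly_props(1,2)[OF alg] by simp
qed

lemma irreducible_minpoly: "irreducible (minpoly \<alpha>)"
proof (rule Factorial_Ring.irreducibleI)
  show "minpoly \<alpha> \<noteq> 0" by (rule minpoly_nonzero)
  show "\<not> minpoly \<alpha> dvd 1"
    using rpoly_eq_0_iff[OF alg, of 1] by simp
  fix a b assume ab: "minpoly \<alpha> = a * b"
  then have "rpoly a \<alpha> = 0 \<or> rpoly b \<alpha> = 0"
    using minpoly_props(2)[OF alg] by simp
  then have "minpoly \<alpha> dvd a \<or> minpoly \<alpha> dvd b"
    by (simp add: rpoly_eq_0_iff[OF alg])
  moreover have "a \<noteq> 0" "b \<noteq> 0"
    using ab minpoly_nonzero by auto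
  ultimately show "a dvd 1 \<or> b dvd 1"
    using ab by (metis dvd_mult_cancel_left dvd_times_right_cancel_iff mult.commute mult.right_neutral)
qed

lemma coprime_minpoly: "\<not> minpoly \<alpha> dvd P \<Longrightarrow> coprime (minpoly \<alpha>) P"
  using irreducible_minpoly by (simp add: irreducible_imp_prime_elem prime_elem_imp_coprime)

lemma bezout_minpoly:
  assumes "\<not> minpoly \<alpha> dvd P"
  obtains A B where "A * minpoly \<alpha> + B * P = 1"
  using bezout_coefficients_fst_snd[of "minpoly \<alpha>" P] coprime_minpoly[OF assms]
  by (metis coprime_imp_gcd_eq_1)

lemma self_in_conjs: "\<alpha> \<in> conjs \<alpha>"
  using minpoly_props(2)[OF alg] by (simp add: conjs_def)

lemma conj_algebraic: "z \<in> conjs \<alpha> \<Longrightarrow> algebraic z"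
  using minpoly_nonzero by (auto simp: conjs_def algebraic_iff_rpoly)

text \<open>If P vanished at a conjugate without being a multiple of the irreducible
  \<open>minpoly \<alpha>\<close>, a Bezout identity evaluated there would read 0 = 1. Hence
  \<alpha> and its conjugates satisfy the same rational equations, which is what makes
  \<open>emb\<close> well defined.\<close>

lemma rpoly_conj_eq_0_iff:
  assumes "z \<in> conjs \<alpha>"
  shows "rpoly P z = 0 \<longleftrightarrow> minpoly \<alpha> dvd P"
proof
  assume P: "rpoly P z = 0"
  show "minpoly \<alpha> dvd P"
  proof (rule ccontr)
    assume "\<not> minpoly \<alpha> dvd P"
    then obtain A B where "A * minpoly \<alpha> + B * P = 1"
      using bezout_minpoly by blast
    then have "rpoly A z * rpoly (minpoly \<alpha>) z + rpoly B z * rpoly P z = 1"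
      by (metis rpoly_1 rpoly_add rpoly_mult)
    with P assms show False
      by (simp add: conjs_def)
  qed
next
  assume "minpoly \<alpha> dvd P"
  then show "rpoly P z = 0"
    using assms by (auto elim!: dvdE simp: conjs_def)
qed

lemma conj_nonzero: "\<alpha> \<noteq> 0 \<Longrightarrow> z \<in> conjs \<alpha> \<Longrightarrow> z \<noteq> 0"
  using rpoly_conj_eq_0_iff[of z "[:0, 1:]"] rpoly_eq_0_iff[OF alg, of "[:0, 1:]"] by auto

text \<open>A multiple root would make the minimal polynomial divide its derivative, which in
  characteristic 0 is nonzero and of smaller degree. Simple roots make the number of conjugates
  equal to the degree.\<close>

lemma rsquarefree_minpoly: "rsquarefree (map_poly complex_of_rat (minpoly \<alpha>))"
  unfolding rsquarefree_roots
proof safe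
  fix z assume z: "poly (map_poly complex_of_rat (minpoly \<alpha>)) z = 0"
    "poly (pderiv (map_poly complex_of_rat (minpoly \<alpha>))) z = 0"
  have "pderiv (map_poly complex_of_rat (minpoly \<alpha>)) = map_poly complex_of_rat (pderiv (minpoly \<alpha>))"
    by (intro poly_eqI) (simp add: coeff_pderiv coeff_map_poly of_rat_mult of_rat_add)
  then have "rpoly (pderiv (minpoly \<alpha>)) z = 0" "z \<in> conjs \<alpha>"
    using z by (simp_all add: rpoly_def conjs_def)
  then have "minpoly \<alpha> dvd pderiv (minpoly \<alpha>)"
    by (simp add: rpoly_conj_eq_0_iff)
  moreover have "pderiv (minpoly \<alpha>) \<noteq> 0" "degree (pderiv (minpoly \<alpha>)) < degree (minpoly \<alpha>)"
    using degree_minpoly_pos by (auto simp: pderiv_eq_0_iff degree_pderiv)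
  ultimately show False
    using dvd_imp_degree_le leD by blast
qed

lemma minpoly_eq_prod: "map_poly of_rat (minpoly \<alpha>) = (\<Prod>z\<in>conjs \<alpha>. [:- z, 1:])"
proof -
  have "lead_coeff (map_poly complex_of_rat (minpoly \<alpha>)) = 1"
    using minpoly_props(1)[OF alg] by (simp add: coeff_map_poly degree_map_poly)
  then show ?thesis
    using complex_poly_decompose_rsquarefree[OF rsquarefree_minpoly]
    by (simp add: conjs_def rpoly_def)
qed

lemma finite_conjs [simp]: "finite (conjs \<alpha>)"
  using poly_roots_finite[of "map_poly complex_of_rat (minpoly \<alpha>)"] minpoly_nonzero
  by (simp add: conjs_def rpoly_def map_poly_eq_0_iff)

lemma card_conjs: "card (conjs \<alpha>) = degree (minpoly \<alpha>)"
proof -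
  have "degree (minpoly \<alpha>) = degree (\<Prod>z\<in>conjs \<alpha>. [:- z, 1:])"
    by (simp flip: minpoly_eq_prod add: degree_map_poly)
  also have "\<dots> = card (conjs \<alpha>)"
    by (subst degree_prod_eq_sum_degree) auto
  finally show ?thesis by simp
qed

text \<open>Polynomial values already form a field: the Bezout coefficient of P modulo the minimal
  polynomial, evaluated at \<alpha>, is the inverse of the value of P.\<close>

lemma rat_adjoin_eq: "rat_adjoin \<alpha> = range (\<lambda>P. rpoly P \<alpha>)"
proof -
  define R where "R = range (\<lambda>P. rpoly P \<alpha>)"
  have R_I: "rpoly P \<alpha> \<in> R" for P
    by (simp add: R_def)
  have "rat_field R"
  proof
    show "\<rat> \<subseteq> R"
    proof
      fix x :: complex assume "x \<in> \<rat>"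
      then obtain q where "x = rpoly [:q:] \<alpha>" by (auto elim: Rats_cases)
      then show "x \<in> R" by (simp only: R_I)
    qed
    fix x assume "x \<in> R"
    then obtain P where P: "x = rpoly P \<alpha>" by (auto simp: R_def)
    show "x + y \<in> R" "x * y \<in> R" if "y \<in> R" for y
    proof -
      from that obtain Q where "y = rpoly Q \<alpha>" by (auto simp: R_def)
      with P have "x + y = rpoly (P + Q) \<alpha>" "x * y = rpoly (P * Q) \<alpha>" by auto
      then show "x + y \<in> R" "x * y \<in> R" by (simp_all only: R_I)
    qed
    show "inverse x \<in> R"
    proof (cases "x = 0")
      case True
      then show ?thesis using R_I[of 0] by simp
    next
      case False
      then obtain A B where "A * minpoly \<alpha> + B * P = 1"
        using bezout_minpoly[of P] rpoly_eq_0_iff[OF alg] P by metis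
      then have "rpoly A \<alpha> * rpoly (minpoly \<alpha>) \<alpha> + rpoly B \<alpha> * rpoly P \<alpha> = 1"
        by (metis rpoly_1 rpoly_add rpoly_mult)
      then have "inverse x = rpoly B \<alpha>"
        using minpoly_props(2)[OF alg] P by (simp add: inverse_unique mult.commute)
      then show ?thesis by (simp only: R_I)
    qed
  qed
  then interpret R: rat_field R .
  have "\<alpha> \<in> R"
    using R_I[of "[:0, 1:]"] by simp
  then have 1: "rat_adjoin \<alpha> \<subseteq> range (\<lambda>P. rpoly P \<alpha>)"
    unfolding rat_adjoin_def R_def[symmetric] using R.Rats_subset R.subfield
    by (intro field.generate_field_min_subfield1[OF field_complex_ring]) auto
  have "rpoly P \<alpha> \<in> rat_adjoin \<alpha>" for P
  proof (induction P)
    case 0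
    then show ?case
      using field.zero_in_generate[OF field_complex_ring] by (simp add: rat_adjoin_def)
  next
    case (pCons a P)
    have "complex_of_rat a \<in> rat_adjoin \<alpha>" "\<alpha> \<in> rat_adjoin \<alpha>"
      by (auto simp: rat_adjoin_def intro!: generate_field.incl)
    then show ?case
      using pCons(2) generate_field.eng_add[of _ complex_ring] generate_field.eng_mult[of _ complex_ring]
      unfolding rat_adjoin_def by simp
  qed
  with 1 show ?thesis by auto
qed

lemma rpoly_in_rat_adjoin [simp]: "rpoly P \<alpha> \<in> rat_adjoin \<alpha>"
  by (simp add: rat_adjoin_eq)

lemma self_in_rat_adjoin [simp]: "\<alpha> \<in> rat_adjoin \<alpha>"
  using rpoly_in_rat_adjoin[of "[:0,1:]"] by simp

lemma rat_field_rat_adjoin: "rat_field (rat_adjoin \<alpha>)"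
proof
  show "\<rat> \<subseteq> rat_adjoin \<alpha>"
    by (auto simp: rat_adjoin_def intro!: generate_field.incl)
  show "x + y \<in> rat_adjoin \<alpha>" if "x \<in> rat_adjoin \<alpha>" "y \<in> rat_adjoin \<alpha>" for x y
    using that generate_field.eng_add[of _ complex_ring] unfolding rat_adjoin_def by simp
  show "x * y \<in> rat_adjoin \<alpha>" if "x \<in> rat_adjoin \<alpha>" "y \<in> rat_adjoin \<alpha>" for x y
    using that generate_field.eng_mult[of _ complex_ring] unfolding rat_adjoin_def by simp
  show "inverse x \<in> rat_adjoin \<alpha>" if "x \<in> rat_adjoin \<alpha>" for x
    using that generate_field.m_inv[of x complex_ring] unfolding rat_adjoin_def
    by (cases "x = 0") auto
qed

lemma rat_adjoin_algebraic: "rat_adjoin \<alpha> \<subseteq> Collect algebraic"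
  unfolding rat_adjoin_eq using ALG.rpoly_mem alg by auto

end

text \<open>The embedding of the field of \<alpha> that sends \<alpha> to the conjugate z. Any
  polynomial representing x gives the same value at z, because two of them differ by a multiple of
  the minimal polynomial.\<close>

definition emb :: "complex \<Rightarrow> complex \<Rightarrow> complex \<Rightarrow> complex" where
  "emb \<alpha> z x = rpoly (SOME P. rpoly P \<alpha> = x) z"

context
  fixes \<alpha> z :: complex
  assumes alg: "algebraic \<alpha>" and z: "z \<in> conjs \<alpha>"
begin

lemma emb_rpoly [simp]: "emb \<alpha> z (rpoly P \<alpha>) = rpoly P z"
proof -
  define Q where "Q = (SOME Q. rpoly Q \<alpha> = rpoly P \<alpha>)"
  have "rpoly Q \<alpha> = rpoly P \<alpha>"
    unfolding Q_def by (rule someI) (rule refl)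
  then have "rpoly (Q - P) z = 0"
    using rpoly_eq_0_iff[OF alg, of "Q - P"] rpoly_conj_eq_0_iff[OF alg z, of "Q - P"] by simp
  then show ?thesis
    by (simp add: emb_def Q_def[symmetric])
qed

lemma emb_self [simp]: "emb \<alpha> z \<alpha> = z"
  using emb_rpoly[of "[:0, 1:]"] by simp

lemma emb_of_rat [simp]: "emb \<alpha> z (of_rat q) = of_rat q"
  using emb_rpoly[of "[:q:]"] by simp

lemma emb_add:
  assumes "x \<in> rat_adjoin \<alpha>" "y \<in> rat_adjoin \<alpha>"
  shows "emb \<alpha> z (x + y) = emb \<alpha> z x + emb \<alpha> z y"
proof -
  obtain P Q where "x = rpoly P \<alpha>" "y = rpoly Q \<alpha>"
    using assms by (auto simp: rat_adjoin_eq[OF alg])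
  then show ?thesis
    using emb_rpoly[of "P + Q"] by simp
qed

lemma emb_mult:
  assumes "x \<in> rat_adjoin \<alpha>" "y \<in> rat_adjoin \<alpha>"
  shows "emb \<alpha> z (x * y) = emb \<alpha> z x * emb \<alpha> z y"
proof -
  obtain P Q where "x = rpoly P \<alpha>" "y = rpoly Q \<alpha>"
    using assms by (auto simp: rat_adjoin_eq[OF alg])
  then show ?thesis
    using emb_rpoly[of "P * Q"] by simp
qed

lemma emb_diff:
  assumes "x \<in> rat_adjoin \<alpha>" "y \<in> rat_adjoin \<alpha>"
  shows "emb \<alpha> z (x - y) = emb \<alpha> z x - emb \<alpha> z y"
proof -
  obtain P Q where "x = rpoly P \<alpha>" "y = rpoly Q \<alpha>"
    using assms by (auto simp: rat_adjoin_eq[OF alg])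
  then show ?thesis
    using emb_rpoly[of "P - Q"] by simp
qed

lemma emb_power:
  assumes "x \<in> rat_adjoin \<alpha>"
  shows "emb \<alpha> z (x ^ n) = emb \<alpha> z x ^ n"
proof -
  obtain P where "x = rpoly P \<alpha>"
    using assms by (auto simp: rat_adjoin_eq[OF alg])
  then show ?thesis
    using emb_rpoly[of "P ^ n"] by simp
qed

lemma emb_eq_0_iff:
  assumes "x \<in> rat_adjoin \<alpha>"
  shows "emb \<alpha> z x = 0 \<longleftrightarrow> x = 0"
proof -
  obtain P where "x = rpoly P \<alpha>"
    using assms by (auto simp: rat_adjoin_eq[OF alg])
  then show ?thesis
    using rpoly_conj_eq_0_iff[OF alg z] rpoly_eq_0_iff[OF alg] by simp
qed

lemma emb_algebraic: "x \<in> rat_adjoin \<alpha> \<Longrightarrow> algebraic (emb \<alpha> z x)"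
  using ALG.rpoly_mem conj_algebraic[OF alg z] by (auto simp: rat_adjoin_eq[OF alg])

text \<open>Embeddings pull w back to the field of \<alpha>; \<open>restrict\<close> restores the
  extensionality by which absolute values are compared as functions.\<close>

lemma abs_value_on_emb:
  assumes "abs_value_on (Collect algebraic) w"
  shows "abs_value_on (rat_adjoin \<alpha>) (restrict (\<lambda>x. w (emb \<alpha> z x)) (rat_adjoin \<alpha>))"
proof -
  interpret K: rat_field "rat_adjoin \<alpha>"
    by (rule rat_field_rat_adjoin[OF alg])
  interpret W: valued_field "Collect algebraic" w
    by unfold_locales (rule assms)
  show ?thesis
    unfolding abs_value_on_def
    by (auto simp: K.mem_intros W.nonneg W.eq_0_iff emb_algebraic emb_eq_0_iff emb_add emb_mult
        W.mult W.triangle)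
qed

lemma extends_emb:
  assumes "extends_rat_place p w"
  shows "extends_rat_place p (restrict (\<lambda>x. w (emb \<alpha> z x)) (rat_adjoin \<alpha>))"
proof -
  interpret K: rat_field "rat_adjoin \<alpha>"
    by (rule rat_field_rat_adjoin[OF alg])
  show ?thesis
    using assms by (auto simp: extends_rat_place_def)
qed

end

section \<open>Lagrange interpolation\<close>

definition lagrange :: "complex set \<Rightarrow> complex \<Rightarrow> complex poly" where
  "lagrange S z = (\<Prod>y\<in>S - {z}. [:- y / (z - y), 1 / (z - y):])"

lemma poly_lagrange:
  assumes "finite S" "z \<in> S" "y \<in> S"
  shows "poly (lagrange S z) y = (if y = z then 1 else 0)"
proof -
  have "- x / (z - x) + y * (1 / (z - x)) = (y - x) / (z - x)" for x
    by (simp add: field_simps diff_divide_distrib)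
  then have "poly (lagrange S z) y = (\<Prod>x\<in>S - {z}. (y - x) / (z - x))"
    by (simp add: lagrange_def poly_prod)
  also have "\<dots> = (if y = z then 1 else 0)"
  proof (cases "y = z")
    case True
    then show ?thesis by (auto intro!: prod.neutral split: if_splits)
  next
    case False
    with assms show ?thesis by (auto intro!: prod_zero)
  qed
  finally show ?thesis .
qed

lemma degree_lagrange:
  assumes "finite S" "z \<in> S"
  shows "degree (lagrange S z) < card S"
proof -
  have "degree (lagrange S z) \<le> (\<Sum>y\<in>S - {z}. degree [:- y / (z - y), 1 / (z - y):])"
    unfolding lagrange_def using assms(1)
    by (intro degree_prod_sum_le[unfolded o_def]) auto
  also have "\<dots> \<le> (\<Sum>y\<in>S - {z}. 1)"
    by (intro sum_mono) auto
  also have "\<dots> = card S - 1"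
    using assms by simp
  finally show ?thesis
    using assms by (metis One_nat_def Suc_pred card_gt_0_iff empty_iff le_imp_less_Suc)
qed

lemma lagrange_interpolation:
  assumes "finite S" "degree P < card S"
  shows "P = (\<Sum>z\<in>S. Polynomial.smult (poly P z) (lagrange S z))"
proof (rule poly_eqI_degree)
  fix y assume "y \<in> S"
  with assms(1) show "poly P y = poly (\<Sum>z\<in>S. Polynomial.smult (poly P z) (lagrange S z)) y"
    by (simp add: poly_sum poly_lagrange if_distrib cong: if_cong)
next
  have "degree (\<Sum>z\<in>S. Polynomial.smult (poly P z) (lagrange S z)) \<le> card S - 1"
    using degree_lagrange[OF assms(1)]
    by (intro degree_sum_le assms(1)) (fastforce intro: order.trans[OF degree_smult_le])
  then show "degree (\<Sum>z\<in>S. Polynomial.smult (poly P z) (lagrange S z)) < card S"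
    using assms(2) by linarith
qed (use assms in auto)

text \<open>The weights depend on S only. This is how estimates at conjugates become estimates of
  rational coefficients, uniformly in the polynomial.\<close>

lemma coeff_lagrange:
  assumes "finite S" "degree P < card S"
  shows "coeff P j = (\<Sum>z\<in>S. poly P z * coeff (lagrange S z) j)"
  by (subst lagrange_interpolation[OF assms]) (simp add: coeff_sum)

lemma (in rat_field) coeff_prod_mem:
  assumes "\<And>i k. i \<in> A \<Longrightarrow> coeff (f i) k \<in> K"
  shows "coeff (prod f A) k \<in> K"
  using assms
  by (induction A arbitrary: k rule: infinite_finite_induct)
    (auto simp: coeff_mult coeff_1 intro!: mem_intros)

lemma (in rat_field) coeff_linear_mem: "a \<in> K \<Longrightarrow> b \<in> K \<Longrightarrow> coeff [:a, b:] k \<in> K"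
  by (auto simp: coeff_pCons split: nat.split)

lemma (in rat_field) coeff_lagrange_mem:
  assumes "S \<subseteq> K" "z \<in> S"
  shows "coeff (lagrange S z) j \<in> K"
  unfolding lagrange_def
  using assms by (intro coeff_prod_mem coeff_linear_mem mem_intros) auto

section \<open>Rationality of symmetric functions of conjugates\<close>

text \<open>The sum is the trace of multiplication by P on \<rat>[X] modulo the minimal polynomial.
  In the monomial basis its j-th diagonal entry is the coefficient of X^j in the remainder of X^j P,
  a rational number.\<close>

lemma trace_rational:
  assumes alg: "algebraic \<alpha>"
  shows "(\<Sum>z\<in>conjs \<alpha>. rpoly P z) \<in> \<rat>"
proof -
  define f where "f = minpoly \<alpha>"
  define n where "n = degree f"
  let ?Z = "conjs \<alpha>"
  define Q where "Q j = (Polynomial.monom 1 j * P) mod f" for j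
  have card: "card ?Z = n"
    using card_conjs[OF alg] by (simp add: n_def f_def)
  have n: "n > 0"
    using degree_minpoly_pos[OF alg] by (simp add: n_def f_def)
  have fin: "finite ?Z"
    by (rule finite_conjs[OF alg])
  have Q: "rpoly (Q j) z = z ^ j * rpoly P z" if "z \<in> ?Z" for z j
  proof -
    have "Polynomial.monom 1 j * P = f * ((Polynomial.monom 1 j * P) div f) + Q j"
      by (simp add: Q_def)
    then have "rpoly (Polynomial.monom 1 j * P) z = rpoly f z * rpoly ((Polynomial.monom 1 j * P) div f) z + rpoly (Q j) z"
      by (metis rpoly_add rpoly_mult)
    with that show ?thesis
      by (simp add: conjs_def f_def)
  qed
  have deg: "degree (Q j) < n" for j
    using n degree_mod_less'[of f "Polynomial.monom 1 j * P"] minpoly_nonzero[OF alg]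
    unfolding Q_def n_def f_def
    by (cases "(Polynomial.monom 1 j * P) mod minpoly \<alpha> = 0") auto
  \<comment> \<open>Interpolation of \<open>Q j\<close> at the conjugates, where it takes the values
    z^j P(z). Summing over j then evaluates each Lagrange polynomial at its own node, where it is
    1.\<close>
  have "of_rat (coeff (Q j) j) = (\<Sum>z\<in>?Z. z ^ j * rpoly P z * coeff (lagrange ?Z z) j)" for j
  proof -
    have "of_rat (coeff (Q j) j) = coeff (map_poly complex_of_rat (Q j)) j"
      by (simp add: coeff_map_poly)
    also have "\<dots> = (\<Sum>z\<in>?Z. poly (map_poly of_rat (Q j)) z * coeff (lagrange ?Z z) j)"
      using deg fin card by (intro coeff_lagrange) (auto simp: degree_map_poly)
    finally show ?thesis
      using Q by (simp add: rpoly_def)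
  qed
  then have "(\<Sum>j<n. of_rat (coeff (Q j) j)) =
      (\<Sum>j<n. \<Sum>z\<in>?Z. z ^ j * rpoly P z * coeff (lagrange ?Z z) j)"
    by simp
  also have "\<dots> = (\<Sum>z\<in>?Z. \<Sum>j<n. z ^ j * rpoly P z * coeff (lagrange ?Z z) j)"
    by (rule sum.swap)
  also have "\<dots> = (\<Sum>z\<in>?Z. rpoly P z)"
  proof (rule sum.cong)
    fix z assume z: "z \<in> ?Z"
    have "(\<Sum>j<n. coeff (lagrange ?Z z) j * z ^ j) = poly (lagrange ?Z z) z"
      unfolding poly_altdef using degree_lagrange[OF fin z] card
      by (intro sum.mono_neutral_right) (auto simp: coeff_eq_0 not_le)
    also have "\<dots> = 1"
      using poly_lagrange[OF fin z z] by simp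
    finally have "(\<Sum>j<n. coeff (lagrange ?Z z) j * z ^ j) = 1" .
    then have "rpoly P z = (\<Sum>j<n. coeff (lagrange ?Z z) j * z ^ j) * rpoly P z"
      by simp
    also have "\<dots> = (\<Sum>j<n. z ^ j * rpoly P z * coeff (lagrange ?Z z) j)"
      unfolding sum_distrib_right by (simp only: mult_ac)
    finally show "(\<Sum>j<n. z ^ j * rpoly P z * coeff (lagrange ?Z z) j) = rpoly P z" ..
  qed simp
  finally show ?thesis
    by (metis (no_types, lifting) Rats_of_rat Rats_sum)
qed

text \<open>Newton's identities, read off from the logarithmic derivative of the product.\<close>

lemma newton_identity:
  fixes y :: "'a \<Rightarrow> complex"
  assumes "finite Z"
  shows "of_nat k * coeff (\<Prod>z\<in>Z. [:1, - y z:]) k =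
    - (\<Sum>i<k. coeff (\<Prod>z\<in>Z. [:1, - y z:]) i * (\<Sum>z\<in>Z. y z ^ (k - i)))"
proof -
  \<comment> \<open>The series aT / (1 - aT), which is -T times the logarithmic derivative of 1 -
    aT.\<close>
  define S where "S a = Abs_fps (\<lambda>k. if k = 0 then 0 else a ^ k)" for a :: complex
  have single: "fps_of_poly [:1, - a:] * S a = fps_const a * fps_X" for a
  proof (rule fps_ext)
    fix k
    have "fps_of_poly [:1, - a:] * S a = S a - fps_const a * (fps_X * S a)"
      by (simp add: fps_of_poly_pCons algebra_simps flip: fps_const_neg)
    then show "fps_nth (fps_of_poly [:1, - a:] * S a) k = fps_nth (fps_const a * fps_X) k"
      by (cases k; cases "k - 1") (auto simp: S_def)
  qed
  have key: "fps_X * fps_deriv (fps_of_poly (\<Prod>z\<in>Z. [:1, - y z:])) =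
      - (fps_of_poly (\<Prod>z\<in>Z. [:1, - y z:]) * (\<Sum>z\<in>Z. S (y z)))"
    using assms
  proof (induction Z rule: finite_induct)
    case (insert x F)
    let ?P = "fps_of_poly (\<Prod>z\<in>F. [:1, - y z:])"
    let ?g = "fps_of_poly [:1, - y x:]"
    have g: "fps_X * fps_deriv ?g = - (?g * S (y x))"
      by (simp only: single) (simp add: fps_of_poly_pCons)
    have "fps_X * fps_deriv (?g * ?P) = (fps_X * fps_deriv ?g) * ?P + ?g * (fps_X * fps_deriv ?P)"
      by (simp add: algebra_simps)
    also have "\<dots> = - ((?g * ?P) * (S (y x) + (\<Sum>z\<in>F. S (y z))))"
      unfolding g insert.IH by (simp add: algebra_simps)
    finally show ?case
      unfolding prod.insert[OF insert.hyps] sum.insert[OF insert.hyps] fps_of_poly_mult .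
  qed simp
  have "fps_nth (fps_X * fps_deriv (fps_of_poly (\<Prod>z\<in>Z. [:1, - y z:]))) k
      = of_nat k * coeff (\<Prod>z\<in>Z. [:1, - y z:]) k"
    by (cases k) auto
  moreover have "fps_nth (- (fps_of_poly (\<Prod>z\<in>Z. [:1, - y z:]) * (\<Sum>z\<in>Z. S (y z)))) k =
     - (\<Sum>i<k. coeff (\<Prod>z\<in>Z. [:1, - y z:]) i * (\<Sum>z\<in>Z. y z ^ (k - i)))"
    unfolding fps_neg_nth fps_mult_nth atLeast0AtMost lessThan_Suc_atMost[symmetric] sum.lessThan_Suc
    by (simp add: fps_sum_nth S_def)
  ultimately show ?thesis
    unfolding key by (rule box_equals[OF refl])
qed

text \<open>The power sums of the values of P are traces of powers of P, hence rational. Newton's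
  identities pass this on to the coefficients by induction, the division by k being possible in
  characteristic 0.\<close>

lemma conj_prod_rational:
  assumes alg: "algebraic \<alpha>"
  shows "coeff (\<Prod>z\<in>conjs \<alpha>. [:1, - rpoly P z:]) k \<in> \<rat>"
proof (induction k rule: less_induct)
  case (less k)
  let ?c = "coeff (\<Prod>z\<in>conjs \<alpha>. [:1, - rpoly P z:])"
  have p: "(\<Sum>z\<in>conjs \<alpha>. rpoly P z ^ i) \<in> \<rat>" for i
    using trace_rational[OF alg, of "P ^ i"] by simp
  show ?case
  proof (cases "k = 0")
    case True
    then show ?thesis
      by (simp flip: poly_0_coeff_0 add: poly_prod)
  next
    case False
    have "of_nat k * ?c k = - (\<Sum>i<k. ?c i * (\<Sum>z\<in>conjs \<alpha>. rpoly P z ^ (k - i)))"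
      by (rule newton_identity[OF finite_conjs[OF alg]])
    also have "\<dots> \<in> \<rat>"
      using less.IH by (intro Rats_minus_iff[THEN iffD2] Rats_sum Rats_mult p) auto
    finally have "of_nat k * ?c k / of_nat k \<in> \<rat>"
      by (intro Rats_divide) auto
    with False show ?thesis by simp
  qed
qed

section \<open>Dimensions from explicit bases\<close>

context ring
begin

lemma combine_eq_finsum:
  assumes "set Ks \<subseteq> carrier R" "f \<in> {..<n} \<rightarrow> carrier R" "length Ks = n"
  shows "combine Ks (map f [0..<n]) = (\<Oplus>j\<in>{..<n}. (Ks ! j) \<otimes> f j)"
  using assms
proof (induction n arbitrary: Ks)
  case 0
  then show ?case by simp
next
  case (Suc n)
  then obtain Ls k where Ks: "Ks = Ls @ [k]" "length Ls = n"
    by (metis length_Suc_conv_rev)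
  have Ls: "Ls ! j \<in> carrier R" if "j < n" for j
    using Suc.prems(1) Ks that nth_mem by fastforce
  have "combine (Ls @ [k]) (map f [0..<n] @ [f n]) = combine Ls (map f [0..<n]) \<oplus> combine [k] [f n]"
    using Suc.prems Ks by (intro combine_append[symmetric]) auto
  also have "combine Ls (map f [0..<n]) = (\<Oplus>j\<in>{..<n}. (Ls ! j) \<otimes> f j)"
    using Suc.prems Ks by (intro Suc.IH) auto
  also have "\<dots> = (\<Oplus>j\<in>{..<n}. (Ks ! j) \<otimes> f j)"
    using Suc.prems Ks Ls by (intro finsum_cong') (auto simp: nth_append Pi_def)
  also have "\<dots> \<oplus> combine [k] [f n] = (\<Oplus>j\<in>{..<Suc n}. (Ks ! j) \<otimes> f j)"
    unfolding lessThan_Suc using Suc.prems Ks Ls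
    by (subst finsum_insert) (auto simp: a_comm nth_append Pi_def)
  finally show ?case
    using Ks by simp
qed

text \<open>A family indexed below n replaces the coefficient lists of the dimension theory. The
  criterion serves twice: for the number field over \<rat> and for the completion over its rational
  classes.\<close>

lemma dim_eqI:
  assumes sf: "subfield K R" and f: "f \<in> {..<n} \<rightarrow> carrier R"
    and span: "\<And>x. x \<in> E \<longleftrightarrow> (\<exists>c \<in> {..<n} \<rightarrow> K. x = (\<Oplus>j\<in>{..<n}. c j \<otimes> f j))"
    and indep: "\<And>c. c \<in> {..<n} \<rightarrow> K \<Longrightarrow> (\<Oplus>j\<in>{..<n}. c j \<otimes> f j) = \<zero> \<Longrightarrow> \<forall>j<n. c j = \<zero>"
  shows "dim K E = n"
proof -
  let ?Us = "map f [0..<n]"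
  have K: "K \<subseteq> carrier R"
    using subfieldE(3)[OF sf] .
  have Us: "set ?Us \<subseteq> carrier R"
    using f by auto
  have "independent K ?Us"
  proof (rule trivial_combine_imp_independent[OF sf Us])
    fix Ks assume Ks: "set Ks \<subseteq> K" "combine Ks ?Us = \<zero>"
    \<comment> \<open>A vanishing combination may come with a coefficient list of any length;
      normalization truncates it or pads it with zeros to the length of the basis.\<close>
    obtain Ls where Ls: "set (take (length ?Us) Ks) \<subseteq> set Ls" "set Ls \<subseteq> set (take (length ?Us) Ks) \<union> {\<zero>}"
      "length Ls = length ?Us" "combine Ls ?Us = \<zero>"
      using combine_normalize[OF subset_trans[OF Ks(1) K] Us Ks(2)] by blast
    have zero: "\<zero> \<in> K"
      using subringE(2)[OF subfieldE(1)[OF sf]] .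
    have LsK: "set Ls \<subseteq> K"
      using Ls(2) Ks(1) zero by (auto dest: in_set_takeD)
    have "(\<Oplus>j\<in>{..<n}. (Ls ! j) \<otimes> f j) = \<zero>"
      using combine_eq_finsum[of Ls f n] Ls LsK K f by auto
    moreover have "(\<lambda>j. Ls ! j) \<in> {..<n} \<rightarrow> K"
      using LsK Ls(3) by (auto simp: Pi_def)
    ultimately have "\<forall>j<n. Ls ! j = \<zero>"
      using indep by blast
    then have "set Ls \<subseteq> {\<zero>}"
      using Ls(3) by (auto simp: in_set_conv_nth)
    then show "set (take (length ?Us) Ks) \<subseteq> {\<zero>}"
      using Ls(1) by auto
  qed
  moreover have "Span K ?Us = E"
  proof (rule Set.set_eqI)
    fix x
    have "x \<in> Span K ?Us \<longleftrightarrow> (\<exists>Ks. set Ks \<subseteq> K \<and> length Ks = n \<and> x = combine Ks ?Us)"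
      using Span_mem_iff_length_version[OF sf Us, of x] by auto
    also have "\<dots> \<longleftrightarrow> (\<exists>c \<in> {..<n} \<rightarrow> K. x = (\<Oplus>j\<in>{..<n}. c j \<otimes> f j))"
    proof
      assume "\<exists>Ks. set Ks \<subseteq> K \<and> length Ks = n \<and> x = combine Ks ?Us"
      then obtain Ks where Ks: "set Ks \<subseteq> K" "length Ks = n" "x = combine Ks ?Us" by blast
      then have "x = (\<Oplus>j\<in>{..<n}. (Ks ! j) \<otimes> f j)"
        using combine_eq_finsum[of Ks f n] K f by auto
      moreover have "(\<lambda>j. Ks ! j) \<in> {..<n} \<rightarrow> K"
        using Ks by (auto simp: Pi_def)
      ultimately show "\<exists>c \<in> {..<n} \<rightarrow> K. x = (\<Oplus>j\<in>{..<n}. c j \<otimes> f j)" by blast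
    next
      assume "\<exists>c \<in> {..<n} \<rightarrow> K. x = (\<Oplus>j\<in>{..<n}. c j \<otimes> f j)"
      then obtain c where c: "c \<in> {..<n} \<rightarrow> K" "x = (\<Oplus>j\<in>{..<n}. c j \<otimes> f j)" by blast
      have "combine (map c [0..<n]) ?Us = (\<Oplus>j\<in>{..<n}. (map c [0..<n] ! j) \<otimes> f j)"
        using c(1) f K by (intro combine_eq_finsum) auto
      also have "\<dots> = x"
        unfolding c(2) using c(1) f K by (intro finsum_cong') (auto simp: Pi_def)
      finally show "\<exists>Ks. set Ks \<subseteq> K \<and> length Ks = n \<and> x = combine Ks ?Us"
        using c(1) by (intro exI[of _ "map c [0..<n]"]) auto
    qed
    finally show "x \<in> Span K ?Us \<longleftrightarrow> x \<in> E"
      by (simp add: span)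
  qed
  ultimately have "dimension n K E"
    using dimensionI[OF sf, of ?Us E] by simp
  then show ?thesis
    using dimI[OF sf] by (simp add: over_def)
qed

end

lemma complex_ring_finsum: "(\<Oplus>\<^bsub>complex_ring\<^esub>j\<in>{..<n::nat}. f j) = (\<Sum>j<n. f j)"
proof (induction n)
  case (Suc n)
  then show ?case
    unfolding lessThan_Suc by (subst CR.finsum_insert) auto
qed (simp add: CR.finsum_empty)

lemma rat_adjoin_repr:
  assumes alg: "algebraic \<alpha>" and "x \<in> rat_adjoin \<alpha>"
  obtains Q where "x = rpoly Q \<alpha>" "degree Q < card (conjs \<alpha>)"
    "\<And>z. rpoly Q z = (\<Sum>j<card (conjs \<alpha>). of_rat (coeff Q j) * z ^ j)"
proof -
  obtain P where P: "x = rpoly P \<alpha>"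
    using assms(2) by (auto simp: rat_adjoin_eq[OF alg])
  define Q where "Q = P mod minpoly \<alpha>"
  have "P = minpoly \<alpha> * (P div minpoly \<alpha>) + Q"
    by (simp add: Q_def)
  then have "x = rpoly Q \<alpha>"
    unfolding P using minpoly_props(2)[OF alg]
    by (metis add_0 mult_zero_left rpoly_add rpoly_mult)
  moreover have deg: "degree Q < card (conjs \<alpha>)"
    using degree_minpoly_pos[OF alg] degree_mod_less'[of "minpoly \<alpha>" P] minpoly_nonzero[OF alg]
    unfolding Q_def card_conjs[OF alg] by (cases "P mod minpoly \<alpha> = 0") auto
  moreover have "rpoly Q z = (\<Sum>j<card (conjs \<alpha>). of_rat (coeff Q j) * z ^ j)" for z
    unfolding rpoly_altdef using deg by (intro sum.mono_neutral_left) (auto simp: coeff_eq_0 not_le)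
  ultimately show ?thesis using that by blast
qed

lemma alg_degree_eq:
  assumes alg: "algebraic \<alpha>"
  shows "alg_degree \<alpha> = card (conjs \<alpha>)"
proof -
  define n where "n = degree (minpoly \<alpha>)"
  have npos: "n > 0"
    using degree_minpoly_pos[OF alg] by (simp add: n_def)
  have eq: "(\<Sum>j<n. complex_of_rat (c j) * \<alpha> ^ j) = rpoly (\<Sum>j<n. Polynomial.monom (c j) j) \<alpha>" for c
    by simp
  have "CR.dim \<rat> (rat_adjoin \<alpha>) = n"
  proof (rule CR.dim_eqI)
    show "subfield \<rat> complex_ring"
      by (rule rat_field.subfield[OF rat_field_Rats])
    show "(\<lambda>j. \<alpha> ^ j) \<in> {..<n} \<rightarrow> carrier complex_ring" by simp
  next
    fix x
    show "x \<in> rat_adjoin \<alpha> \<longleftrightarrow>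
      (\<exists>c\<in>{..<n} \<rightarrow> \<rat>. x = (\<Oplus>\<^bsub>complex_ring\<^esub>j\<in>{..<n}. c j \<otimes>\<^bsub>complex_ring\<^esub> \<alpha> ^ j))"
    proof
      assume "x \<in> rat_adjoin \<alpha>"
      then obtain Q where "x = rpoly Q \<alpha>"
        "rpoly Q \<alpha> = (\<Sum>j<n. of_rat (coeff Q j) * \<alpha> ^ j)"
        using rat_adjoin_repr[OF alg] by (metis card_conjs[OF alg] n_def)
      then show "\<exists>c\<in>{..<n} \<rightarrow> \<rat>. x = (\<Oplus>\<^bsub>complex_ring\<^esub>j\<in>{..<n}. c j \<otimes>\<^bsub>complex_ring\<^esub> \<alpha> ^ j)"
        by (intro bexI[of _ "\<lambda>j. of_rat (coeff Q j)"]) (auto simp: complex_ring_finsum)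
    next
      assume "\<exists>c\<in>{..<n} \<rightarrow> \<rat>. x = (\<Oplus>\<^bsub>complex_ring\<^esub>j\<in>{..<n}. c j \<otimes>\<^bsub>complex_ring\<^esub> \<alpha> ^ j)"
      then obtain c where c: "c \<in> {..<n} \<rightarrow> \<rat>" "x = (\<Sum>j<n. c j * \<alpha> ^ j)"
        by (auto simp: complex_ring_finsum)
      interpret K: rat_field "rat_adjoin \<alpha>"
        by (rule rat_field_rat_adjoin[OF alg])
      show "x \<in> rat_adjoin \<alpha>"
        unfolding c(2) using c(1) self_in_rat_adjoin[OF alg] K.Rats_subset
        by (intro K.sum_mem K.mult_mem K.power_mem) auto
    qed
  next
    fix c assume c: "c \<in> {..<n} \<rightarrow> \<rat>"
      "(\<Oplus>\<^bsub>complex_ring\<^esub>j\<in>{..<n}. c j \<otimes>\<^bsub>complex_ring\<^esub> \<alpha> ^ j) = \<zero>\<^bsub>complex_ring\<^esub>"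
    from c(1) have "\<forall>j\<in>{..<n}. \<exists>q. c j = of_rat q"
      by (auto elim!: Rats_cases dest: funcset_mem)
    then obtain q where q: "\<And>j. j < n \<Longrightarrow> c j = of_rat (q j)"
      by (metis lessThan_iff)
    define P where "P = (\<Sum>j<n. Polynomial.monom (q j) j)"
    have "rpoly P \<alpha> = 0"
      using c(2) q by (simp add: complex_ring_finsum P_def)
    moreover have "degree P \<le> n - 1"
      unfolding P_def by (intro degree_sum_le) (auto intro: order.trans[OF degree_monom_le])
    ultimately have "P = 0"
      using minpoly_props(3)[OF alg, of P] npos unfolding n_def by linarith
    have "coeff P j = q j" if "j < n" for j
      using that by (simp add: P_def coeff_sum coeff_monom)
    then show "\<forall>j<n. c j = \<zero>\<^bsub>complex_ring\<^esub>"
      using \<open>P = 0\<close> q by auto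
  qed
  then show ?thesis
    by (simp add: alg_degree_def field_degree_def card_conjs[OF alg] n_def)
qed

section \<open>Extending p-adic absolute values to the algebraic numbers\<close>

lemma (in valued_field) of_int_Padic:
  assumes p: "prime p" and vp: "v (of_nat p) = 1 / real p"
    and unit: "\<And>c. \<not> int p dvd c \<Longrightarrow> v (of_int c) = 1" and a: "a \<noteq> 0"
  shows "v (of_int a) = real p powi (- int (multiplicity (int p) a))"
proof -
  have "\<not> int p dvd 1"
    using prime_gt_1_nat[OF p] by auto
  then obtain c where c: "a = int p ^ multiplicity (int p) a * c" "\<not> int p dvd c"
    using multiplicity_decompose'[OF a] by metis
  have "complex_of_int a = of_nat p ^ multiplicity (int p) a * of_int c"
    by (subst c(1)) simp
  then have "v (of_int a) = (1 / real p) ^ multiplicity (int p) a * 1"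
    using unit[OF c(2)] vp by (simp add: mult power power_mem)
  then show ?thesis
    by (simp add: power_int_minus power_one_over inverse_eq_divide)
qed

lemma (in valued_field) extends_PadicI:
  assumes p: "prime p" and vp: "v (of_nat p) = 1 / real p"
    and unit: "\<And>c. \<not> int p dvd c \<Longrightarrow> v (of_int c) = 1"
  shows "extends_rat_place (Padic p) v"
  unfolding extends_rat_place_def
proof
  fix x
  obtain a b where ab: "quotient_of x = (a, b)"
    by (cases "quotient_of x")
  have x: "x = of_int a / of_int b" and b: "b > 0"
    using quotient_of_div[OF ab] quotient_of_denom_pos[OF ab] by auto
  show "v (of_rat x) = rat_place_abs (Padic p) x"
  proof (cases "x = 0")
    case True
    then show ?thesis by (simp add: padic_abs_def)
  next
    case False
    then have a: "a \<noteq> 0" using x by auto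
    have p0: "real p \<noteq> 0" using p by (auto dest: prime_gt_0_nat)
    have "v (of_rat x) = v (of_int a) / v (of_int b)"
      by (simp add: x of_rat_divide divide)
    also have "\<dots> = real p powi (int (multiplicity (int p) b) - int (multiplicity (int p) a))"
      using of_int_Padic[OF assms a] of_int_Padic[OF assms, of b] b p0
      by (simp add: power_int_diff power_int_minus divide_inverse)
    finally show ?thesis
      using False by (simp add: padic_abs_def ab)
  qed
qed

section \<open>Valuation rings from maximal subrings\<close>

definition is_subring :: "complex set \<Rightarrow> bool" where
  "is_subring A \<longleftrightarrow> 1 \<in> A \<and> (\<forall>x\<in>A. \<forall>y\<in>A. x + y \<in> A \<and> x * y \<in> A \<and> - x \<in> A)"

definition adjoin :: "complex set \<Rightarrow> complex \<Rightarrow> complex set" where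
  "adjoin A x = {poly P x | P. \<forall>i. coeff P i \<in> A}"

text \<open>A subring of \<open>\<complex>\<close> maximal among those in which \<open>p\<close> is not invertible is a valuation ring.\<close>

locale max_subring =
  fixes A :: "complex set" and p :: nat
  assumes prime: "prime p" and subring: "is_subring A" and inv_p: "1 / of_nat p \<notin> A"
    and maximal: "\<And>B. is_subring B \<Longrightarrow> 1 / of_nat p \<notin> B \<Longrightarrow> A \<subseteq> B \<Longrightarrow> B = A"
begin

lemma A_one [simp]: "1 \<in> A" and A_add: "x \<in> A \<Longrightarrow> y \<in> A \<Longrightarrow> x + y \<in> A"
  and A_mult: "x \<in> A \<Longrightarrow> y \<in> A \<Longrightarrow> x * y \<in> A" and A_uminus: "x \<in> A \<Longrightarrow> - x \<in> A"
  using subring by (auto simp: is_subring_def)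

lemma A_zero [simp]: "0 \<in> A"
  using A_add[of 1 "-1"] A_uminus[of 1] by simp

lemma A_diff: "x \<in> A \<Longrightarrow> y \<in> A \<Longrightarrow> x - y \<in> A"
  using A_add[of x "-y"] A_uminus by simp

lemma A_power: "x \<in> A \<Longrightarrow> x ^ n \<in> A"
  by (induction n) (auto intro: A_mult)

lemma A_sum: "(\<And>i. i \<in> I \<Longrightarrow> f i \<in> A) \<Longrightarrow> sum f I \<in> A"
  by (induction I rule: infinite_finite_induct) (auto intro: A_add)

lemma A_of_nat [simp]: "of_nat n \<in> A"
  by (induction n) (auto intro: A_add)

lemma A_of_int [simp]: "of_int n \<in> A"
  using A_of_nat[of "nat \<bar>n\<bar>"] A_uminus[of "of_nat (nat \<bar>n\<bar>)"] by (cases "n \<ge> 0") auto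

lemma p_pos [simp]: "p > 0"
  using prime by (rule prime_gt_0_nat)

lemma p_nonzero: "complex_of_nat p \<noteq> 0"
  by simp

text \<open>Adjoining x gives a strictly larger subring A[x], so by maximality 1/p lies in it and is
  a polynomial in x over A.\<close>

lemma adjoin_eqI:
  assumes "x \<notin> A"
  obtains P where "\<And>i. coeff P i \<in> A" "of_nat p * poly P x = 1"
proof -
  have "is_subring (adjoin A x)"
    unfolding is_subring_def
  proof safe
    show "1 \<in> adjoin A x"
      unfolding adjoin_def by (intro CollectI exI[of _ 1]) (auto simp: coeff_1)
    fix a b assume "a \<in> adjoin A x" "b \<in> adjoin A x"
    then obtain P Q where PQ: "a = poly P x" "b = poly Q x" "\<And>i. coeff P i \<in> A" "\<And>i. coeff Q i \<in> A"
      by (auto simp: adjoin_def)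
    show "a + b \<in> adjoin A x"
      unfolding adjoin_def using PQ by (intro CollectI exI[of _ "P + Q"]) (auto intro: A_add)
    show "a * b \<in> adjoin A x"
      unfolding adjoin_def using PQ
      by (intro CollectI exI[of _ "P * Q"]) (auto simp: coeff_mult intro!: A_sum A_mult)
    show "- a \<in> adjoin A x"
      unfolding adjoin_def using PQ by (intro CollectI exI[of _ "- P"]) (auto intro: A_uminus)
  qed
  moreover have "A \<subseteq> adjoin A x"
  proof
    fix a assume "a \<in> A"
    then show "a \<in> adjoin A x"
      unfolding adjoin_def by (intro CollectI exI[of _ "[:a:]"]) (auto simp: coeff_pCons split: nat.split)
  qed
  moreover have "x \<in> adjoin A x"
    unfolding adjoin_def by (intro CollectI exI[of _ "[:0, 1:]"]) (auto simp: coeff_pCons split: nat.split)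
  ultimately have "1 / of_nat p \<in> adjoin A x"
    using maximal[of "adjoin A x"] assms by auto
  then obtain P where "1 / of_nat p = poly P x" "\<And>i. coeff P i \<in> A"
    by (auto simp: adjoin_def)
  then show ?thesis
    by (intro that[of P]) (auto simp flip: \<open>1 / of_nat p = poly P x\<close>)
qed

text \<open>With u = 1 - p a: if 1/u were missing from A, then 1/p would be a polynomial of some
  degree d in 1/u. Clearing denominators by u^d, which has the form 1 + p b, leaves 1/p + b in A,
  against the choice of A.\<close>

lemma one_minus_p_unit:
  assumes a: "a \<in> A"
  shows "1 - of_nat p * a \<noteq> 0" "1 / (1 - of_nat p * a) \<in> A"
proof -
  define u where "u = 1 - of_nat p * a"
  have uA: "u \<in> A"
    unfolding u_def using a by (intro A_diff A_mult) auto
  have u: "u \<noteq> 0"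
  proof
    assume "u = 0"
    then have "1 / of_nat p = a" by (simp add: u_def nonzero_divide_eq_eq mult.commute)
    with a inv_p show False by simp
  qed
  have pow: "\<exists>b\<in>A. u ^ n = 1 + of_nat p * b" for n
  proof (induction n)
    case 0
    show ?case by (intro bexI[of _ 0]) auto
  next
    case (Suc n)
    then obtain b where b: "b \<in> A" "u ^ n = 1 + of_nat p * b" by blast
    then have "u ^ Suc n = 1 + of_nat p * (b - a - of_nat p * a * b)"
      by (simp add: u_def algebra_simps)
    with a b show ?case by (intro bexI[of _ "b - a - of_nat p * a * b"]) (auto intro!: A_diff A_mult)
  qed
  show "1 - of_nat p * a \<noteq> 0" using u by (simp add: u_def)
  show "1 / (1 - of_nat p * a) \<in> A"
  proof (rule ccontr)
    assume "1 / (1 - of_nat p * a) \<notin> A"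
    then obtain P where P: "\<And>i. coeff P i \<in> A" "of_nat p * poly P (1 / u) = 1"
      using adjoin_eqI unfolding u_def by blast
    define d where "d = degree P"
    obtain b where b: "b \<in> A" "u ^ d = 1 + of_nat p * b"
      using pow by blast
    have "u ^ d * poly P (1 / u) = (\<Sum>i\<le>d. coeff P i * u ^ (d - i))"
      unfolding poly_altdef sum_distrib_left d_def[symmetric] using u
      by (intro sum.cong) (auto simp: power_diff power_one_over field_simps)
    then have "u ^ d * poly P (1 / u) \<in> A"
      using P(1) uA by (auto intro!: A_sum A_mult A_power)
    moreover have "poly P (1 / u) = 1 / of_nat p"
      using P(2) by (simp add: nonzero_eq_divide_eq mult.commute)
    then have "u ^ d * poly P (1 / u) = 1 / of_nat p + b"
      unfolding b(2) by (simp add: distrib_right)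
    ultimately have "1 / of_nat p + b - b \<in> A"
      using b(1) A_diff by metis
    with inv_p show False by simp
  qed
qed

text \<open>Descent on the sum of the degrees: the relation of smaller degree eliminates the leading
  term of the other one. It ends because a constant polynomial would put 1/p into A.\<close>

lemma valuation_aux:
  assumes "x \<noteq> 0" "\<And>i. coeff P i \<in> A" "of_nat p * poly P x = 1"
    "\<And>i. coeff Q i \<in> A" "of_nat p * poly Q (1 / x) = 1"
  shows False
  using assms
proof (induction "degree P + degree Q" arbitrary: P Q x rule: less_induct)
  case less
  have *: thesis
    if le: "degree Q \<le> degree P" and x: "x \<noteq> 0" and P: "\<And>i. coeff P i \<in> A" "of_nat p * poly P x = 1"
      and Q: "\<And>i. coeff Q i \<in> A" "of_nat p * poly Q (1 / x) = 1"
      and ex: "\<And>P'. degree P' < degree P \<Longrightarrow> (\<And>i. coeff P' i \<in> A) \<Longrightarrow> of_nat p * poly P' x = 1 \<Longrightarrow> thesis"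
    for P Q x thesis
  proof -
    define n where "n = degree P"
    define m where "m = degree Q"
    define u where "u = 1 - of_nat p * coeff Q 0"
    have u: "u \<noteq> 0" "1 / u \<in> A"
      using one_minus_p_unit[OF Q(1), of 0] by (simp_all add: u_def)
    have "n > 0"
    proof (rule ccontr)
      assume "\<not> n > 0"
      then obtain c where "P = [:c:]" by (auto simp: n_def elim: degree_eq_zeroE)
      then have "1 / of_nat p = coeff P 0" using P(2) by (simp add: nonzero_divide_eq_eq mult.commute)
      then show False using inv_p P(1)[of 0] by metis
    qed
    \<comment> \<open>Multiplying p Q(1/x) = 1 by x^n and isolating the constant coefficient of Q
      gives u x^n = p T(x) with T of degree below n. Since u is a unit of A, the leading term of P
      can be rewritten in lower degree.\<close>
    define T where "T = (\<Sum>j\<in>{1..m}. Polynomial.monom (coeff Q j) (n - j))"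
    define c where "c = coeff P n"
    define P0 where "P0 = P - Polynomial.monom c n"
    define P' where "P' = P0 + Polynomial.smult (c * (1 / u) * of_nat p) T"
    have T_x: "of_nat p * poly T x = u * x ^ n"
    proof -
      have "poly T x = (\<Sum>j\<in>{1..m}. coeff Q j * x ^ (n - j))"
        by (simp add: T_def poly_sum poly_monom)
      also have "\<dots> = x ^ n * (\<Sum>j\<in>{1..m}. coeff Q j * (1 / x) ^ j)"
        unfolding sum_distrib_left using x le
        by (intro sum.cong) (auto simp: power_diff power_one_over field_simps n_def m_def)
      also have "(\<Sum>j\<in>{1..m}. coeff Q j * (1 / x) ^ j) = poly Q (1 / x) - coeff Q 0"
        unfolding poly_altdef m_def atMost_atLeast0 by (subst (2) sum.atLeast_Suc_atMost) auto
      finally have T: "poly T x = x ^ n * (poly Q (1 / x) - coeff Q 0)" .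
      have "of_nat p * poly T x = x ^ n * (of_nat p * poly Q (1 / x) - of_nat p * coeff Q 0)"
        unfolding T by (simp add: right_diff_distrib mult_ac)
      then show ?thesis
        by (simp add: Q(2) u_def)
    qed
    have "poly P x = poly P0 x + c * x ^ n"
      by (simp add: P0_def poly_monom)
    moreover have "poly P' x = poly P0 x + c * (1 / u) * (of_nat p * poly T x)"
      by (simp add: P'_def)
    ultimately have "poly P' x = poly P x"
      using u(1) by (simp add: T_x)
    then have 1: "of_nat p * poly P' x = 1"
      using P(2) by simp
    have "coeff T i \<in> A" for i
      unfolding T_def coeff_sum coeff_monom using Q(1) by (intro A_sum) auto
    moreover have "coeff P0 i \<in> A" for i
      unfolding P0_def c_def coeff_diff coeff_monom using P(1) by (intro A_diff) auto
    moreover have "c \<in> A"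
      unfolding c_def by (rule P(1))
    ultimately have 2: "coeff P' i \<in> A" for i
      unfolding P'_def coeff_add coeff_smult by (intro A_add A_mult u(2) A_of_nat)
    have "degree P0 \<le> n - 1"
    proof (rule degree_le, safe)
      fix i assume "i > n - 1"
      then show "coeff P0 i = 0"
        using \<open>n > 0\<close> by (cases "i = n") (auto simp: P0_def c_def n_def coeff_eq_0)
    qed
    moreover have "degree T \<le> n - 1"
      unfolding T_def
      by (intro degree_sum_le) (auto intro!: order.trans[OF degree_monom_le])
    ultimately have "degree P' \<le> n - 1"
      unfolding P'_def using degree_smult_le[of "c * (1 / u) * of_nat p" T]
      by (intro degree_add_le) linarith+
    then have "degree P' < degree P"
      using \<open>n > 0\<close> by (simp add: n_def)
    with 1 2 ex show thesis by blast
  qed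
  show ?case
  proof (cases "degree Q \<le> degree P")
    case True
    obtain P' where "degree P' < degree P" "\<And>i. coeff P' i \<in> A" "of_nat p * poly P' x = 1"
      using *[OF True less.prems] by blast
    then show False
      using less.hyps[of P' Q x] less.prems by auto
  next
    case False
    have inv: "1 / (1 / x) = x" by simp
    obtain Q' where "degree Q' < degree Q" "\<And>i. coeff Q' i \<in> A" "of_nat p * poly Q' (1 / x) = 1"
      using *[of P Q "1 / x"] False less.prems unfolding inv by (metis divide_eq_0_iff nle_le one_neq_zero)
    then show False
      using less.hyps[of P Q' x] less.prems by auto
  qed
qed

lemma valuation: "x \<in> A \<or> 1 / x \<in> A"
proof (cases "x = 0")
  case False
  show ?thesis
  proof (rule ccontr)
    assume "\<not> ?thesis"
    then obtain P Q where "\<And>i. coeff P i \<in> A" "of_nat p * poly P x = 1"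
      "\<And>i. coeff Q i \<in> A" "of_nat p * poly Q (1 / x) = 1"
      using adjoin_eqI by metis
    with False show False using valuation_aux by blast
  qed
qed auto

text \<open>Bezout writes a multiple of c as 1 - p t, which is a unit of A.\<close>

lemma int_unit:
  assumes "\<not> int p dvd c"
  shows "1 / of_int c \<in> A"
proof -
  have "coprime c (int p)"
    using assms prime by (metis coprime_commute prime_imp_coprime prime_nat_int_transfer)
  then obtain s t where st: "s * c + t * int p = 1"
    using bezout_int[of c "int p"] by auto
  have "of_int (s * c + t * int p) = (1 :: complex)"
    unfolding st by simp
  then have sc: "of_int s * of_int c = 1 - of_nat p * (of_int t :: complex)"
    by (simp add: algebra_simps)
  have ne: "1 - of_nat p * of_int t \<noteq> (0 :: complex)" and u: "1 / (1 - of_nat p * of_int t) \<in> A"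
    using one_minus_p_unit[of "of_int t"] by auto
  from sc ne have "(of_int s :: complex) \<noteq> 0" by auto
  then have "1 / of_int c = of_int s * (1 / (of_int s * of_int c) :: complex)"
    by simp
  then have "1 / of_int c = of_int s * (1 / (1 - of_nat p * of_int t) :: complex)"
    unfolding sc .
  with u show ?thesis
    by (metis A_mult A_of_int)
qed

text \<open>If x is not in A then 1/x is. Dividing an equation of degree d with integer coefficients
  by x^(d-1) puts c x into A, where c is the leading coefficient. The part of c prime to p is a
  unit, so that only a power of p remains.\<close>

lemma algebraic_bounded:
  assumes "algebraic x"
  shows "\<exists>N. of_nat p ^ N * x \<in> A"
proof (cases "x \<in> A")
  case True
  then show ?thesis by (intro exI[of _ 0]) simp
next
  case False
  then have x: "x \<noteq> 0" and y: "1 / x \<in> A"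
    using valuation[of x] by auto
  obtain P where P: "\<And>i. coeff P i \<in> \<int>" "P \<noteq> 0" "poly P x = 0"
    using assms by (auto simp: algebraic_def)
  define d where "d = degree P"
  obtain c where c: "lead_coeff P = of_int c"
    using P(1) by (auto elim: Ints_cases)
  have c0: "c \<noteq> 0" using c P(2) by auto
  have d: "d > 0"
  proof (rule ccontr)
    assume "\<not> d > 0"
    then obtain a where "P = [:a:]" by (auto simp: d_def elim: degree_eq_zeroE)
    with P show False by auto
  qed
  have coeffA: "coeff P i \<in> A" for i
    using P(1)[of i] by (auto elim: Ints_cases)
  have "0 = (1 / x) ^ (d - 1) * poly P x"
    using P(3) by simp
  also have "\<dots> = (\<Sum>i\<le>d. coeff P i * (x ^ i * (1 / x) ^ (d - 1)))"
    unfolding poly_altdef sum_distrib_left d_def[symmetric] by (simp add: mult_ac)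
  also have "\<dots> = (\<Sum>i<d. coeff P i * (x ^ i * (1 / x) ^ (d - 1))) + of_int c * (x ^ d * (1 / x) ^ (d - 1))"
    by (simp add: lessThan_Suc_atMost[symmetric] c d_def)
  also have "x ^ d * (1 / x) ^ (d - 1) = x"
    using d x by (cases d) (auto simp: power_one_over)
  also have "(\<Sum>i<d. coeff P i * (x ^ i * (1 / x) ^ (d - 1))) = (\<Sum>i<d. coeff P i * (1 / x) ^ (d - 1 - i))"
    using x by (intro sum.cong) (auto simp: power_diff power_one_over field_simps)
  finally have "of_int c * x = - (\<Sum>i<d. coeff P i * (1 / x) ^ (d - 1 - i))"
    by (simp add: add_eq_0_iff)
  also have "\<dots> \<in> A"
    using coeffA y by (intro A_uminus A_sum A_mult A_power) auto
  finally have cx: "of_int c * x \<in> A" .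
  have "\<not> int p dvd 1"
    using prime_gt_1_nat[OF prime] by auto
  then obtain c' where c': "c = int p ^ multiplicity (int p) c * c'" "\<not> int p dvd c'"
    using multiplicity_decompose'[OF c0] by metis
  have "c' \<noteq> 0" using c'(2) by auto
  have "of_int c = of_nat p ^ multiplicity (int p) c * (of_int c' :: complex)"
    by (subst c'(1)) simp
  then have "of_nat p ^ multiplicity (int p) c * x = of_int c * x * (1 / of_int c')"
    using \<open>c' \<noteq> 0\<close> by simp
  also have "\<dots> \<in> A"
    using cx int_unit[OF c'(2)] by (rule A_mult)
  finally show ?thesis by blast
qed

text \<open>\<open>logval\<close> is the base-\<open>p\<close> logarithm of the absolute value with valuation ring \<open>A\<close>, as a Dedekind cut.\<close>

definition cut :: "complex \<Rightarrow> real set" where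
  "cut x = {of_int a / of_nat b | a (b::nat). b > 0 \<and> of_nat p powi a * x ^ b \<in> A}"

definition logval :: "complex \<Rightarrow> real" where
  "logval x = Inf (cut x)"

lemma cutI: "b > 0 \<Longrightarrow> of_nat p powi a * x ^ b \<in> A \<Longrightarrow> r = of_int a / of_nat b \<Longrightarrow> r \<in> cut x"
  by (auto simp: cut_def)

lemma powi_p_in_A: assumes "of_nat p powi a \<in> A" shows "a \<ge> 0"
proof (rule ccontr)
  assume "\<not> a \<ge> 0"
  then obtain k where "a = - int (Suc k)"
    by (metis not_le negD)
  then have "a + int k = - 1" by simp
  then have "of_nat p powi a * of_nat p ^ k = (1 / of_nat p :: complex)"
    using power_int_add[of "of_nat p :: complex" a "int k"] by (simp add: inverse_eq_divide)
  moreover have "of_nat p powi a * of_nat p ^ k \<in> A"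
    using assms by (intro A_mult A_power) auto
  ultimately show False using inv_p by simp
qed

lemma cut_nonempty: assumes "algebraic x" shows "cut x \<noteq> {}"
proof -
  obtain N where "of_nat p ^ N * x \<in> A"
    using algebraic_bounded[OF assms] by blast
  then have "of_int (int N) / of_nat 1 \<in> cut x"
    by (intro cutI[of 1 "int N"]) auto
  then show ?thesis by auto
qed

lemma cut_bounded: assumes "algebraic x" "x \<noteq> 0" shows "bdd_below (cut x)"
proof -
  obtain M where M: "of_nat p ^ M * inverse x \<in> A"
    using algebraic_bounded[of "inverse x"] assms by auto
  show ?thesis
  proof (rule bdd_belowI[of _ "- real M"])
    fix r assume "r \<in> cut x"
    then obtain a b where ab: "r = of_int a / of_nat b" "b > 0" "of_nat p powi a * x ^ b \<in> A"
      by (auto simp: cut_def)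
    \<comment> \<open>The b-th power of p^M / x removes x and leaves a power of p in A, whose
      exponent cannot be negative.\<close>
    have "(of_nat p powi a * x ^ b) * (of_nat p ^ M * inverse x) ^ b \<in> A"
      using ab(3) M A_mult A_power by blast
    also have "(of_nat p powi a * x ^ b) * (of_nat p ^ M * inverse x) ^ b
        = of_nat p powi (a + int (M * b))"
    proof -
      have "(of_nat p powi a * x ^ b) * (of_nat p ^ M * inverse x) ^ b
          = of_nat p powi a * of_nat p ^ (M * b) * (x * inverse x) ^ b"
        by (simp add: power_mult_distrib power_mult mult_ac)
      also have "\<dots> = of_nat p powi (a + int (M * b))"
        using assms(2) p_nonzero by (subst power_int_add) (auto simp flip: power_int_of_nat)
      finally show ?thesis .
    qed
    finally have "a + int (M * b) \<ge> 0"
      by (rule powi_p_in_A)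
    then have "real_of_int (a + int (M * b)) \<ge> 0"
      by (simp only: of_int_0_le_iff)
    then have "of_int a \<ge> - (real M * real b)" by simp
    then have "- real M * real b \<le> of_int a" by simp
    then show "- real M \<le> r"
      unfolding ab(1) using ab(2) by (subst pos_le_divide_eq) auto
  qed
qed

lemma logval_le: "algebraic x \<Longrightarrow> x \<noteq> 0 \<Longrightarrow> r \<in> cut x \<Longrightarrow> logval x \<le> r"
  unfolding logval_def by (intro cInf_lower cut_bounded)

lemma logval_less:
  assumes "algebraic x" "logval x < s" obtains r where "r \<in> cut x" "r < s"
  using cInf_lessD[OF cut_nonempty[OF assms(1)]] assms(2) unfolding logval_def by blast

lemma logval_1 [simp]: "logval 1 = 0"
proof (rule antisym)
  show "logval 1 \<le> 0"
    by (rule logval_le) (auto intro!: cutI[of 1 0])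
  show "logval 1 \<ge> 0"
    unfolding logval_def
  proof (rule cInf_greatest)
    show "cut 1 \<noteq> {}" by (intro cut_nonempty) auto
    fix r assume "r \<in> cut 1"
    then show "0 \<le> r" using powi_p_in_A by (auto simp: cut_def)
  qed
qed

lemma logval_mult_le:
  assumes "algebraic x" "x \<noteq> 0" "algebraic y" "y \<noteq> 0"
  shows "logval (x * y) \<le> logval x + logval y"
proof (rule field_le_epsilon)
  fix e :: real assume e: "e > 0"
  obtain r where r: "r \<in> cut x" "r < logval x + e / 2"
    using logval_less[OF assms(1), of "logval x + e / 2"] e by auto
  obtain s where s: "s \<in> cut y" "s < logval y + e / 2"
    using logval_less[OF assms(3), of "logval y + e / 2"] e by auto
  obtain a b where ab: "r = of_int a / of_nat b" "b > 0" "of_nat p powi a * x ^ b \<in> A"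
    using r(1) by (auto simp: cut_def)
  obtain c d where cd: "s = of_int c / of_nat d" "d > 0" "of_nat p powi c * y ^ d \<in> A"
    using s(1) by (auto simp: cut_def)
  have "(of_nat p powi a * x ^ b) ^ d * (of_nat p powi c * y ^ d) ^ b \<in> A"
    using ab(3) cd(3) A_mult A_power by blast
  also have "(of_nat p powi a * x ^ b) ^ d * (of_nat p powi c * y ^ d) ^ b =
      of_nat p powi (a * int d + c * int b) * (x * y) ^ (b * d)"
    by (simp add: power_int_add power_mult_distrib power_int_mult power_mult mult_ac)
      (metis mult.commute power_mult)
  finally have "r + s \<in> cut (x * y)"
    using ab cd by (intro cutI[of "b * d" "a * int d + c * int b"]) (auto simp: field_simps)
  then have "logval (x * y) \<le> r + s"
    using assms ALG.mult_mem by (intro logval_le) auto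
  with r s show "logval (x * y) \<le> logval x + logval y + e"
    by linarith
qed

text \<open>Here the valuation ring property enters: for a rational r = a/n outside the cut of x,
  the element p^a x^n is outside A, so its inverse lies in A and -r is in the cut of 1/x. If the
  claim failed, such an r could be chosen strictly between the two values.\<close>

lemma logval_inverse:
  assumes "algebraic x" "x \<noteq> 0"
  shows "logval (inverse x) = - logval x"
proof (rule antisym)
  show "- logval x \<le> logval (inverse x)"
    using logval_mult_le[OF assms, of "inverse x"] assms ALG.inverse_mem[of x] by auto
  show "logval (inverse x) \<le> - logval x"
  proof (rule ccontr)
    assume "\<not> ?thesis"
    then have "- logval (inverse x) < logval x" by simp
    then obtain r where r: "r \<in> \<rat>" "- logval (inverse x) < r" "r < logval x"
      using Rats_dense_in_real by blast
    obtain a b where ab: "b > 0" "r = of_int a / of_int b"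
      using r(1) by (elim Rats_cases')
    define n where "n = nat b"
    have n: "n > 0" "r = of_int a / of_nat n"
      using ab by (auto simp: n_def)
    have "r \<notin> cut x"
      using logval_le[OF assms] r(3) by fastforce
    then have "of_nat p powi a * x ^ n \<notin> A"
      using cutI[of n a x r] n by auto
    then have "1 / (of_nat p powi a * x ^ n) \<in> A"
      using valuation by blast
    also have "1 / (of_nat p powi a * x ^ n) = of_nat p powi (-a) * inverse x ^ n"
      by (simp add: power_int_minus field_simps)
    finally have "- r \<in> cut (inverse x)"
      using n by (intro cutI[of n "-a"]) auto
    then have "logval (inverse x) \<le> - r"
      using assms by (intro logval_le) auto
    with r show False by simp
  qed
qed

lemma logval_mult:
  assumes "algebraic x" "x \<noteq> 0" "algebraic y" "y \<noteq> 0"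
  shows "logval (x * y) = logval x + logval y"
proof (rule antisym)
  have "logval (x * y * inverse y) \<le> logval (x * y) + logval (inverse y)"
    using assms ALG.mult_mem by (intro logval_mult_le) auto
  then show "logval x + logval y \<le> logval (x * y)"
    using assms logval_inverse[of y] by (simp add: mult.assoc)
qed (rule logval_mult_le[OF assms])

lemma logval_in_A: "algebraic x \<Longrightarrow> x \<noteq> 0 \<Longrightarrow> x \<in> A \<Longrightarrow> logval x \<le> 0"
  by (intro logval_le cutI[of 1 0]) auto

text \<open>Since \<open>logval\<close> is -1 at p, the base p gives p the absolute value 1/p, as
  the p-adic normalization demands.\<close>

definition absval :: "complex \<Rightarrow> real" where
  "absval = restrict (\<lambda>x. if x = 0 then 0 else real p powr logval x) (Collect algebraic)"

lemma absval_in_A: "algebraic x \<Longrightarrow> x \<in> A \<Longrightarrow> absval x \<le> 1"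
  using logval_in_A[of x] powr_mono[of "logval x" 0 "real p"] prime_gt_1_nat[OF prime]
  by (auto simp: absval_def)

lemma absval_mult: "algebraic x \<Longrightarrow> algebraic y \<Longrightarrow> absval (x * y) = absval x * absval y"
  using logval_mult ALG.mult_mem[of x y] prime_gt_0_nat[OF prime] by (auto simp: absval_def powr_add)

text \<open>One of x/y and y/x lies in A, so one summand can be factored out, and 1 plus an element
  of A stays in A.\<close>

lemma absval_max:
  assumes "algebraic x" "algebraic y"
  shows "absval (x + y) \<le> max (absval x) (absval y)"
proof -
  have *: "absval (x + y) \<le> absval y"
    if "algebraic x" "algebraic y" "y \<noteq> 0" "x / y \<in> A" for x y
  proof -
    have alg: "algebraic (1 + x / y)"
      using that ALG.add_mem ALG.divide_mem by auto
    have "x + y = y * (1 + x / y)"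
      using that by (simp add: field_simps)
    then have "absval (x + y) = absval y * absval (1 + x / y)"
      using absval_mult that alg by simp
    also have "\<dots> \<le> absval y * 1"
      using that alg by (intro mult_left_mono absval_in_A A_add) (auto simp: absval_def)
    finally show ?thesis by simp
  qed
  show ?thesis
  proof (cases "x = 0 \<or> y = 0")
    case True
    then show ?thesis by auto
  next
    case False
    then show ?thesis
      using *[of x y] *[of y x] assms valuation[of "x / y"] by (auto simp: add.commute max_def)
  qed
qed

lemma abs_value_on_absval: "abs_value_on (Collect algebraic) absval"
  unfolding abs_value_on_def
proof (intro conjI ballI)
  show "absval \<in> extensional (Collect algebraic)"
    by (simp add: absval_def)
  fix x :: complex assume x: "x \<in> Collect algebraic"
  then show 0: "0 \<le> absval x" by (auto simp: absval_def)
  show "absval x = 0 \<longleftrightarrow> x = 0"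
    using x prime_gt_0_nat[OF prime] by (auto simp: absval_def)
  fix y :: complex assume y: "y \<in> Collect algebraic"
  show "absval (x * y) = absval x * absval y"
    using x y absval_mult by auto
  have "0 \<le> absval y" using y by (auto simp: absval_def)
  with 0 show "absval (x + y) \<le> absval x + absval y"
    using absval_max[of x y] x y by auto
qed

lemma extends_absval: "extends_rat_place (Padic p) absval"
proof -
  interpret W: valued_field "Collect algebraic" absval
    by unfold_locales (rule abs_value_on_absval)
  have "logval (of_nat p) \<le> -1"
    using ALG.of_nat_mem[of p] by (intro logval_le cutI[of 1 "-1"]) auto
  moreover have "logval (inverse (of_nat p)) \<le> 1"
    using ALG.inverse_mem[of "of_nat p"] ALG.of_nat_mem[of p] by (intro logval_le cutI[of 1 1]) auto
  ultimately have "logval (of_nat p) = -1"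
    using logval_inverse[of "of_nat p"] ALG.of_nat_mem[of p] by simp
  then have "absval (of_nat p) = 1 / real p"
    using ALG.of_nat_mem[of p] by (simp add: absval_def powr_minus divide_inverse)
  moreover have "absval (of_int c) = 1" if "\<not> int p dvd c" for c
  proof -
    have alg: "algebraic (of_int c)" "algebraic (inverse (of_int c))"
      using ALG.of_int_mem[of c] by auto
    have "c \<noteq> 0" using that by auto
    have "absval (of_int c) \<le> 1" "absval (inverse (of_int c)) \<le> 1"
      using absval_in_A[OF alg(1)] absval_in_A[OF alg(2)] int_unit[OF that]
      by (auto simp: inverse_eq_divide)
    moreover have "absval (of_int c) > 0"
      using W.pos[of "of_int c"] alg \<open>c \<noteq> 0\<close> by simp
    ultimately show ?thesis
      using W.inverse[of "of_int c"] alg by (simp add: inverse_le_1_iff)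
  qed
  ultimately show ?thesis
    by (intro W.extends_PadicI prime)
qed

end

text \<open>The starting ring R is a parameter with two uses: the integers for mere existence, and
  the valuation ring of an absolute value that is to be extended. Zorn's lemma applies because the
  union of a chain of subrings avoiding 1/p avoids it too.\<close>

theorem padic_extension_exists:
  assumes p: "prime p" and R: "is_subring R" "1 / of_nat p \<notin> R"
  obtains w where "abs_value_on (Collect algebraic) w" "extends_rat_place (Padic p) w"
    "\<And>x. algebraic x \<Longrightarrow> x \<in> R \<Longrightarrow> w x \<le> 1"
proof -
  define F where "F = {A. is_subring A \<and> 1 / of_nat p \<notin> A \<and> R \<subseteq> A}"
  have "\<exists>M\<in>F. \<forall>Y\<in>F. M \<subseteq> Y \<longrightarrow> Y = M"
  proof (rule subset_Zorn_nonempty)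
    show "F \<noteq> {}" using R by (auto simp: F_def)
    fix C assume C: "C \<noteq> {}" "subset.chain F C"
    have mem: "A \<in> F" if "A \<in> C" for A
      using C(2) that by (auto simp: subset.chain_def)
    have tot: "A \<subseteq> B \<or> B \<subseteq> A" if "A \<in> C" "B \<in> C" for A B
      using C(2) that by (auto simp: subset_chain_def)
    have "is_subring (\<Union>C)"
      unfolding is_subring_def
    proof safe
      show "1 \<in> \<Union>C" using C(1) mem by (auto simp: F_def is_subring_def)
      fix x y A B assume "A \<in> C" "x \<in> A" "B \<in> C" "y \<in> B"
      with tot obtain D where D: "D \<in> C" "x \<in> D" "y \<in> D" by blast
      then have "is_subring D" using mem by (auto simp: F_def)
      with D show "x + y \<in> \<Union>C" "x * y \<in> \<Union>C" "- x \<in> \<Union>C"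
        by (auto simp: is_subring_def)
    qed
    with C(1) mem show "\<Union>C \<in> F" by (fastforce simp: F_def)
  qed
  then obtain A where A: "A \<in> F" "\<And>Y. Y \<in> F \<Longrightarrow> A \<subseteq> Y \<Longrightarrow> Y = A" by blast
  interpret max_subring A p
  proof
    fix B assume "is_subring B" "1 / of_nat p \<notin> B" "A \<subseteq> B"
    with A show "B = A" by (auto simp: F_def)
  qed (use A p in \<open>auto simp: F_def\<close>)
  show ?thesis
    using A absval_in_A by (intro that[OF abs_value_on_absval extends_absval]) (auto simp: F_def)
qed

section \<open>Ostrowski's theorem and normalized absolute values\<close>

text \<open>If q = a/b exceeded 1, q^k would outgrow A k + B. Applied to the powers of one element,
  this removes the number of terms from the estimate of a sum.\<close>

lemma le_of_power_le:
  fixes a b A B :: real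
  assumes a: "a \<ge> 0" and b: "b > 0" and AB: "A \<ge> 0" "B \<ge> 0"
    and le: "\<And>k::nat. a ^ k \<le> (A * k + B) * b ^ k"
  shows "a \<le> b"
proof (rule ccontr)
  assume "\<not> a \<le> b"
  define q where "q = a / b"
  have q: "q > 1" using b \<open>\<not> a \<le> b\<close> by (simp add: q_def)
  then have small: "norm (inverse q) < 1"
    by (metis abs_of_pos inverse_less_1_iff less_trans norm_inverse real_norm_def zero_less_one)
  have "(\<lambda>k. A * (real k * inverse q ^ k) + B * inverse q ^ k) \<longlonglongrightarrow> A * 0 + B * 0"
    using small by (intro tendsto_intros powser_times_n_limit_0 LIMSEQ_power_zero) simp_all
  then have "\<forall>\<^sub>F k in sequentially. A * (real k * inverse q ^ k) + B * inverse q ^ k < 1"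
    by (rule order_tendstoD) simp
  then obtain k where k: "A * (real k * inverse q ^ k) + B * inverse q ^ k < 1"
    unfolding eventually_sequentially by blast
  have pos: "q ^ k > 0" using q by simp
  have "A * (real k * inverse q ^ k) + B * inverse q ^ k = (A * real k + B) / q ^ k"
    unfolding power_inverse divide_inverse by (simp only: distrib_right mult.assoc)
  with k pos have "A * real k + B < q ^ k"
    by simp
  moreover have "q ^ k \<le> A * real k + B"
    using le[of k] b by (simp add: q_def power_divide pos_divide_le_eq)
  ultimately show False by simp
qed

section \<open>Archimedean and non-archimedean absolute values\<close>

context valued_field
begin

text \<open>The expansion of (x + y)^k has k + 1 terms, each at most the k-th power of the maximum
  because binomial coefficients have absolute value at most 1. The factor k + 1 is then removed by
  \<open>le_of_power_le\<close>.\<close>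

lemma nonarchimedean:
  assumes "\<And>n. v (of_nat n) \<le> 1" "x \<in> K" "y \<in> K"
  shows "v (x + y) \<le> max (v x) (v y)"
proof (cases "max (v x) (v y) = 0")
  case True
  then have "x = 0" "y = 0"
    using eq_0_iff nonneg assms(2,3) by (metis max.absorb1 max.absorb2 nle_le)+
  then show ?thesis by simp
next
  case False
  define M where "M = max (v x) (v y)"
  have M: "M > 0" "v x \<le> M" "v y \<le> M"
    using False nonneg[OF assms(2)] nonneg[OF assms(3)] by (auto simp: M_def max_def)
  have "v (x + y) \<le> M"
  proof (rule le_of_power_le[where A = 1 and B = 1])
    show "v (x + y) \<ge> 0" using assms(2,3) by (intro nonneg mem_intros)
    fix k
    have "v (x + y) ^ k = v ((x + y) ^ k)"
      using assms(2,3) by (simp add: power add_mem)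
    also have "\<dots> = v (\<Sum>i\<le>k. of_nat (k choose i) * x ^ i * y ^ (k - i))"
      by (simp add: binomial_ring)
    also have "\<dots> \<le> (\<Sum>i\<le>k. v (of_nat (k choose i) * x ^ i * y ^ (k - i)))"
      using assms(2,3) by (intro sum_le mem_intros) auto
    also have "\<dots> \<le> (\<Sum>i\<le>k. M ^ k)"
    proof (rule sum_mono)
      fix i assume i: "i \<in> {..k}"
      have "v (of_nat (k choose i) * x ^ i * y ^ (k - i)) = v (of_nat (k choose i)) * v x ^ i * v y ^ (k - i)"
        using assms(2,3) by (simp add: mult power mem_intros)
      also have "\<dots> \<le> 1 * M ^ i * M ^ (k - i)"
        using M assms nonneg by (intro mult_mono power_mono) auto
      also have "\<dots> = M ^ k"
        using i by (simp flip: power_add)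
      finally show "v (of_nat (k choose i) * x ^ i * y ^ (k - i)) \<le> M ^ k" .
    qed
    also have "\<dots> = (1 * real k + 1) * M ^ k" by simp
    finally show "v (x + y) ^ k \<le> (1 * real k + 1) * M ^ k" .
  qed (use M in auto)
  then show ?thesis by (simp add: M_def)
qed

text \<open>Again by powers: each binomial term has as absolute value the s-th power of the
  corresponding real term of (a + b)^k, hence at most the s-th power of the whole. Subadditivity is
  not automatic for the exponent 1/s, which may exceed 1.\<close>

lemma archimedean_root:
  assumes s: "s > 0" and vn: "\<And>n. n > 0 \<Longrightarrow> v (of_nat n) = real n powr s"
    and xy: "x \<in> K" "y \<in> K"
  shows "v (x + y) powr (1 / s) \<le> v x powr (1 / s) + v y powr (1 / s)"
proof (cases "x = 0 \<or> y = 0")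
  case True
  then show ?thesis by auto
next
  case False
  define a b where "a = v x powr (1 / s)" and "b = v y powr (1 / s)"
  have vx: "v x = a powr s" and vy: "v y = b powr s" and ab: "a > 0" "b > 0"
    using pos[OF xy(1)] pos[OF xy(2)] False s by (auto simp: a_def b_def powr_powr)
  have "v (x + y) \<le> (a + b) powr s"
  proof (rule le_of_power_le[where A = 1 and B = 1])
    show "v (x + y) \<ge> 0" using xy by (intro nonneg mem_intros)
    fix k
    have "v (x + y) ^ k = v ((x + y) ^ k)"
      using xy by (simp add: power add_mem)
    also have "\<dots> = v (\<Sum>i\<le>k. of_nat (k choose i) * x ^ i * y ^ (k - i))"
      by (simp add: binomial_ring)
    also have "\<dots> \<le> (\<Sum>i\<le>k. v (of_nat (k choose i) * x ^ i * y ^ (k - i)))"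
      using xy by (intro sum_le mem_intros) auto
    also have "\<dots> \<le> (\<Sum>i\<le>k. ((a + b) ^ k) powr s)"
    proof (rule sum_mono)
      fix i assume i: "i \<in> {..k}"
      have "v (of_nat (k choose i) * x ^ i * y ^ (k - i)) = v (of_nat (k choose i)) * v x ^ i * v y ^ (k - i)"
        using xy by (simp add: mult power mem_intros)
      also have "\<dots> = (real (k choose i) * a ^ i * b ^ (k - i)) powr s"
        using i ab by (simp add: vn vx vy powr_mult powr_power powr_realpow[symmetric] powr_powr mult.commute)
      also have "\<dots> \<le> ((a + b) ^ k) powr s"
      proof (rule powr_mono2)
        have "real (k choose i) * a ^ i * b ^ (k - i) \<le> (\<Sum>i\<le>k. real (k choose i) * a ^ i * b ^ (k - i))"
          using i ab by (intro member_le_sum) auto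
        then show "real (k choose i) * a ^ i * b ^ (k - i) \<le> (a + b) ^ k"
          by (simp add: binomial_ring)
      qed (use ab s in auto)
      finally show "v (of_nat (k choose i) * x ^ i * y ^ (k - i)) \<le> ((a + b) ^ k) powr s" .
    qed
    also have "\<dots> = (1 * real k + 1) * ((a + b) powr s) ^ k"
      using ab by (simp add: powr_power powr_realpow[symmetric] powr_powr mult.commute)
    finally show "v (x + y) ^ k \<le> (1 * real k + 1) * ((a + b) powr s) ^ k" .
  qed (use ab in auto)
  then have "v (x + y) powr (1 / s) \<le> ((a + b) powr s) powr (1 / s)"
    using s xy by (intro powr_mono2) (auto intro: nonneg add_mem)
  also have "\<dots> = a + b"
    using s ab by (simp add: powr_powr)
  finally show ?thesis by (simp add: a_def b_def)
qed

text \<open>Expansion of m in base n with d digits: a digit has absolute value at most itself, hence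
  at most n, and since M is at least 1 all powers of M may be replaced by the d-th.\<close>

lemma of_nat_base:
  assumes n: "n \<ge> 2" and M: "M \<ge> 1" "v (of_nat n) \<le> M"
  shows "m < n ^ d \<Longrightarrow> v (of_nat m) \<le> real d * real n * M ^ d"
proof (induction d arbitrary: m)
  case 0
  then show ?case by simp
next
  case (Suc d)
  define q r where "q = m div n" and "r = m mod n"
  have m: "m = q * n + r" and r: "r < n" using n by (auto simp: q_def r_def)
  have q: "q < n ^ d"
    using Suc.prems n by (simp add: q_def less_mult_imp_div_less mult.commute)
  have "v (of_nat m) \<le> v (of_nat q * of_nat n) + v (of_nat r)"
    unfolding m using triangle[of "of_nat q * of_nat n" "of_nat r"] by (simp add: mult_mem)
  also have "\<dots> \<le> (real d * real n * M ^ d) * M + real n * 1"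
    using Suc.IH[OF q] M of_nat_le[of r] r by (auto simp: mult intro!: add_mono mult_mono nonneg)
  also have "\<dots> \<le> (real d * real n * M ^ d) * M + real n * M ^ Suc d"
    using one_le_power[of M "Suc d"] M by (intro add_left_mono mult_left_mono) auto
  also have "\<dots> = real (Suc d) * real n * M ^ Suc d"
    by (simp add: algebra_simps)
  finally show ?case .
qed

text \<open>Ostrowski's argument: m^k has about k ln m / ln n digits in base n, and comparing k-th
  powers for all k removes the linear factor in the resulting bound.\<close>

lemma of_nat_compare:
  assumes n: "n \<ge> 2" and m: "m \<ge> 2" and M: "M \<ge> 1" "v (of_nat n) \<le> M"
  shows "v (of_nat m) \<le> M powr (ln m / ln n)"
proof -
  define L where "L = ln (real m) / ln (real n)"
  have L: "L > 0" using n m by (simp add: L_def)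
  show ?thesis
    unfolding L_def[symmetric]
  proof (rule le_of_power_le[where A = "L * real n * M" and B = "real n * M"])
    show "v (of_nat m) \<ge> 0" by (rule nonneg) simp
    fix k
    \<comment> \<open>One more than the integer part, so that m^k < n^d holds strictly.\<close>
    define d where "d = nat \<lfloor>real k * L\<rfloor> + 1"
    have "real d = of_int \<lfloor>real k * L\<rfloor> + 1"
      using L by (simp add: d_def)
    then have d: "real d \<le> real k * L + 1" "real k * L < real d"
      by linarith+
    have "real (m ^ k) = real n powr (real k * L)"
      using n m by (simp add: powr_def L_def) (metis exp_ln exp_of_nat_mult gr0I not_numeral_le_zero of_nat_0_less_iff)
    also have "\<dots> < real n powr real d"
      using d n by (intro powr_less_mono) auto
    also have "\<dots> = real (n ^ d)"
      using n by (simp add: powr_realpow)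
    finally have "m ^ k < n ^ d" by (simp only: of_nat_less_iff)
    then have "v (of_nat (m ^ k)) \<le> real d * real n * M ^ d"
      by (rule of_nat_base[OF n M])
    also have "\<dots> \<le> (real k * L + 1) * real n * (M powr (real k * L + 1))"
      using d M by (intro mult_mono) (auto simp flip: powr_realpow intro!: powr_mono)
    also have "\<dots> = (L * real n * M * real k + real n * M) * (M powr L) ^ k"
      using M by (simp add: powr_add powr_powr powr_realpow[symmetric] algebra_simps)
    finally show "v (of_nat m) ^ k \<le> (L * real n * M * real k + real n * M) * (M powr L) ^ k"
      by (simp add: power)
  qed (use L M in auto)
qed

text \<open>Comparing two integers in both directions shows that ln v(n) / ln n is constant. One
  integer of absolute value above 1 forces this on all n \<ge> 2, since an n without it, taken as
  base with M = 1, would bound the given integer by 1.\<close>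

lemma archimedean_exponent:
  assumes "v (of_nat m0) > 1"
  obtains s where "s > 0" "\<And>n. n > 0 \<Longrightarrow> v (of_nat n) = real n powr s"
proof -
  have m0: "m0 \<ge> 2"
    using assms by (cases "m0 = 0 \<or> m0 = 1") auto
  have big: "v (of_nat n) > 1" if n: "n \<ge> 2" for n
  proof (rule ccontr)
    assume "\<not> ?thesis"
    then have "v (of_nat m0) \<le> 1 powr (ln m0 / ln n)"
      using of_nat_compare[OF n m0, of 1] by simp
    with assms show False by simp
  qed
  have le: "v (of_nat m) \<le> v (of_nat n) powr (ln m / ln n)" if "m \<ge> 2" "n \<ge> 2" for m n
    using of_nat_compare[of n m "v (of_nat n)"] that big[of n] by simp
  define s where "s = ln (v (of_nat m0)) / ln m0"
  have s: "s > 0" using assms m0 by (simp add: s_def)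
  have "v (of_nat n) = real n powr s" if n: "n > 0" for n
  proof (cases "n = 1")
    case False
    then have n2: "n \<ge> 2" using n by simp
    have 1: "ln (v (of_nat n)) \<le> (ln n / ln m0) * ln (v (of_nat m0))"
      using le[OF n2 m0] big[OF n2] assms by (metis ln_powr ln_mono less_trans zero_less_one powr_gt_zero less_numeral_extra(3) less_irrefl)
    have 2: "ln (v (of_nat m0)) \<le> (ln m0 / ln n) * ln (v (of_nat n))"
      using le[OF m0 n2] big[OF n2] assms by (metis ln_powr ln_mono less_trans zero_less_one powr_gt_zero less_numeral_extra(3) less_irrefl)
    have "ln (real n) > 0" "ln (real m0) > 0" using n2 m0 by auto
    with 1 2 have "ln (v (of_nat n)) = s * ln n"
      using 1 2 unfolding s_def
      by (intro antisym) (simp_all add: divide_simps mult_ac)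
    then show ?thesis
      using big[OF n2] n by (simp add: powr_def) (metis exp_ln less_trans zero_less_one)
  qed simp
  with s that show ?thesis by blast
qed

lemma extends_ArchimedeanI:
  assumes "\<And>n. v (of_nat n) = real n"
  shows "extends_rat_place Archimedean v"
  unfolding extends_rat_place_def
proof
  fix x
  obtain a b where ab: "quotient_of x = (a, b)"
    by (cases "quotient_of x")
  have x: "x = of_int a / of_int b"
    using quotient_of_div[OF ab] by auto
  have "v (of_int c) = \<bar>of_int c\<bar>" for c
    unfolding of_int_eq_nat assms by simp
  then show "v (of_rat x) = rat_place_abs Archimedean x"
    by (simp add: x of_rat_divide divide)
qed

lemma (in -) nonprime_factors:
  fixes p :: nat
  assumes "\<not> prime p" "p > 1"
  obtains a b where "p = a * b" "a < p" "b < p"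
proof -
  obtain a where a: "a dvd p" "a \<noteq> 1" "a \<noteq> p"
    using assms by (auto simp: prime_nat_iff)
  then obtain b where b: "p = a * b" by blast
  have "a > 0" "b > 0" using b assms(2) by (auto intro: Nat.gr0I)
  moreover have "b \<noteq> 1" using a b by auto
  ultimately have "a < p" "b < p" using a b by auto
  with b that show ?thesis by blast
qed

text \<open>The least positive integer of absolute value below 1 is prime by multiplicativity. An
  integer coprime to it cannot be small as well, since a Bezout identity and the ultrametric
  inequality would give 1 < 1.\<close>

lemma nonarchimedean_prime:
  assumes le: "\<And>n. v (of_nat n) \<le> 1" and n: "n > 0" "v (of_nat n) < 1"
  obtains p where "prime p" "v (of_nat p) < 1" "\<And>c. \<not> int p dvd c \<Longrightarrow> v (of_int c) = 1"
proof -
  define p where "p = (LEAST n. n > 0 \<and> v (of_nat n) < 1)"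
  have p: "p > 0" "v (of_nat p) < 1"
    using LeastI[of "\<lambda>n. n > 0 \<and> v (of_nat n) < 1", OF conjI[OF n]] by (auto simp: p_def)
  have least: "v (of_nat m) = 1" if "0 < m" "m < p" for m
    using not_less_Least[of m "\<lambda>n. n > 0 \<and> v (of_nat n) < 1"] that le[of m]
    by (auto simp: p_def)
  have "p \<noteq> 1" using p(2) by auto
  have prime: "prime p"
  proof (rule ccontr)
    assume "\<not> prime p"
    then obtain a b where ab: "p = a * b" "a < p" "b < p"
      using \<open>p \<noteq> 1\<close> p(1) nonprime_factors[of p] by (metis Suc_lessI One_nat_def)
    then have "a > 0" "b > 0" using p(1) by (auto intro: Nat.gr0I)
    then have "v (of_nat p) = 1"
      using ab least by (simp add: mult)
    with p(2) show False by simp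
  qed
  have "v (of_int c) = 1" if c: "\<not> int p dvd c" for c
  proof (rule ccontr)
    assume ne: "v (of_int c) \<noteq> 1"
    have int_le: "v (of_int a) \<le> 1" for a
      unfolding of_int_eq_nat by (rule le)
    with ne have less: "v (of_int c) < 1" by (simp add: less_le)
    have "coprime c (int p)"
      using c prime by (metis coprime_commute prime_imp_coprime prime_nat_int_transfer)
    then obtain s t where st: "s * c + t * int p = 1"
      using bezout_int[of c "int p"] by auto
    have "of_int (s * c + t * int p) = (1 :: complex)"
      unfolding st by simp
    then have eq: "of_int s * of_int c + of_int t * of_nat p = (1 :: complex)" by simp
    have "1 = v (of_int s * of_int c + of_int t * of_nat p)"
      by (simp add: eq)
    also have "\<dots> \<le> max (v (of_int s * of_int c)) (v (of_int t * of_nat p))"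
      by (intro nonarchimedean le mem_intros) auto
    also have "\<dots> < 1"
    proof -
      have "v (of_int s) * v (of_int c) \<le> 1 * v (of_int c)" "v (of_int t) * v (of_nat p) \<le> 1 * v (of_nat p)"
        by (intro mult_right_mono int_le nonneg; simp)+
      then show ?thesis using less p(2) by (simp add: mult)
    qed
    finally show False by simp
  qed
  with that prime p(2) show ?thesis by blast
qed

lemma abs_value_on_powr:
  assumes "\<And>x y. x \<in> K \<Longrightarrow> y \<in> K \<Longrightarrow> v (x + y) powr t \<le> v x powr t + v y powr t"
  shows "abs_value_on K (restrict (\<lambda>x. v x powr t) K)"
  unfolding abs_value_on_def
  using assms by (auto simp: eq_0_iff mult mem_intros nonneg powr_mult)

end

text \<open>On a field of finite dimension, an absolute value trivial on the rationals is bounded by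
  a constant. Applied to all powers of an element this forces the bound 1, and applied to its
  inverse, equality.\<close>

lemma rat_adjoin_trivial:
  assumes alg: "algebraic \<alpha>" and v: "abs_value_on (rat_adjoin \<alpha>) v"
    and triv: "\<And>n. n > 0 \<Longrightarrow> v (of_nat n) = 1" and x: "x \<in> rat_adjoin \<alpha>" "x \<noteq> 0"
  shows "v x = 1"
proof -
  interpret K: rat_field "rat_adjoin \<alpha>"
    by (rule rat_field_rat_adjoin[OF alg])
  interpret V: valued_field "rat_adjoin \<alpha>" v
    by unfold_locales (rule v)
  define n where "n = card (conjs \<alpha>)"
  define C where "C = (\<Sum>j<n. v \<alpha> ^ j)"
  have triv_int: "v (of_int a) \<le> 1" for a
    unfolding V.of_int_eq_nat using triv[of "nat \<bar>a\<bar>"] by (cases "a = 0") auto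
  have triv_rat: "v (of_rat q) \<le> 1" for q
  proof -
    obtain a b where ab: "quotient_of q = (a, b)" by (cases "quotient_of q")
    have q: "q = of_int a / of_int b" "b > 0"
      using quotient_of_div[OF ab] quotient_of_denom_pos[OF ab] by auto
    have "v (of_int b) = 1"
      unfolding V.of_int_eq_nat using triv[of "nat \<bar>b\<bar>"] q(2) by simp
    with q(1) show ?thesis
      using triv_int[of a] by (simp add: of_rat_divide V.divide)
  qed
  have bound: "v y \<le> C" if y: "y \<in> rat_adjoin \<alpha>" for y
  proof -
    obtain Q where Q: "y = (\<Sum>j<n. of_rat (coeff Q j) * \<alpha> ^ j)"
      using rat_adjoin_repr[OF alg y] unfolding n_def by metis
    have "v y \<le> (\<Sum>j<n. v (of_rat (coeff Q j) * \<alpha> ^ j))"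
      unfolding Q using self_in_rat_adjoin[OF alg] by (intro V.sum_le K.mem_intros) auto
    also have "\<dots> \<le> (\<Sum>j<n. 1 * v \<alpha> ^ j)"
      using self_in_rat_adjoin[OF alg] triv_rat
      by (intro sum_mono) (auto simp: V.mult V.power K.power_mem intro!: mult_right_mono V.nonneg
          zero_le_power mult_left_le_one_le)
    finally show ?thesis by (simp add: C_def)
  qed
  have le1: "v y \<le> 1" if y: "y \<in> rat_adjoin \<alpha>" for y
  proof (rule le_of_power_le[where A = 0 and B = C])
    show "v y ^ k \<le> (0 * real k + C) * 1 ^ k" for k
      using bound[of "y ^ k"] y by (simp add: V.power K.power_mem)
    show "C \<ge> 0" using bound[of 1] by simp
  qed (use V.nonneg y in auto)
  have "v x \<le> 1" "v (inverse x) \<le> 1" using le1 x K.inverse_mem by auto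
  then show ?thesis
    using V.inverse[OF x(1)] V.pos[OF x] by (simp add: inverse_le_1_iff)
qed

theorem ostrowski:
  assumes alg: "algebraic \<alpha>" and v: "v \<in> nontrivial_abs_values (rat_adjoin \<alpha>)"
  obtains w p s where "p \<in> rat_places" "extends_rat_place p w" "abs_value_on (rat_adjoin \<alpha>) w"
    "s > 0" "\<And>x. x \<in> rat_adjoin \<alpha> \<Longrightarrow> w x = v x powr s"
proof -
  interpret K: rat_field "rat_adjoin \<alpha>"
    by (rule rat_field_rat_adjoin[OF alg])
  interpret V: valued_field "rat_adjoin \<alpha>" v
    using v by unfold_locales (simp add: nontrivial_abs_values_def)
  let ?w = "\<lambda>s. restrict (\<lambda>x. v x powr s) (rat_adjoin \<alpha>)"
  show ?thesis
  proof (cases "\<exists>m. v (of_nat m) > 1")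
    case True
    then obtain s where s: "s > 0" "\<And>n. n > 0 \<Longrightarrow> v (of_nat n) = real n powr s"
      using V.archimedean_exponent by metis
    have w: "abs_value_on (rat_adjoin \<alpha>) (?w (1 / s))"
      by (intro V.abs_value_on_powr V.archimedean_root s)
    interpret W: valued_field "rat_adjoin \<alpha>" "?w (1 / s)"
      by unfold_locales (rule w)
    have "?w (1 / s) (of_nat n) = real n" for n
      using s by (cases "n = 0") (auto simp: powr_powr)
    then have "extends_rat_place Archimedean (?w (1 / s))"
      by (rule W.extends_ArchimedeanI)
    then show ?thesis
      using w s(1) by (intro that[of Archimedean "?w (1 / s)" "1 / s"]) (auto simp: rat_places_def)
  next
    case False
    then have le: "v (of_nat n) \<le> 1" for n by (meson not_le)
    have "\<exists>n>0. v (of_nat n) \<noteq> 1"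
      using rat_adjoin_trivial[OF alg V.abs_value] v unfolding nontrivial_abs_values_def by blast
    then obtain n where "n > 0" "v (of_nat n) < 1"
      using le by (metis less_le)
    then obtain p where p: "prime p" "v (of_nat p) < 1" "\<And>c. \<not> int p dvd c \<Longrightarrow> v (of_int c) = 1"
      using V.nonarchimedean_prime[OF le] by metis
    have p0: "p > 1" using prime_gt_1_nat[OF p(1)] .
    have vp: "v (of_nat p) > 0"
      using p0 by (intro V.pos) auto
    \<comment> \<open>Chosen so that v(p)^s = 1/p.\<close>
    define s where "s = - ln p / ln (v (of_nat p))"
    have s: "s > 0"
      using p0 p(2) vp by (auto simp: s_def divide_simps)
    have w: "abs_value_on (rat_adjoin \<alpha>) (?w s)"
    proof (rule V.abs_value_on_powr)
      fix x y assume xy: "x \<in> rat_adjoin \<alpha>" "y \<in> rat_adjoin \<alpha>"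
      have "v (x + y) powr s \<le> (max (v x) (v y)) powr s"
        using s xy by (intro powr_mono2 V.nonarchimedean le) (auto intro: V.nonneg K.add_mem)
      also have "\<dots> \<le> v x powr s + v y powr s"
        by (auto simp: max_def)
      finally show "v (x + y) powr s \<le> v x powr s + v y powr s" .
    qed
    interpret W: valued_field "rat_adjoin \<alpha>" "?w s"
      by unfold_locales (rule w)
    have "ln (v (of_nat p)) \<noteq> 0" using vp p(2) by auto
    then have "?w s (of_nat p) = 1 / real p"
      using vp p0 by (simp add: powr_def s_def exp_minus inverse_eq_divide)
    moreover have "?w s (of_int c) = 1" if "\<not> int p dvd c" for c
      using p(3)[OF that] by simp
    ultimately have "extends_rat_place (Padic p) (?w s)"
      by (intro W.extends_PadicI p)
    then show ?thesis
      using w s(1) p(1) by (intro that[of "Padic p" "?w s" s]) (auto simp: rat_places_def)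
  qed
qed

lemma padic_abs_of_nat:
  assumes "prime p"
  shows "padic_abs p (of_nat p) = 1 / real p" "prime q \<Longrightarrow> q \<noteq> p \<Longrightarrow> padic_abs p (of_nat q) = 1"
proof -
  have q: "quotient_of (of_nat n) = (int n, 1)" for n
    using quotient_of_int[of "int n"] by (simp del: quotient_of_int)
  have p: "prime (int p)" using assms by simp
  show "padic_abs p (of_nat p) = 1 / real p"
    using prime_gt_0_nat[OF assms] prime_gt_1_nat[OF assms]
    by (simp add: padic_abs_def q multiplicity_self inverse_eq_divide power_int_minus)
  assume "prime q" "q \<noteq> p"
  then have "\<not> int p dvd int q"
    using assms primes_dvd_imp_eq by (metis int_dvd_int_iff)
  then show "padic_abs p (of_nat q) = 1"
    using prime_gt_0_nat[OF \<open>prime q\<close>] by (simp add: padic_abs_def q not_dvd_imp_multiplicity_0)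
qed

text \<open>Among the primes, a p-adic absolute value is below 1 at its own prime only, while the
  archimedean one is at least 1 at every positive integer. Evaluation at 2 or at the prime then
  fixes s. This gives uniqueness both of the rational place below and of the normalization within a
  class.\<close>

lemma extends_unique:
  assumes p: "p \<in> rat_places" "extends_rat_place p w" and q: "q \<in> rat_places" "extends_rat_place q w'"
    and s: "s > 0" and eq: "\<And>x. w' (of_rat x) = w (of_rat x) powr s"
  shows "p = q \<and> s = 1"
proof -
  have wq: "w' (of_rat x) = rat_place_abs q x" and wp: "w (of_rat x) = rat_place_abs p x" for x
    using p q by (auto simp: extends_rat_place_def)
  have *: "rat_place_abs q (of_nat n) = rat_place_abs p (of_nat n) powr s" for n
    using eq[of "of_nat n"] wq wp by metis
  show ?thesis
  proof (cases p)
    case Archimedean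
    show ?thesis
    proof (cases q)
      case Archimedean
      with * [of 2] \<open>p = Archimedean\<close> have "2 powr s = 2 powr 1" by simp
      then show ?thesis using Archimedean \<open>p = Archimedean\<close> powr_inj[of 2 s 1] by auto
    next
      case (Padic r)
      then have r: "prime r" using q by (auto simp: rat_places_def)
      have "1 / real r = real r powr s"
        using *[of r] padic_abs_of_nat(1)[OF r] Padic Archimedean by simp
      moreover have "real r powr s > 1" using s prime_gt_1_nat[OF r] by simp
      moreover have "1 / real r < 1" using prime_gt_1_nat[OF r] by simp
      ultimately show ?thesis by linarith
    qed
  next
    case (Padic r)
    then have r: "prime r" using p by (auto simp: rat_places_def)
    have r1: "r > 1" using prime_gt_1_nat[OF r] .
    have **: "rat_place_abs q (of_nat r) = (1 / real r) powr s"
      using *[of r] padic_abs_of_nat(1)[OF r] Padic by simp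
    have less: "(1 / real r) powr s < 1"
      using s r1 by (simp add: powr_divide divide_simps)
    show ?thesis
    proof (cases q)
      case Archimedean
      then show ?thesis using ** less r1 by simp
    next
      case (Padic t)
      then have t: "prime t" using q by (auto simp: rat_places_def)
      have "t = r"
        using ** less padic_abs_of_nat(2)[OF t r] Padic by (cases "t = r") auto
      moreover have "s = 1"
      proof -
        have "(1 / real r) powr s = (1 / real r) powr 1"
          using ** padic_abs_of_nat(1)[OF r] Padic \<open>t = r\<close> by simp
        then have "real r powr s = real r powr 1"
          using r1 by (simp add: powr_divide)
        then show ?thesis using r1 powr_inj[of "real r" s 1] by auto
      qed
      ultimately show ?thesis using Padic \<open>p = Padic r\<close> by simp
    qed
  qed
qed

section \<open>Places as normalized absolute values\<close>

definition normalized_abs_values :: "complex set \<Rightarrow> (complex \<Rightarrow> real) set" where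
  "normalized_abs_values K = {w. abs_value_on K w \<and> (\<exists>p\<in>rat_places. extends_rat_place p w)}"

lemma normalized_nontrivial:
  assumes "rat_field K" "w \<in> normalized_abs_values K"
  shows "w \<in> nontrivial_abs_values K"
proof -
  interpret rat_field K by fact
  obtain p where p: "p \<in> rat_places" "extends_rat_place p w" and w: "abs_value_on K w"
    using assms(2) by (auto simp: normalized_abs_values_def)
  have wp: "w (of_rat x) = rat_place_abs p x" for x
    using p by (auto simp: extends_rat_place_def)
  have "\<exists>n>0. rat_place_abs p (of_nat n) \<noteq> 1"
  proof (cases p)
    case Archimedean
    then show ?thesis by (intro exI[of _ 2]) simp
  next
    case (Padic r)
    then have r: "prime r" using p by (auto simp: rat_places_def)
    then show ?thesis
      using Padic padic_abs_of_nat(1)[OF r] prime_gt_1_nat[OF r] by (intro exI[of _ r]) auto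
  qed
  then obtain n where "n > 0" "rat_place_abs p (of_nat n) \<noteq> 1" by blast
  then have "w (of_nat n) \<noteq> 1" "(of_nat n :: complex) \<noteq> 0"
    using wp[of "of_nat n"] by auto
  with w show ?thesis
    unfolding nontrivial_abs_values_def by (intro CollectI conjI bexI[of _ "of_nat n"]) auto
qed

lemma equiv_abs_value_equiv:
  assumes "rat_field K"
  shows "equiv (nontrivial_abs_values K) (abs_value_equiv K)"
proof (rule equivI)
  show "abs_value_equiv K \<subseteq> nontrivial_abs_values K \<times> nontrivial_abs_values K"
    by (auto simp: abs_value_equiv_def)
  have pos: "v x \<ge> 0" if "v \<in> nontrivial_abs_values K" "x \<in> K" for v x
    using that by (auto simp: nontrivial_abs_values_def abs_value_on_def)
  show "refl_on (nontrivial_abs_values K) (abs_value_equiv K)"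
    by (rule refl_onI) (auto simp: abs_value_equiv_def pos intro!: exI[of _ 1])
  show "sym (abs_value_equiv K)"
  proof (rule symI)
    fix v w assume vw: "(v, w) \<in> abs_value_equiv K"
    then obtain s where s: "s > 0" "\<forall>x\<in>K. w x = v x powr s"
      by (auto simp: abs_value_equiv_def)
    then show "(w, v) \<in> abs_value_equiv K"
      using vw pos by (auto simp: abs_value_equiv_def powr_powr intro!: exI[of _ "1 / s"])
  qed
  show "trans (abs_value_equiv K)"
  proof (rule transI)
    fix u v w assume uv: "(u, v) \<in> abs_value_equiv K" "(v, w) \<in> abs_value_equiv K"
    then obtain s t where "s > 0" "\<forall>x\<in>K. v x = u x powr s" "t > 0" "\<forall>x\<in>K. w x = v x powr t"
      by (auto simp: abs_value_equiv_def)
    then show "(u, w) \<in> abs_value_equiv K"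
      using uv by (auto simp: abs_value_equiv_def powr_powr intro!: exI[of _ "s * t"])
  qed
qed

text \<open>Two normalized members of one class differ by an exponent s, which must be 1;
  extensionality then makes them equal, so exactly one function meets the \<open>THE\<close> in
  \<open>place_norm\<close>.\<close>

lemma place_norm_eq:
  assumes K: "rat_field K" and V: "V \<in> places K" and w: "w \<in> V" and p: "p \<in> rat_places" "extends_rat_place p w"
  shows "place_norm V = w"
  unfolding place_norm_def
proof (rule the_equality)
  interpret rat_field K by fact
  show "w \<in> V \<and> (\<exists>p\<in>rat_places. extends_rat_place p w)"
    using w p by blast
  fix w' assume w': "w' \<in> V \<and> (\<exists>p\<in>rat_places. extends_rat_place p w')"
  then obtain q where q: "q \<in> rat_places" "extends_rat_place q w'" by blast
  have "(w, w') \<in> abs_value_equiv K"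
    using V w w' quotient_eq_iff[OF equiv_abs_value_equiv[OF K]] unfolding places_def by blast
  then obtain s where s: "s > 0" "\<forall>x\<in>K. w' x = w x powr s"
    and ab: "abs_value_on K w" "abs_value_on K w'"
    by (auto simp: abs_value_equiv_def nontrivial_abs_values_def)
  have "s = 1"
    using extends_unique[OF p q s(1)] s(2) by simp
  then have "w' x = w x" if "x \<in> K" for x
    using s(2) ab(1) that by (simp add: abs_value_on_def)
  with ab show "w' = w"
    by (intro extensionalityI[of _ K]) (auto simp: abs_value_on_def)
qed

text \<open>Ostrowski's theorem supplies a normalized member in each class. The bijection lets a
  product over places, which are classes, be taken over functions grouped by the rational place
  below.\<close>

lemma place_norm_bij:
  assumes alg: "algebraic \<alpha>"
  shows "bij_betw place_norm (places (rat_adjoin \<alpha>)) (normalized_abs_values (rat_adjoin \<alpha>))"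
    and "V \<in> places (rat_adjoin \<alpha>) \<Longrightarrow> place_norm V \<in> V"
proof -
  let ?K = "rat_adjoin \<alpha>"
  note K = rat_field_rat_adjoin[OF alg]
  interpret K: rat_field ?K by (rule K)
  note eqv = equiv_abs_value_equiv[OF K]
  have *: "place_norm V \<in> V \<and> place_norm V \<in> normalized_abs_values ?K" if V: "V \<in> places ?K" for V
  proof -
    obtain v where v: "v \<in> nontrivial_abs_values ?K" "V = abs_value_equiv ?K `` {v}"
      using V by (auto simp: places_def elim: quotientE)
    obtain w p s where w: "p \<in> rat_places" "extends_rat_place p w" "abs_value_on ?K w"
      "s > 0" "\<And>x. x \<in> ?K \<Longrightarrow> w x = v x powr s"
      using ostrowski[OF alg v(1)] by metis
    have wn: "w \<in> normalized_abs_values ?K"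
      using w by (auto simp: normalized_abs_values_def)
    then have "w \<in> V"
      using normalized_nontrivial[OF K] v w(4,5) by (auto simp: abs_value_equiv_def)
    moreover from this have "place_norm V = w"
      by (rule place_norm_eq[OF K V _ w(1,2)])
    ultimately show ?thesis using wn by simp
  qed
  then show "V \<in> places ?K \<Longrightarrow> place_norm V \<in> V" by blast
  show "bij_betw place_norm (places ?K) (normalized_abs_values ?K)"
  proof (rule bij_betwI')
    fix V W assume VW: "V \<in> places ?K" "W \<in> places ?K"
    show "place_norm V = place_norm W \<longleftrightarrow> V = W"
    proof
      assume eq: "place_norm V = place_norm W"
      then have "place_norm V \<in> V \<inter> W" using *[OF VW(1)] *[OF VW(2)] by auto
      then show "V = W"
        using VW quotient_disj[OF eqv] unfolding places_def by blast
    qed simp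
  next
    fix w assume w: "w \<in> normalized_abs_values ?K"
    then have wn: "w \<in> nontrivial_abs_values ?K" by (rule normalized_nontrivial[OF K])
    define V where "V = abs_value_equiv ?K `` {w}"
    have "V \<in> places ?K" "w \<in> V"
      using wn equiv_class_self[OF eqv wn] by (auto simp: V_def places_def intro: quotientI)
    moreover obtain p where "p \<in> rat_places" "extends_rat_place p w"
      using w by (auto simp: normalized_abs_values_def)
    ultimately show "\<exists>V\<in>places ?K. w = place_norm V"
      using place_norm_eq[OF K] by metis
  qed (use * in blast)
qed

section \<open>Weak approximation\<close>

text \<open>If v(y) < w(y), a rational power of the common value \<gamma> of a rational number c
  fits between them, so that a suitable t = y^n / c^a has v(t) < 1 < w(t), against
  \<open>dom\<close>. Applying the resulting inequality to x and 1/x gives equality. Two fields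
  occur because the lemma both compares absolute values of K and shows that one on a larger field
  extends one on K.\<close>

lemma abs_value_dominated:
  assumes K: "rat_field K" and v: "abs_value_on K v" and L: "rat_field L" and w: "abs_value_on L w"
    and KL: "K \<subseteq> L" and p: "p \<in> rat_places" and ext: "extends_rat_place p v" "extends_rat_place p w"
    and dom: "\<And>x. x \<in> K \<Longrightarrow> v x < 1 \<Longrightarrow> w x \<le> 1" and x: "x \<in> K"
  shows "w x = v x"
proof -
  interpret V: valued_field K v
    using K v by (simp add: valued_field_def valued_field_axioms_def)
  interpret W: valued_field L w
    using L w by (simp add: valued_field_def valued_field_axioms_def)
  have "\<exists>q. 0 < rat_place_abs p q \<and> rat_place_abs p q < 1"
  proof (cases p)
    case Archimedean
    then show ?thesis by (intro exI[of _ "1 / 2"]) (simp add: of_rat_divide)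
  next
    case (Padic r)
    then have r: "prime r" using p by (auto simp: rat_places_def)
    then show ?thesis
      using Padic padic_abs_of_nat(1)[OF r] prime_gt_1_nat[OF r] by (intro exI[of _ "of_nat r"]) auto
  qed
  then obtain q where q: "0 < rat_place_abs p q" "rat_place_abs p q < 1" by blast
  define c where "c = complex_of_rat q"
  define \<gamma> where "\<gamma> = rat_place_abs p q"
  have c: "v c = \<gamma>" "w c = \<gamma>" "c \<in> K" "c \<in> L"
    using ext by (auto simp: extends_rat_place_def c_def \<gamma>_def)
  have \<gamma>: "0 < \<gamma>" "\<gamma> < 1" using q by (auto simp: \<gamma>_def)
  have le: "w y \<le> v y" if y: "y \<in> K" "y \<noteq> 0" for y
  proof (rule ccontr)
    assume "\<not> w y \<le> v y"
    then have less: "v y < w y" by simp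
    have yL: "y \<in> L" using y KL by auto
    have vy: "0 < v y" using V.pos y by simp
    have "ln (w y) / ln \<gamma> < ln (v y) / ln \<gamma>"
      using less vy \<gamma> by (intro divide_strict_right_mono_neg) auto
    then obtain r where r: "r \<in> \<rat>" "ln (w y) / ln \<gamma> < r" "r < ln (v y) / ln \<gamma>"
      using Rats_dense_in_real by blast
    obtain a b where ab: "b > 0" "r = of_int a / of_int b"
      using r(1) by (elim Rats_cases')
    define n where "n = nat b"
    have n: "n > 0" "r * real n = of_int a"
      using ab by (auto simp: n_def)
    have 1: "v y < \<gamma> powr r" "\<gamma> powr r < w y"
    proof -
      have "ln (v y) < r * ln \<gamma>" "r * ln \<gamma> < ln (w y)"
        using r(2,3) \<gamma> by (auto simp: neg_less_divide_eq neg_divide_less_eq)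
      then have "exp (ln (v y)) < exp (r * ln \<gamma>)" "exp (r * ln \<gamma>) < exp (ln (w y))"
        by (simp_all only: exp_less_cancel_iff)
      then show "v y < \<gamma> powr r" "\<gamma> powr r < w y"
        using vy less \<gamma> by (simp_all add: powr_def)
    qed
    have "(\<gamma> powr r) ^ n = \<gamma> powr (r * real n)"
      using \<gamma> by (simp add: powr_powr flip: powr_realpow)
    also have "\<dots> = \<gamma> powi a"
      unfolding n(2) using \<gamma> by (simp add: powr_real_of_int')
    finally have pow: "(\<gamma> powr r) ^ n = \<gamma> powi a" .
    have 2: "v y ^ n < \<gamma> powi a" "\<gamma> powi a < w y ^ n"
      unfolding pow[symmetric] using 1 vy n \<gamma> by (auto intro!: power_strict_mono)
    have \<gamma>a: "\<gamma> powi a > 0" using \<gamma> by simp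
    define t where "t = y ^ n / c powi a"
    have t: "t \<in> K" "v t = v y ^ n / \<gamma> powi a" "w t = w y ^ n / \<gamma> powi a"
      unfolding t_def using y yL c
      by (simp_all add: V.mem_intros V.divide V.power V.power_int W.mem_intros W.divide W.power W.power_int)
    have "v t < 1" "w t > 1" using 2 \<gamma>a t by simp_all
    with dom t(1) show False by force
  qed
  show ?thesis
  proof (cases "x = 0")
    case False
    then have "w x \<le> v x" "w (inverse x) \<le> v (inverse x)"
      using le[of x] le[of "inverse x"] x V.inverse_mem by auto
    moreover have "w (inverse x) = inverse (w x)" "v (inverse x) = inverse (v x)"
      using V.inverse W.inverse x KL by auto
    moreover have "v x > 0" "w x > 0" using V.pos W.pos x False KL by auto
    ultimately show ?thesis by (simp add: le_imp_inverse_le)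
  qed simp
qed

context valued_field
begin

text \<open>The fraction tends to 1 where x has absolute value above 1 and to 0 where it has
  absolute value below 1; it turns separation by strict inequalities into approximation.\<close>

lemma tendsto_approx_one:
  assumes x: "x \<in> K" "v x > 1"
  shows "(\<lambda>N. v (x ^ N / (1 + x ^ N) - 1)) \<longlonglongrightarrow> 0"
proof (rule tendsto_sandwich[where f = "\<lambda>_. 0" and h = "\<lambda>N. inverse (v x ^ N + (-1))"])
  have lim: "filterlim (\<lambda>N. v x ^ N) at_top sequentially"
    using x by (intro filterlim_at_infinity_imp_filterlim_at_top filterlim_realpow_sequentially_gt1) auto
  have "filterlim (\<lambda>N. v x ^ N + (-1)) at_top sequentially"
    unfolding add.commute[of _ "-1"]
    by (rule filterlim_tendsto_add_at_top[OF tendsto_const lim])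
  then show "(\<lambda>N. inverse (v x ^ N + (-1))) \<longlonglongrightarrow> 0"
    by (rule tendsto_inverse_0_at_top)
  show "(\<lambda>N. 0) \<longlonglongrightarrow> (0 :: real)" by simp
  show "\<forall>\<^sub>F N in sequentially. 0 \<le> v (x ^ N / (1 + x ^ N) - 1)"
    using x by (intro always_eventually allI nonneg mem_intros) auto
  show "\<forall>\<^sub>F N in sequentially. v (x ^ N / (1 + x ^ N) - 1) \<le> inverse (v x ^ N + (-1))"
  proof (rule eventually_sequentiallyI[of 1])
    fix N :: nat assume N: "N \<ge> 1"
    have gt: "v x ^ N > 1" using x N by (intro one_less_power) auto
    have "v x ^ N = v ((1 + x ^ N) - 1)" using x by (simp add: power)
    also have "\<dots> \<le> v (1 + x ^ N) + 1"
      using triangle_diff[of "1 + x ^ N" 1] x by (simp add: mem_intros)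
    finally have le: "v x ^ N - 1 \<le> v (1 + x ^ N)" by simp
    then have ne: "1 + x ^ N \<noteq> 0" using gt by auto
    have "x ^ N / (1 + x ^ N) - 1 = - inverse (1 + x ^ N)"
      using ne by (simp add: field_simps)
    then have "v (x ^ N / (1 + x ^ N) - 1) = inverse (v (1 + x ^ N))"
      using x by (simp add: uminus inverse mem_intros)
    also have "\<dots> \<le> inverse (v x ^ N + (-1))"
      using le gt by (intro le_imp_inverse_le) auto
    finally show "v (x ^ N / (1 + x ^ N) - 1) \<le> inverse (v x ^ N + (-1))" .
  qed
qed

lemma tendsto_approx_zero:
  assumes x: "x \<in> K" "v x < 1"
  shows "(\<lambda>N. v (x ^ N / (1 + x ^ N))) \<longlonglongrightarrow> 0"
proof (rule tendsto_sandwich[where f = "\<lambda>_. 0" and h = "\<lambda>N. v x ^ N / (1 - v x ^ N)"])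
  have lim: "(\<lambda>N. v x ^ N) \<longlonglongrightarrow> 0"
    using x nonneg by (intro LIMSEQ_power_zero) auto
  have "(\<lambda>N. v x ^ N / (1 - v x ^ N)) \<longlonglongrightarrow> 0 / (1 - 0)"
    by (intro tendsto_intros lim) auto
  then show "(\<lambda>N. v x ^ N / (1 - v x ^ N)) \<longlonglongrightarrow> 0" by simp
  show "(\<lambda>N. 0) \<longlonglongrightarrow> (0 :: real)" by simp
  show "\<forall>\<^sub>F N in sequentially. 0 \<le> v (x ^ N / (1 + x ^ N))"
    using x by (intro always_eventually allI nonneg mem_intros) auto
  show "\<forall>\<^sub>F N in sequentially. v (x ^ N / (1 + x ^ N)) \<le> v x ^ N / (1 - v x ^ N)"
  proof (rule eventually_sequentiallyI[of 1])
    fix N :: nat assume N: "N \<ge> 1"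
    have lt: "v x ^ N < 1" using x N nonneg by (intro power_less_one_iff[THEN iffD2]) auto
    have "1 \<le> v (1 + x ^ N) + v x ^ N"
      using triangle_diff[of "1 + x ^ N" "x ^ N"] x by (simp add: mem_intros power)
    then have le: "1 - v x ^ N \<le> v (1 + x ^ N)" by simp
    have "v (x ^ N / (1 + x ^ N)) = v x ^ N / v (1 + x ^ N)"
      using x by (simp add: divide power mem_intros)
    also have "\<dots> \<le> v x ^ N / (1 - v x ^ N)"
      using le lt x nonneg by (intro divide_left_mono mult_pos_pos) auto
    finally show "v (x ^ N / (1 + x ^ N)) \<le> v x ^ N / (1 - v x ^ N)" .
  qed
qed

lemma tendsto_abs_one:
  assumes "\<And>N. f N \<in> K" "(\<lambda>N. v (f N - 1)) \<longlonglongrightarrow> 0"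
  shows "(\<lambda>N. v (f N)) \<longlonglongrightarrow> 1"
proof -
  have "(\<lambda>N. v (f N) - 1) \<longlonglongrightarrow> 0"
    by (rule Lim_null_comparison[OF _ assms(2)])
      (use abs_diff_le[of _ 1] assms(1) in auto)
  then show ?thesis
    using tendsto_add[of "\<lambda>N. v (f N) - 1" 0 sequentially "\<lambda>_. 1" 1] by simp
qed

end

section \<open>Separating the absolute values over one rational place\<close>

definition abs_values_over :: "complex set \<Rightarrow> rat_place \<Rightarrow> (complex \<Rightarrow> real) set" where
  "abs_values_over K p = {v. abs_value_on K v \<and> extends_rat_place p v}"

lemma valued_fieldI: "rat_field K \<Longrightarrow> v \<in> abs_values_over K p \<Longrightarrow> valued_field K v"
  by (simp add: abs_values_over_def valued_field_def valued_field_axioms_def)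

text \<open>Without such an x, u(x) < 1 would always imply v(x) \<le> 1, and
  \<open>abs_value_dominated\<close> would identify u and v.\<close>

lemma separate_pair:
  assumes K: "rat_field K" and p: "p \<in> rat_places"
    and v: "v \<in> abs_values_over K p" and u: "u \<in> abs_values_over K p" and "v \<noteq> u"
  obtains x where "x \<in> K" "v x > 1" "u x < 1"
proof -
  have "\<exists>x\<in>K. u x < 1 \<and> \<not> v x \<le> 1"
  proof (rule ccontr)
    assume "\<not> ?thesis"
    then have "v x = u x" if "x \<in> K" for x
      using that abs_value_dominated[OF K _ K _ order_refl p, of u v x] u v
      by (auto simp: abs_values_over_def)
    then have "v = u"
      using u v by (intro extensionalityI[of _ K]) (auto simp: abs_values_over_def abs_value_on_def)
    with \<open>v \<noteq> u\<close> show False by simp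
  qed
  with that show ?thesis by force
qed

text \<open>Let x separate v from V, and y separate v from the new u. If u(x) = 1, a high power of x
  times y works. If u(x) > 1, the multiplier x^N / (1 + x^N) takes the place of x^N, as it tends to
  1 at u and v and to 0 on V.\<close>

lemma separate_many:
  assumes K: "rat_field K" and p: "p \<in> rat_places" and v: "v \<in> abs_values_over K p"
    and V: "finite V" "V \<subseteq> abs_values_over K p" "v \<notin> V"
  shows "\<exists>x\<in>K. v x > 1 \<and> (\<forall>u\<in>V. u x < 1)"
  using V
proof (induction V rule: finite_induct)
  case empty
  interpret valued_field K v by (rule valued_fieldI[OF K v])
  have "\<exists>q. rat_place_abs p q > 1"
  proof (cases p)
    case Archimedean
    then show ?thesis by (intro exI[of _ 2]) simp
  next
    case (Padic r)
    then have r: "prime r" using p by (auto simp: rat_places_def)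
    have vr: "v (of_nat r) = 1 / real r"
      using v Padic padic_abs_of_nat(1)[OF r] by (auto simp: abs_values_over_def extends_rat_place_def)
        (metis of_rat_of_nat_eq)
    have "v (of_rat (1 / of_nat r)) = real r"
      using vr by (simp add: of_rat_divide divide)
    then show ?thesis
      using v prime_gt_1_nat[OF r] by (auto simp: abs_values_over_def extends_rat_place_def intro!: exI[of _ "1 / of_nat r"])
  qed
  then obtain q where "rat_place_abs p q > 1" by blast
  then show ?case
    using v by (intro bexI[of _ "of_rat q"]) (auto simp: abs_values_over_def extends_rat_place_def)
next
  case (insert u V)
  interpret v: valued_field K v by (rule valued_fieldI[OF K v])
  have u: "u \<in> abs_values_over K p" using insert by auto
  interpret u: valued_field K u by (rule valued_fieldI[OF K u])
  have vf: "valued_field K v'" if "v' \<in> V" for v'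
    using insert that by (intro valued_fieldI[OF K, of _ p]) auto
  obtain x where x: "x \<in> K" "v x > 1" "\<And>v'. v' \<in> V \<Longrightarrow> v' x < 1"
    using insert by blast
  obtain y where y: "y \<in> K" "v y > 1" "u y < 1"
    using separate_pair[OF K p v u] insert by blast
  consider "u x < 1" | "u x = 1" | "u x > 1" by linarith
  then show ?case
  proof cases
    case 1
    with x show ?thesis by (intro bexI[of _ x]) auto
  next
    case 2
    have "\<forall>\<^sub>F N in sequentially. v' (x ^ N * y) < 1" if v': "v' \<in> V" for v'
    proof -
      interpret v': valued_field K v' by (rule vf[OF v'])
      have "(\<lambda>N. v' x ^ N * v' y) \<longlonglongrightarrow> 0 * v' y"
        using x(1) x(3)[OF v'] v'.nonneg by (intro tendsto_intros LIMSEQ_power_zero) auto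
      then have "\<forall>\<^sub>F N in sequentially. v' x ^ N * v' y < 1"
        by (intro order_tendstoD(2)[where y = "0 * v' y"]) auto
      then show ?thesis
        using x y by (simp add: v'.mult v'.power v.power_mem)
    qed
    then have "\<forall>\<^sub>F N in sequentially. \<forall>v'\<in>V. v' (x ^ N * y) < 1"
      using insert by (intro eventually_ball_finite) auto
    then obtain N where N: "\<forall>v'\<in>V. v' (x ^ N * y) < 1"
      unfolding eventually_sequentially by blast
    have "v (x ^ N * y) > 1"
    proof -
      have "v x ^ N \<ge> 1" using x by simp
      then have "1 * v y \<le> v x ^ N * v y" using y by (intro mult_right_mono) auto
      then have "1 < v x ^ N * v y" using y by linarith
      then show ?thesis using x y by (simp add: v.mult v.power v.power_mem)
    qed
    moreover have "u (x ^ N * y) < 1"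
      using x y 2 by (simp add: u.mult u.power v.power_mem)
    ultimately show ?thesis
      using N x y by (intro bexI[of _ "x ^ N * y"]) (auto simp: v.mem_intros)
  next
    case 3
    let ?t = "\<lambda>N. x ^ N / (1 + x ^ N)"
    have t: "?t N \<in> K" for N using x by (intro v.mem_intros) auto
    have "(\<lambda>N. v (?t N) * v y) \<longlonglongrightarrow> 1 * v y"
      using v.tendsto_abs_one[of ?t] v.tendsto_approx_one[OF x(1,2)] t by (intro tendsto_intros) auto
    then have ev1: "\<forall>\<^sub>F N in sequentially. v (?t N) * v y > 1"
      by (rule order_tendstoD) (use y in simp)
    have "(\<lambda>N. u (?t N) * u y) \<longlonglongrightarrow> 1 * u y"
      using u.tendsto_abs_one[of ?t] u.tendsto_approx_one[OF x(1) 3] t by (intro tendsto_intros) auto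
    then have ev2: "\<forall>\<^sub>F N in sequentially. u (?t N) * u y < 1"
      by (rule order_tendstoD) (use y in simp)
    have "\<forall>\<^sub>F N in sequentially. v' (?t N * y) < 1" if v': "v' \<in> V" for v'
    proof -
      interpret v': valued_field K v' by (rule vf[OF v'])
      have "(\<lambda>N. v' (?t N) * v' y) \<longlonglongrightarrow> 0 * v' y"
        using v'.tendsto_approx_zero[OF x(1) x(3)[OF v']] by (intro tendsto_intros)
      then have "\<forall>\<^sub>F N in sequentially. v' (?t N) * v' y < 1"
        by (intro order_tendstoD(2)[where y = "0 * v' y"]) auto
      then show ?thesis
        using t y by (simp add: v'.mult del: times_divide_eq_left)
    qed
    then have ev3: "\<forall>\<^sub>F N in sequentially. \<forall>v'\<in>V. v' (?t N * y) < 1"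
      using insert by (intro eventually_ball_finite) auto
    obtain N where N: "v (?t N) * v y > 1" "u (?t N) * u y < 1" "\<forall>v'\<in>V. v' (?t N * y) < 1"
      using eventually_conj[OF ev1 eventually_conj[OF ev2 ev3]] unfolding eventually_sequentially by blast
    have "?t N * y \<in> K" "v (?t N * y) > 1" "u (?t N * y) < 1"
      using N t y by (simp_all add: u.mult v.mult v.mult_mem del: times_divide_eq_left)
    with N(3) show ?thesis
      by (intro bexI[of _ "?t N * y"]) auto
  qed
qed

theorem weak_approximation:
  assumes K: "rat_field K" and p: "p \<in> rat_places" and v: "v \<in> abs_values_over K p"
    and V: "finite V" "V \<subseteq> abs_values_over K p" "v \<notin> V" and e: "e > 0"
  obtains b where "b \<in> K" "v (b - 1) < e" "\<And>u. u \<in> V \<Longrightarrow> u b < e"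
proof -
  interpret v: valued_field K v by (rule valued_fieldI[OF K v])
  obtain x where x: "x \<in> K" "v x > 1" "\<And>u. u \<in> V \<Longrightarrow> u x < 1"
    using separate_many[OF K p v V] by blast
  let ?t = "\<lambda>N. x ^ N / (1 + x ^ N)"
  have ev1: "\<forall>\<^sub>F N in sequentially. v (?t N - 1) < e"
    by (rule order_tendstoD(2)[OF v.tendsto_approx_one[OF x(1,2)] e])
  have "\<forall>\<^sub>F N in sequentially. u (?t N) < e" if u: "u \<in> V" for u
  proof -
    interpret u: valued_field K u
      using V u by (intro valued_fieldI[OF K, of _ p]) auto
    show ?thesis
      by (rule order_tendstoD(2)[OF u.tendsto_approx_zero[OF x(1) x(3)[OF u]] e])
  qed
  then have ev2: "\<forall>\<^sub>F N in sequentially. \<forall>u\<in>V. u (?t N) < e"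
    using V by (intro eventually_ball_finite) auto
  obtain N where "v (?t N - 1) < e" "\<forall>u\<in>V. u (?t N) < e"
    using eventually_conj[OF ev1 ev2] unfolding eventually_sequentially by blast
  then show ?thesis
    using x by (intro that[of "?t N"]) (auto intro!: v.mem_intros)
qed

section \<open>Convergence in a valued field\<close>

definition lim_in :: "(complex \<Rightarrow> real) \<Rightarrow> (nat \<Rightarrow> complex) \<Rightarrow> complex \<Rightarrow> bool" where
  "lim_in v x l \<longleftrightarrow> (\<lambda>m. v (x m - l)) \<longlonglongrightarrow> 0"

definition cauchy_in :: "(complex \<Rightarrow> real) \<Rightarrow> (nat \<Rightarrow> complex) \<Rightarrow> bool" where
  "cauchy_in v x \<longleftrightarrow> (\<forall>e>0. \<exists>N. \<forall>m\<ge>N. \<forall>n\<ge>N. v (x m - x n) < e)"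

context valued_field
begin

lemma null_comparison:
  assumes "\<And>m. x m \<in> K" "\<And>m. v (x m) \<le> f m" "f \<longlonglongrightarrow> 0"
  shows "(\<lambda>m. v (x m)) \<longlonglongrightarrow> 0"
  by (rule Lim_null_comparison[OF _ assms(3)]) (use assms nonneg in auto)

lemma null_add:
  assumes "\<And>m. x m \<in> K" "\<And>m. y m \<in> K" "(\<lambda>m. v (x m)) \<longlonglongrightarrow> 0" "(\<lambda>m. v (y m)) \<longlonglongrightarrow> 0"
  shows "(\<lambda>m. v (x m + y m)) \<longlonglongrightarrow> 0"
  by (rule null_comparison[of _ "\<lambda>m. v (x m) + v (y m)"])
    (use assms in \<open>auto intro: mem_intros triangle tendsto_add_zero\<close>)

lemma null_sum:
  assumes "\<And>i m. i \<in> I \<Longrightarrow> x i m \<in> K" "\<And>i. i \<in> I \<Longrightarrow> (\<lambda>m. v (x i m)) \<longlonglongrightarrow> 0"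
  shows "(\<lambda>m. v (\<Sum>i\<in>I. x i m)) \<longlonglongrightarrow> 0"
  using assms
  by (induction I rule: infinite_finite_induct) (auto intro!: null_add sum_mem)

lemma null_mult:
  assumes "\<And>m. x m \<in> K" "\<And>m. y m \<in> K" "(\<lambda>m. v (x m)) \<longlonglongrightarrow> 0" "(\<lambda>m. v (y m)) \<longlonglongrightarrow> c"
  shows "(\<lambda>m. v (x m * y m)) \<longlonglongrightarrow> 0"
  using tendsto_mult[OF assms(3,4)] assms(1,2) by (simp add: mult)

lemma lim_in_const: "lim_in v (\<lambda>_. a) a"
  by (simp add: lim_in_def)

lemma lim_in_abs:
  assumes "\<And>m. x m \<in> K" "l \<in> K" "lim_in v x l"
  shows "(\<lambda>m. v (x m)) \<longlonglongrightarrow> v l"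
proof -
  have "(\<lambda>m. v (x m) - v l) \<longlonglongrightarrow> 0"
    by (rule Lim_null_comparison[OF _ assms(3)[unfolded lim_in_def]])
      (use assms abs_diff_le in auto)
  then show ?thesis by (simp add: LIM_zero_iff)
qed

lemma lim_in_add:
  assumes "\<And>m. x m \<in> K" "\<And>m. y m \<in> K" "a \<in> K" "b \<in> K" "lim_in v x a" "lim_in v y b"
  shows "lim_in v (\<lambda>m. x m + y m) (a + b)"
proof -
  have "(\<lambda>m. v ((x m - a) + (y m - b))) \<longlonglongrightarrow> 0"
    using assms by (intro null_add) (auto simp: lim_in_def mem_intros)
  then show ?thesis by (simp add: lim_in_def algebra_simps)
qed

lemma lim_in_mult:
  assumes "\<And>m. x m \<in> K" "\<And>m. y m \<in> K" "a \<in> K" "b \<in> K" "lim_in v x a" "lim_in v y b"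
  shows "lim_in v (\<lambda>m. x m * y m) (a * b)"
proof -
  have "(\<lambda>m. v ((x m - a) * y m + (y m - b) * a)) \<longlonglongrightarrow> 0"
    using assms lim_in_abs[OF assms(2,4,6)]
    by (intro null_add null_mult[where c = "v b"] null_mult[where c = "v a"])
      (auto simp: lim_in_def mem_intros)
  then show ?thesis by (simp add: lim_in_def algebra_simps)
qed

lemma lim_in_uminus:
  assumes "\<And>m. x m \<in> K" "a \<in> K" "lim_in v x a"
  shows "lim_in v (\<lambda>m. - x m) (- a)"
  using lim_in_mult[of "\<lambda>_. -1" x "-1" a] assms lim_in_const uminus_mem[of 1] by simp

lemma lim_in_power:
  assumes "\<And>m. x m \<in> K" "a \<in> K" "lim_in v x a"
  shows "lim_in v (\<lambda>m. x m ^ k) (a ^ k)"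
  by (induction k) (auto intro!: lim_in_mult lim_in_const assms mem_intros)

text \<open>The index maps and the filter F are left general so that one estimate covers convergence
  of inverses (one index) and their Cauchy property (two indices and the product filter). The
  convention that 0 has inverse 0 is harmless because the sequences are eventually nonzero.\<close>

lemma null_inverse_diff:
  assumes x: "\<And>m. x m \<in> K" and y: "\<And>m. y m \<in> K"
    and lim: "filterlim s sequentially F" "filterlim t sequentially F"
    and L: "(\<lambda>m. v (x m)) \<longlonglongrightarrow> L" "(\<lambda>m. v (y m)) \<longlonglongrightarrow> L'" "L > 0" "L' > 0"
    and d: "((\<lambda>i. v (x (s i) - y (t i))) \<longlongrightarrow> 0) F"
  shows "((\<lambda>i. v (inverse (x (s i)) - inverse (y (t i)))) \<longlongrightarrow> 0) F"
proof (rule Lim_transform_eventually)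
  show "((\<lambda>i. v (x (s i) - y (t i)) / (v (x (s i)) * v (y (t i)))) \<longlongrightarrow> 0) F"
    using tendsto_divide[OF d tendsto_mult[OF filterlim_compose[OF L(1) lim(1)] filterlim_compose[OF L(2) lim(2)]]] L(3,4)
    by simp
  have "\<forall>\<^sub>F m in sequentially. x m \<noteq> 0" "\<forall>\<^sub>F m in sequentially. y m \<noteq> 0"
    using order_tendstoD(1)[OF L(1,3)] order_tendstoD(1)[OF L(2,4)]
    by (auto elim: eventually_mono)
  then have "\<forall>\<^sub>F i in F. x (s i) \<noteq> 0" "\<forall>\<^sub>F i in F. y (t i) \<noteq> 0"
    using lim by (auto simp: filterlim_iff)
  then show "\<forall>\<^sub>F i in F. v (x (s i) - y (t i)) / (v (x (s i)) * v (y (t i)))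
      = v (inverse (x (s i)) - inverse (y (t i)))"
  proof eventually_elim
    case (elim i)
    then have "inverse (x (s i)) - inverse (y (t i)) = - ((x (s i) - y (t i)) / (x (s i) * y (t i)))"
      by (simp add: field_simps)
    then show ?case
      using x y by (simp only: uminus divide mult mem_intros)
  qed
qed

lemma lim_in_inverse:
  assumes "\<And>m. x m \<in> K" "a \<in> K" "a \<noteq> 0" "lim_in v x a"
  shows "lim_in v (\<lambda>m. inverse (x m)) (inverse a)"
  unfolding lim_in_def
  using assms lim_in_abs[OF assms(1,2,4)] pos[OF assms(2,3)]
  by (intro null_inverse_diff[where x = x and y = "\<lambda>_. a" and s = "\<lambda>i. i" and t = "\<lambda>i. i" and L = "v a" and L' = "v a"])
    (auto simp: lim_in_def filterlim_ident)

text \<open>As a limit along the product filter, the Cauchy property of sums, products and inverses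
  reduces to the calculus of limits.\<close>

lemma cauchy_in_iff:
  assumes "\<And>m. x m \<in> K"
  shows "cauchy_in v x \<longleftrightarrow> ((\<lambda>(m, n). v (x m - x n)) \<longlongrightarrow> 0) (sequentially \<times>\<^sub>F sequentially)"
proof -
  have nn: "0 \<le> v (x m - x n)" for m n using assms by (intro nonneg mem_intros)
  have eq: "dist (v (x m - x n)) 0 = v (x m - x n)" for m n
    using nn by (simp add: dist_real_def)
  have swap: "(\<exists>N. \<forall>m\<ge>N. \<forall>n\<ge>N. v (x n - x m) < e) \<longleftrightarrow> (\<exists>N. \<forall>m\<ge>N. \<forall>n\<ge>N. v (x m - x n) < e)"
    for e
    by (rule ex_cong1) auto
  show ?thesis
    unfolding tendsto_iff eventually_prod_sequentially cauchy_in_def split eq swap ..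
qed

lemma filterlim_seq_fst: "filterlim fst sequentially (sequentially \<times>\<^sub>F sequentially)"
  and filterlim_seq_snd: "filterlim snd sequentially (sequentially \<times>\<^sub>F sequentially)"
  by (rule filterlim_fst, rule filterlim_snd)

lemma cauchy_comparison:
  assumes "\<And>m. x m \<in> K" "\<And>m n. v (x m - x n) \<le> f (m, n)"
    "(f \<longlongrightarrow> 0) (sequentially \<times>\<^sub>F sequentially)"
  shows "cauchy_in v x"
  unfolding cauchy_in_iff[OF assms(1)]
  by (rule Lim_null_comparison[OF _ assms(3)])
    (use assms nonneg diff_mem in \<open>auto intro!: always_eventually\<close>)

lemma cauchy_null_perturb:
  assumes "\<And>m. x m \<in> K" "\<And>m. y m \<in> K" "cauchy_in v x" "(\<lambda>m. v (y m - x m)) \<longlonglongrightarrow> 0"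
  shows "cauchy_in v y"
proof (rule cauchy_comparison)
  let ?f = "\<lambda>mn. v (y (fst mn) - x (fst mn)) + (\<lambda>(m, n). v (x m - x n)) mn + v (y (snd mn) - x (snd mn))"
  show "v (y m - y n) \<le> ?f (m, n)" for m n
    using dist_triangle[of "y m" "x m" "y n"] dist_triangle[of "x m" "x n" "y n"]
      diff_commute[of "x n" "y n"] assms(1,2) by simp
  show "(?f \<longlongrightarrow> 0) (sequentially \<times>\<^sub>F sequentially)"
    using assms(3) unfolding cauchy_in_iff[OF assms(1)]
    by (intro tendsto_add_zero filterlim_compose[OF assms(4) filterlim_seq_fst]
        filterlim_compose[OF assms(4) filterlim_seq_snd])
qed (use assms in auto)

lemma cauchy_const: "a \<in> K \<Longrightarrow> cauchy_in v (\<lambda>_. a)"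
  by (simp add: cauchy_in_def)

lemma null_imp_cauchy:
  assumes "\<And>m. x m \<in> K" "(\<lambda>m. v (x m)) \<longlonglongrightarrow> 0"
  shows "cauchy_in v x"
  by (rule cauchy_null_perturb[of "\<lambda>_. 0"]) (use assms in \<open>auto intro: cauchy_const\<close>)

lemma cauchy_abs:
  assumes "\<And>m. x m \<in> K" "cauchy_in v x"
  obtains L where "(\<lambda>m. v (x m)) \<longlonglongrightarrow> L" "L \<ge> 0"
proof -
  have "Cauchy (\<lambda>m. v (x m))"
    unfolding Cauchy_def
  proof (intro allI impI)
    fix e :: real assume "e > 0"
    then obtain N where N: "\<forall>m\<ge>N. \<forall>n\<ge>N. v (x m - x n) < e"
      using assms(2) by (auto simp: cauchy_in_def)
    have "dist (v (x m)) (v (x n)) < e" if "m \<ge> N" "n \<ge> N" for m n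
      using abs_diff_le[OF assms(1) assms(1), of m n] N[rule_format, OF that] by (simp add: dist_real_def)
    then show "\<exists>M. \<forall>m\<ge>M. \<forall>n\<ge>M. dist (v (x m)) (v (x n)) < e"
      by blast
  qed
  then obtain L where L: "(\<lambda>m. v (x m)) \<longlonglongrightarrow> L"
    using Cauchy_convergent convergent_def by blast
  moreover have "L \<ge> 0"
    by (rule LIMSEQ_le_const[OF L]) (use assms nonneg in auto)
  ultimately show ?thesis using that by blast
qed

lemma cauchy_add:
  assumes "\<And>m. x m \<in> K" "\<And>m. y m \<in> K" "cauchy_in v x" "cauchy_in v y"
  shows "cauchy_in v (\<lambda>m. x m + y m)"
proof (rule cauchy_comparison)
  let ?f = "\<lambda>mn. (\<lambda>(m, n). v (x m - x n)) mn + (\<lambda>(m, n). v (y m - y n)) mn"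
  show "v (x m + y m - (x n + y n)) \<le> ?f (m, n)" for m n
    using triangle[of "x m - x n" "y m - y n"] assms(1,2) by (simp add: mem_intros algebra_simps)
  show "(?f \<longlongrightarrow> 0) (sequentially \<times>\<^sub>F sequentially)"
    using assms(3,4) unfolding cauchy_in_iff[OF assms(1)] cauchy_in_iff[OF assms(2)]
    by (intro tendsto_add_zero)
qed (use assms in \<open>auto intro: mem_intros\<close>)

lemma cauchy_mult:
  assumes "\<And>m. x m \<in> K" "\<And>m. y m \<in> K" "cauchy_in v x" "cauchy_in v y"
  shows "cauchy_in v (\<lambda>m. x m * y m)"
proof -
  obtain L where L: "(\<lambda>m. v (x m)) \<longlonglongrightarrow> L"
    using cauchy_abs[OF assms(1,3)] by blast
  obtain L' where L': "(\<lambda>m. v (y m)) \<longlonglongrightarrow> L'"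
    using cauchy_abs[OF assms(2,4)] by blast
  show ?thesis
  proof (rule cauchy_comparison)
    let ?f = "\<lambda>mn. (\<lambda>(m, n). v (x m - x n)) mn * v (y (fst mn)) + (\<lambda>(m, n). v (y m - y n)) mn * v (x (snd mn))"
    show "v (x m * y m - x n * y n) \<le> ?f (m, n)" for m n
    proof -
      have "x m * y m - x n * y n = (x m - x n) * y m + (y m - y n) * x n"
        by (simp add: algebra_simps)
      then show ?thesis
        using triangle[of "(x m - x n) * y m" "(y m - y n) * x n"] assms(1,2) by (simp add: mem_intros mult)
    qed
    have "(?f \<longlongrightarrow> 0 * L' + 0 * L) (sequentially \<times>\<^sub>F sequentially)"
      using assms(3,4) unfolding cauchy_in_iff[OF assms(1)] cauchy_in_iff[OF assms(2)]
      by (intro tendsto_intros filterlim_compose[OF L' filterlim_seq_fst]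
          filterlim_compose[OF L filterlim_seq_snd])
    then show "(?f \<longlongrightarrow> 0) (sequentially \<times>\<^sub>F sequentially)" by simp
  qed (use assms in \<open>auto intro: mem_intros\<close>)
qed

lemma cauchy_uminus:
  assumes "\<And>m. x m \<in> K" "cauchy_in v x"
  shows "cauchy_in v (\<lambda>m. - x m)"
  using cauchy_mult[of "\<lambda>_. -1" x] assms cauchy_const uminus_mem[of 1] by simp

lemma cauchy_inverse:
  assumes x: "\<And>m. x m \<in> K" and c: "cauchy_in v x" and nn: "\<not> (\<lambda>m. v (x m)) \<longlonglongrightarrow> 0"
  shows "cauchy_in v (\<lambda>m. inverse (x m))" "(\<lambda>m. v (x m * inverse (x m) - 1)) \<longlonglongrightarrow> 0"
proof -
  obtain L where L: "(\<lambda>m. v (x m)) \<longlonglongrightarrow> L" "L \<ge> 0"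
    using cauchy_abs[OF x c] by blast
  have "L \<noteq> 0" using nn L by auto
  then have L0: "L > 0" using L by simp
  have ix: "inverse (x m) \<in> K" for m using x by (rule inverse_mem)
  show "cauchy_in v (\<lambda>m. inverse (x m))"
    unfolding cauchy_in_iff[OF ix] case_prod_unfold
    using c unfolding cauchy_in_iff[OF x] case_prod_unfold
    by (intro null_inverse_diff[OF x x filterlim_seq_fst filterlim_seq_snd L(1) L(1) L0 L0])
  have "\<forall>\<^sub>F m in sequentially. x m \<noteq> 0"
    using order_tendstoD(1)[OF L(1) L0] by (auto elim: eventually_mono)
  then have "\<forall>\<^sub>F m in sequentially. v (x m * inverse (x m) - 1) = 0"
    by eventually_elim simp
  then show "(\<lambda>m. v (x m * inverse (x m) - 1)) \<longlonglongrightarrow> 0"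
    by (rule tendsto_eventually)
qed

end

section \<open>The completion at a place in terms of conjugates\<close>

context valued_field
begin

lemma coeff_linear_mult: "coeff ([:1, - a:] * P) k = coeff P k + (case k of 0 \<Rightarrow> 0 | Suc i \<Rightarrow> - a * coeff P i)"
  for a :: complex
  by (auto split: nat.split)

lemma coeff_prod_linear_mem:
  assumes "\<And>z. z \<in> Z \<Longrightarrow> y z \<in> K"
  shows "coeff (\<Prod>z\<in>Z. [:1, - y z:]) k \<in> K"
  using assms by (intro coeff_prod_mem coeff_linear_mem uminus_mem) auto

text \<open>Continuity of the elementary symmetric functions. With constant term 1 in each factor, a
  factor whose l tends to 0 becomes 1 in the limit and drops out.\<close>

lemma lim_in_coeff_prod:
  assumes "finite Z" "\<And>m z. z \<in> Z \<Longrightarrow> y m z \<in> K" "\<And>z. z \<in> Z \<Longrightarrow> l z \<in> K"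
    "\<And>z. z \<in> Z \<Longrightarrow> lim_in v (\<lambda>m. y m z) (l z)"
  shows "lim_in v (\<lambda>m. coeff (\<Prod>z\<in>Z. [:1, - y m z:]) k) (coeff (\<Prod>z\<in>Z. [:1, - l z:]) k)"
  using assms
proof (induction Z arbitrary: k rule: finite_induct)
  case empty
  show ?case by (simp add: lim_in_const)
next
  case (insert x F)
  have mem: "coeff (\<Prod>z\<in>F. [:1, - y m z:]) k \<in> K" "coeff (\<Prod>z\<in>F. [:1, - l z:]) k \<in> K" for m k
    using insert.prems by (auto intro!: coeff_prod_linear_mem)
  have IH: "lim_in v (\<lambda>m. coeff (\<Prod>z\<in>F. [:1, - y m z:]) k) (coeff (\<Prod>z\<in>F. [:1, - l z:]) k)" for k
    using insert.prems by (intro insert.IH) auto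
  show ?case
  proof (cases k)
    case 0
    then show ?thesis
      unfolding prod.insert[OF insert.hyps] coeff_linear_mult using IH[of 0] by simp
  next
    case (Suc i)
    then show ?thesis
      unfolding prod.insert[OF insert.hyps] coeff_linear_mult Suc nat.case
      using insert.prems mem
      by (intro lim_in_add lim_in_mult lim_in_uminus IH mem_intros) auto
  qed
qed

lemma lim_in_cauchy:
  assumes "\<And>m. x m \<in> K" "l \<in> K" "lim_in v x l"
  shows "cauchy_in v x"
  by (rule cauchy_null_perturb[of "\<lambda>_. l"]) (use assms in \<open>auto simp: lim_in_def intro: cauchy_const\<close>)

end

section \<open>Embeddings that induce a given absolute value\<close>

locale conj_place =
  fixes \<alpha> :: complex and p :: rat_place and u w :: "complex \<Rightarrow> real"
  assumes alg: "algebraic \<alpha>" and nz: "\<alpha> \<noteq> 0" and p: "p \<in> rat_places"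
    and u: "u \<in> abs_values_over (rat_adjoin \<alpha>) p"
    and w: "w \<in> abs_values_over (Collect algebraic) p"
begin

abbreviation "K \<equiv> rat_adjoin \<alpha>"
abbreviation "Z \<equiv> conjs \<alpha>"

text \<open>The conjugates whose embedding pulls w back to u; their number turns out to be the local
  degree at u.\<close>

definition S :: "complex set" where
  "S = {z \<in> Z. \<forall>x\<in>K. w (emb \<alpha> z x) = u x}"

sublocale K: rat_field K by (rule rat_field_rat_adjoin[OF alg])
sublocale U: valued_field K u by (rule valued_fieldI[OF K.rat_field_axioms u])
sublocale W: valued_field "Collect algebraic" w by (rule valued_fieldI[OF rat_field_algebraic w])

lemma \<alpha>_mem [simp]: "\<alpha> \<in> K"
  by (rule self_in_rat_adjoin[OF alg])

lemma fin_Z [simp]: "finite Z" by (rule finite_conjs[OF alg])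
lemma S_sub: "S \<subseteq> Z" by (auto simp: S_def)
lemma fin_S [simp]: "finite S" using S_sub fin_Z by (rule finite_subset)

lemma u_rat: "u (of_rat q) = w (of_rat q)"
  using u w by (simp add: abs_values_over_def extends_rat_place_def)

lemma u_rat_diff: "u (of_rat q - of_rat r) = w (of_rat q - of_rat r)"
  using u_rat[of "q - r"] by (simp add: of_rat_diff)

lemma w_emb: "z \<in> S \<Longrightarrow> x \<in> K \<Longrightarrow> w (emb \<alpha> z x) = u x"
  by (simp add: S_def)

lemma emb_alg: "z \<in> Z \<Longrightarrow> x \<in> K \<Longrightarrow> emb \<alpha> z x \<in> Collect algebraic"
  using emb_algebraic[OF alg] by simp

lemma conj_alg: "z \<in> Z \<Longrightarrow> z \<in> Collect algebraic"
  using conj_algebraic[OF alg] by simp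

text \<open>The multipliers approximate 1 at u and 0 at the other induced absolute values. They
  change \<xi> by a null sequence at u and make it null at every embedding outside S. Each is chosen
  for its own m, with an accuracy that beats the size of \<open>\<xi> m\<close>.\<close>

lemma approximants:
  assumes \<xi>: "\<And>m. \<xi> m \<in> K"
  obtains \<beta> where "\<And>m. \<beta> m \<in> K" "(\<lambda>m. u (\<beta> m * \<xi> m - \<xi> m)) \<longlonglongrightarrow> 0"
    "\<And>z. z \<in> Z - S \<Longrightarrow> (\<lambda>m. w (emb \<alpha> z (\<beta> m * \<xi> m))) \<longlonglongrightarrow> 0"
proof -
  define V where "V = (\<lambda>z. restrict (\<lambda>x. w (emb \<alpha> z x)) K) ` (Z - S)"
  have V: "finite V" "V \<subseteq> abs_values_over K p" "u \<notin> V"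
  proof -
    show "finite V" by (simp add: V_def)
    show "V \<subseteq> abs_values_over K p"
      using abs_value_on_emb[OF alg] extends_emb[OF alg] w by (auto simp: V_def abs_values_over_def)
    show "u \<notin> V"
      by (auto simp: V_def S_def)
  qed
  define B where "B m = 1 + u (\<xi> m) + (\<Sum>z\<in>Z. w (emb \<alpha> z (\<xi> m)))" for m
  have nn: "w (emb \<alpha> z (\<xi> m)) \<ge> 0" if "z \<in> Z" for z m
    using that \<xi> by (intro W.nonneg emb_alg) auto
  have un: "u (\<xi> m) \<ge> 0" for m using \<xi> by (rule U.nonneg)
  have sum_nn: "(\<Sum>z\<in>Z. w (emb \<alpha> z (\<xi> m))) \<ge> 0" for m using nn by (intro sum_nonneg) auto
  have B1: "B m \<ge> 1" and Bu: "u (\<xi> m) \<le> B m" for m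
    unfolding B_def using un[of m] sum_nn[of m] by linarith+
  have Bw: "w (emb \<alpha> z (\<xi> m)) \<le> B m" if "z \<in> Z" for z m
  proof -
    have "w (emb \<alpha> z (\<xi> m)) \<le> (\<Sum>z\<in>Z. w (emb \<alpha> z (\<xi> m)))"
      using that nn by (intro member_le_sum) auto
    then show ?thesis unfolding B_def using un[of m] by linarith
  qed
  \<comment> \<open>\<open>B m\<close> bounds \<open>\<xi> m\<close> at u and at all embeddings, so
    this accuracy makes the errors at most 1/(m + 1).\<close>
  define e where "e m = inverse (real (Suc m)) / B m" for m
  have e: "e m > 0" and eB: "e m * B m = inverse (real (Suc m))" for m
    using B1[of m] by (auto simp: e_def)
  have "\<exists>b. b \<in> K \<and> u (b - 1) < e m \<and> (\<forall>v\<in>V. v b < e m)" for m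
    using weak_approximation[OF K.rat_field_axioms p u V e[of m]] by metis
  then obtain \<beta> where \<beta>: "\<And>m. \<beta> m \<in> K" "\<And>m. u (\<beta> m - 1) < e m" "\<And>m v. v \<in> V \<Longrightarrow> v (\<beta> m) < e m"
    by metis
  have lim: "(\<lambda>m. inverse (real (Suc m))) \<longlonglongrightarrow> 0"
    by (rule LIMSEQ_inverse_real_of_nat)
  show ?thesis
  proof (rule that[OF \<beta>(1)])
    show "(\<lambda>m. u (\<beta> m * \<xi> m - \<xi> m)) \<longlonglongrightarrow> 0"
    proof (rule U.null_comparison[OF _ _ lim])
      fix m
      show "\<beta> m * \<xi> m - \<xi> m \<in> K" using \<beta>(1) \<xi> by (intro K.mem_intros)
      have "\<beta> m * \<xi> m - \<xi> m = (\<beta> m - 1) * \<xi> m" by (simp add: algebra_simps)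
      then have "u (\<beta> m * \<xi> m - \<xi> m) = u (\<beta> m - 1) * u (\<xi> m)"
        using \<beta>(1) \<xi> by (simp add: U.mult K.mem_intros)
      also have "\<dots> \<le> e m * B m"
        using \<beta>(2)[of m] Bu[of m] un[of m] e[of m] by (intro mult_mono) auto
      finally show "u (\<beta> m * \<xi> m - \<xi> m) \<le> inverse (real (Suc m))" by (simp only: eB)
    qed
    fix z assume z: "z \<in> Z - S"
    show "(\<lambda>m. w (emb \<alpha> z (\<beta> m * \<xi> m))) \<longlonglongrightarrow> 0"
    proof (rule W.null_comparison[OF _ _ lim])
      fix m
      show "emb \<alpha> z (\<beta> m * \<xi> m) \<in> Collect algebraic"
        using z \<beta>(1) \<xi> by (intro emb_alg K.mem_intros) auto
      have "restrict (\<lambda>x. w (emb \<alpha> z x)) K \<in> V" using z by (auto simp: V_def)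
      from \<beta>(3)[OF this, of m] have *: "w (emb \<alpha> z (\<beta> m)) < e m" using \<beta>(1) by simp
      have "w (emb \<alpha> z (\<beta> m * \<xi> m)) = w (emb \<alpha> z (\<beta> m)) * w (emb \<alpha> z (\<xi> m))"
        using z \<beta>(1) \<xi> emb_mult[OF alg, of z] emb_alg by (simp add: W.mult)
      also have "\<dots> \<le> e m * B m"
        using * Bw[of z m] nn[of z m] e[of m] z by (intro mult_mono) auto
      finally show "w (emb \<alpha> z (\<beta> m * \<xi> m)) \<le> inverse (real (Suc m))" by (simp only: eB)
    qed
  qed
qed

lemma w_coeff_le:
  assumes T: "finite T" "T \<subseteq> Z" and Q: "degree Q < card T"
  shows "w (of_rat (coeff Q j)) \<le> (\<Sum>z\<in>T. w (rpoly Q z) * w (coeff (lagrange T z) j))"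
proof -
  have T_alg: "T \<subseteq> Collect algebraic" using T(2) conj_alg by auto
  have "of_rat (coeff Q j) = coeff (map_poly complex_of_rat Q) j"
    by (simp add: coeff_map_poly)
  also have "\<dots> = (\<Sum>z\<in>T. rpoly Q z * coeff (lagrange T z) j)"
    using Q T(1) by (subst coeff_lagrange[of T]) (auto simp: degree_map_poly rpoly_def)
  finally have "w (of_rat (coeff Q j)) = w (\<Sum>z\<in>T. rpoly Q z * coeff (lagrange T z) j)" by simp
  also have "\<dots> \<le> (\<Sum>z\<in>T. w (rpoly Q z * coeff (lagrange T z) j))"
    using T_alg by (intro W.sum_le ALG.mult_mem ALG.rpoly_mem ALG.coeff_lagrange_mem) auto
  also have "\<dots> = (\<Sum>z\<in>T. w (rpoly Q z) * w (coeff (lagrange T z) j))"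
    using T_alg by (intro sum.cong W.mult ALG.rpoly_mem ALG.coeff_lagrange_mem) auto
  finally show ?thesis .
qed

lemma cauchy_rat_iff: "cauchy_in u (\<lambda>m. of_rat (q m)) \<longleftrightarrow> cauchy_in w (\<lambda>m. of_rat (q m))"
  by (simp add: cauchy_in_def u_rat_diff)

text \<open>A sequence that is Cauchy at u alone gives no control at the other embeddings, hence
  none over its rational coordinates. After multiplication by the approximants it is Cauchy at every
  embedding, and interpolation at all conjugates makes the coordinates Cauchy.\<close>

lemma spanned_by_powers:
  assumes \<xi>: "\<And>m. \<xi> m \<in> K" and c: "cauchy_in u \<xi>"
  obtains q :: "nat \<Rightarrow> nat \<Rightarrow> rat" where "\<And>j. cauchy_in u (\<lambda>m. of_rat (q m j))"
    "(\<lambda>m. u (\<xi> m - (\<Sum>j<card Z. of_rat (q m j) * \<alpha> ^ j))) \<longlonglongrightarrow> 0"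
proof -
  obtain \<beta> where \<beta>: "\<And>m. \<beta> m \<in> K" "(\<lambda>m. u (\<beta> m * \<xi> m - \<xi> m)) \<longlonglongrightarrow> 0"
    "\<And>z. z \<in> Z - S \<Longrightarrow> (\<lambda>m. w (emb \<alpha> z (\<beta> m * \<xi> m))) \<longlonglongrightarrow> 0"
    by (rule approximants[of \<xi>, OF \<xi>]) (rule that)
  define \<eta> where "\<eta> m = \<beta> m * \<xi> m" for m
  have \<eta>: "\<eta> m \<in> K" for m using \<beta>(1) \<xi> by (auto simp: \<eta>_def intro: K.mem_intros)
  have c\<eta>: "cauchy_in u \<eta>"
    by (rule U.cauchy_null_perturb[OF \<xi> \<eta> c]) (use \<beta>(2) in \<open>simp add: \<eta>_def\<close>)
  have cw: "cauchy_in w (\<lambda>m. emb \<alpha> z (\<eta> m))" if z: "z \<in> Z" for z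
  proof (cases "z \<in> S")
    case True
    then have "w (emb \<alpha> z (\<eta> m) - emb \<alpha> z (\<eta> n)) = u (\<eta> m - \<eta> n)" for m n
      using w_emb[OF True, of "\<eta> m - \<eta> n"] \<eta> emb_diff[OF alg z, of "\<eta> m" "\<eta> n"] by (simp add: K.diff_mem)
    with c\<eta> show ?thesis by (simp add: cauchy_in_def)
  next
    case False
    then show ?thesis
      using z \<eta> \<beta>(3)[of z] emb_alg by (intro W.null_imp_cauchy) (auto simp: \<eta>_def)
  qed
  have "\<exists>Q. \<eta> m = rpoly Q \<alpha> \<and> degree Q < card Z \<and> rpoly Q \<alpha> = (\<Sum>j<card Z. of_rat (coeff Q j) * \<alpha> ^ j)" for m
    by (rule rat_adjoin_repr[OF alg \<eta>[of m]]) blast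
  then obtain Q where Q: "\<And>m. \<eta> m = rpoly (Q m) \<alpha>" "\<And>m. degree (Q m) < card Z"
    "\<And>m. rpoly (Q m) \<alpha> = (\<Sum>j<card Z. of_rat (coeff (Q m) j) * \<alpha> ^ j)"
    by metis
  have "cauchy_in w (\<lambda>m. of_rat (coeff (Q m) j))" for j
  proof (rule W.cauchy_comparison)
    let ?f = "\<lambda>mn. \<Sum>z\<in>Z. (\<lambda>(m, n). w (emb \<alpha> z (\<eta> m) - emb \<alpha> z (\<eta> n))) mn * w (coeff (lagrange Z z) j)"
    show "complex_of_rat (coeff (Q m) j) \<in> Collect algebraic" for m by (rule ALG.of_rat_mem)
    fix m n
    have "w (of_rat (coeff (Q m - Q n) j)) \<le> (\<Sum>z\<in>Z. w (rpoly (Q m - Q n) z) * w (coeff (lagrange Z z) j))"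
      using Q(2)[of m] Q(2)[of n] by (intro w_coeff_le degree_diff_less) auto
    then show "w (of_rat (coeff (Q m) j) - of_rat (coeff (Q n) j)) \<le> ?f (m, n)"
      by (simp add: of_rat_diff Q(1) emb_rpoly[OF alg] cong: sum.cong)
  next
    let ?f = "\<lambda>mn. \<Sum>z\<in>Z. (\<lambda>(m, n). w (emb \<alpha> z (\<eta> m) - emb \<alpha> z (\<eta> n))) mn * w (coeff (lagrange Z z) j)"
    have "(?f \<longlongrightarrow> (\<Sum>z\<in>Z. 0 * w (coeff (lagrange Z z) j))) (sequentially \<times>\<^sub>F sequentially)"
      using cw W.cauchy_in_iff emb_alg \<eta> by (intro tendsto_sum tendsto_mult tendsto_const) auto
    then show "(?f \<longlongrightarrow> 0) (sequentially \<times>\<^sub>F sequentially)" by simp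
  qed
  then have 1: "cauchy_in u (\<lambda>m. of_rat (coeff (Q m) j))" for j
    by (simp add: cauchy_rat_iff)
  have "(\<lambda>m. u (\<xi> m - \<eta> m)) \<longlonglongrightarrow> 0"
    using \<beta>(2) U.diff_commute[OF \<xi> \<eta>] by (simp add: \<eta>_def)
  then show ?thesis
    using that[of "\<lambda>m. coeff (Q m)"] 1 Q(1,3) by simp
qed

text \<open>The coefficients of \<open>\<Prod>z\<in>S. 1 - z T\<close> are limits of rational numbers: if \<open>\<beta> m\<close> tends to 1 at \<open>u\<close>
  and to 0 at the other absolute values, they are the limits of the coefficients of the rational
  polynomials \<open>\<Prod>z\<in>Z. 1 - emb \<alpha> z (\<beta> m * \<alpha>) T\<close>, which have \<open>inverse (\<beta> m * \<alpha>)\<close> as a root.\<close>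

lemma relation:
  obtains g :: "nat \<Rightarrow> nat \<Rightarrow> rat" where "\<And>j. cauchy_in u (\<lambda>m. of_rat (g m j))"
    "(\<lambda>m. u (\<alpha> ^ card S - (\<Sum>j<card S. of_rat (g m j) * \<alpha> ^ j))) \<longlonglongrightarrow> 0"
proof -
  define s where "s = card S"
  define n where "n = card Z"
  have sn: "s \<le> n" unfolding s_def n_def using S_sub by (intro card_mono) auto
  obtain \<beta> where \<beta>: "\<And>m. \<beta> m \<in> K" "(\<lambda>m. u (\<beta> m * \<alpha> - \<alpha>)) \<longlonglongrightarrow> 0"
    "\<And>z. z \<in> Z - S \<Longrightarrow> (\<lambda>m. w (emb \<alpha> z (\<beta> m * \<alpha>))) \<longlonglongrightarrow> 0"
    by (rule approximants[of "\<lambda>_. \<alpha>", OF \<alpha>_mem]) (rule that)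
  define b where "b m = \<beta> m * \<alpha>" for m
  have b: "b m \<in> K" for m using \<beta>(1) by (auto simp: b_def intro: K.mem_intros)
  have b_lim: "lim_in u b \<alpha>" using \<beta>(2) by (simp add: lim_in_def b_def)
  \<comment> \<open>The limit of \<open>emb \<alpha> z (b m)\<close>: on S closeness at u carries
    over to w, and elsewhere the approximants force 0.\<close>
  define l where "l z = (if z \<in> S then z else 0)" for z
  have ylim: "lim_in w (\<lambda>m. emb \<alpha> z (b m)) (l z)" if z: "z \<in> Z" for z
  proof (cases "z \<in> S")
    case True
    have "w (emb \<alpha> z (b m) - z) = u (b m - \<alpha>)" for m
      using w_emb[OF True, of "b m - \<alpha>"] b emb_diff[OF alg z, of "b m" \<alpha>] emb_self[OF alg z]
      by (simp add: K.diff_mem)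
    with True b_lim show ?thesis by (simp add: lim_in_def l_def)
  next
    case False
    with z \<beta>(3)[of z] show ?thesis by (simp add: lim_in_def l_def b_def)
  qed
  define G where "G m = (\<Prod>z\<in>Z. [:1, - emb \<alpha> z (b m):])" for m
  define H where "H = (\<Prod>z\<in>Z. [:1, - l z:])"
  have "\<exists>q. coeff (G m) k = of_rat q" for m k
  proof -
    obtain P where P: "b m = rpoly P \<alpha>" using b[of m] by (auto simp: rat_adjoin_eq[OF alg])
    have "G m = (\<Prod>z\<in>Z. [:1, - rpoly P z:])"
      unfolding G_def P using emb_rpoly[OF alg] by (intro prod.cong) auto
    then have "coeff (G m) k \<in> \<rat>" using conj_prod_rational[OF alg] by simp
    then show ?thesis by (auto elim: Rats_cases)
  qed
  then obtain r where r: "\<And>m k. coeff (G m) k = of_rat (r m k)" by metis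
  have l_alg: "l z \<in> Collect algebraic" if "z \<in> Z" for z
    using conj_alg[OF that] by (simp add: l_def)
  have H_alg: "coeff H k \<in> Collect algebraic" for k
    unfolding H_def using l_alg by (intro W.coeff_prod_linear_mem)
  have r_lim: "lim_in w (\<lambda>m. of_rat (r m k)) (coeff H k)" for k
    unfolding r[symmetric] G_def H_def using b emb_alg l_alg ylim
    by (intro W.lim_in_coeff_prod) auto
  have r_cauchy: "cauchy_in u (\<lambda>m. of_rat (r m k))" for k
    unfolding cauchy_rat_iff by (rule W.lim_in_cauchy[OF ALG.of_rat_mem H_alg r_lim])
  \<comment> \<open>Factors with \<open>l z = 0\<close> equal 1, so only those over S remain; the
    rational coefficients of index above card S therefore tend to 0.\<close>
  have deg_H: "degree H \<le> s"
  proof -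
    have "H = (\<Prod>z\<in>S. [:1, - z:])"
      unfolding H_def using S_sub by (intro prod.mono_neutral_cong_right) (auto simp: l_def one_pCons)
    also have "degree \<dots> \<le> (\<Sum>z\<in>S. degree [:1, - z:])"
      by (intro degree_prod_sum_le[unfolded o_def]) auto
    also have "\<dots> \<le> (\<Sum>z\<in>S. 1)" by (intro sum_mono) auto
    finally show ?thesis by (simp add: s_def)
  qed
  have r_high: "(\<lambda>m. u (of_rat (r m k))) \<longlonglongrightarrow> 0" if "k > s" for k
    using r_lim[of k] that deg_H by (simp add: lim_in_def coeff_eq_0 u_rat)
  have r_bdd: "(\<lambda>m. u (of_rat (r m k))) \<longlonglongrightarrow> w (coeff H k)" for k
    unfolding u_rat by (rule W.lim_in_abs[OF ALG.of_rat_mem H_alg r_lim])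
  have r0: "r m 0 = 1" for m
  proof -
    have "coeff (G m) 0 = 1" by (simp flip: poly_0_coeff_0 add: G_def poly_prod)
    then show ?thesis using r[of m 0] by simp
  qed
  have deg_G: "degree (G m) \<le> n" for m
  proof -
    have "degree (G m) \<le> (\<Sum>z\<in>Z. degree [:1, - emb \<alpha> z (b m):])"
      unfolding G_def by (intro degree_prod_sum_le[unfolded o_def]) auto
    also have "\<dots> \<le> (\<Sum>z\<in>Z. 1)" by (intro sum_mono) auto
    finally show ?thesis by (simp add: n_def)
  qed
  have poly_G: "poly (G m) x = (\<Sum>k\<le>n. of_rat (r m k) * x ^ k)" for m x
    unfolding poly_altdef r using deg_G[of m]
    by (intro sum.mono_neutral_left) (auto simp: coeff_eq_0 not_le simp flip: r)
  have root: "poly (G m) (inverse (b m)) = 0" if "b m \<noteq> 0" for m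
  proof -
    \<comment> \<open>The conjugate \<alpha> itself gives the identity embedding, so one factor of
      \<open>G m\<close> vanishes at the inverse of \<open>b m\<close>.\<close>
    have "emb \<alpha> \<alpha> (b m) = b m"
    proof -
      obtain P where "b m = rpoly P \<alpha>" using b[of m] by (auto simp: rat_adjoin_eq[OF alg])
      then show ?thesis using emb_rpoly[OF alg self_in_conjs[OF alg], of P] by simp
    qed
    then show ?thesis
      unfolding G_def poly_prod using that self_in_conjs[OF alg]
      by (intro prod_zero) (auto intro!: bexI[of _ \<alpha>])
  qed
  have ev: "\<forall>\<^sub>F m in sequentially. b m \<noteq> 0"
  proof -
    have "(\<lambda>m. u (b m)) \<longlonglongrightarrow> u \<alpha>" by (rule U.lim_in_abs[OF b \<alpha>_mem b_lim])
    then have "\<forall>\<^sub>F m in sequentially. u (b m) > 0"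
      by (rule order_tendstoD) (use U.pos nz in simp)
    then show ?thesis by eventually_elim auto
  qed
  have ilim: "lim_in u (\<lambda>m. inverse (b m) ^ k) (inverse \<alpha> ^ k)" for k
    using b b_lim nz by (intro U.lim_in_power U.lim_in_inverse K.mem_intros) auto
  have lim1: "(\<lambda>m. u (\<Sum>k\<le>n. of_rat (r m k) * (inverse (b m) ^ k - inverse \<alpha> ^ k))) \<longlonglongrightarrow> 0"
  proof (intro U.null_sum)
    fix k
    have "(\<lambda>m. u ((inverse (b m) ^ k - inverse \<alpha> ^ k) * of_rat (r m k))) \<longlonglongrightarrow> 0"
      using ilim[of k] b by (intro U.null_mult[OF _ _ _ r_bdd]) (auto simp: lim_in_def intro!: K.mem_intros)
    then show "(\<lambda>m. u (of_rat (r m k) * (inverse (b m) ^ k - inverse \<alpha> ^ k))) \<longlonglongrightarrow> 0"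
      by (simp only: mult.commute)
  qed (use b in \<open>auto intro!: K.mem_intros\<close>)
  have lim2: "(\<lambda>m. u (\<Sum>k\<in>{s<..n}. of_rat (r m k) * inverse \<alpha> ^ k)) \<longlonglongrightarrow> 0"
    using r_high by (intro U.null_sum U.null_mult[where c = "u (inverse \<alpha> ^ _)"]) (auto intro!: K.mem_intros)
  \<comment> \<open>Rewrites the vanishing of \<open>G m\<close> at the inverse of
    \<open>b m\<close>: the truncated sum at the inverse of \<alpha> equals, up to sign, the error
    of replacing 1/b by 1/\<alpha> plus the tail above s, and both are null.\<close>
  have decomp: "(\<Sum>k\<le>s. of_rat (r m k) * inverse \<alpha> ^ k) =
      - (\<Sum>k\<le>n. of_rat (r m k) * (inverse (b m) ^ k - inverse \<alpha> ^ k))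
      - (\<Sum>k\<in>{s<..n}. of_rat (r m k) * inverse \<alpha> ^ k)" if "b m \<noteq> 0" for m
  proof -
    have "{..n} = {..s} \<union> {s<..n}" using sn by auto
    then have "(\<Sum>k\<le>n. of_rat (r m k) * inverse \<alpha> ^ k) =
       (\<Sum>k\<le>s. of_rat (r m k) * inverse \<alpha> ^ k) + (\<Sum>k\<in>{s<..n}. of_rat (r m k) * inverse \<alpha> ^ k)"
      by (simp only:) (rule sum.union_disjoint; auto)
    moreover have "(\<Sum>k\<le>n. of_rat (r m k) * inverse (b m) ^ k) = 0"
      using root[OF that] poly_G by simp
    ultimately show ?thesis by (simp add: right_diff_distrib sum_subtractf)
  qed
  have lim3: "(\<lambda>m. u (\<Sum>k\<le>s. of_rat (r m k) * inverse \<alpha> ^ k)) \<longlonglongrightarrow> 0"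
  proof (rule Lim_transform_eventually)
    let ?A = "\<lambda>m. \<Sum>k\<le>n. of_rat (r m k) * (inverse (b m) ^ k - inverse \<alpha> ^ k)"
    let ?B = "\<lambda>m. \<Sum>k\<in>{s<..n}. of_rat (r m k) * inverse \<alpha> ^ k"
    have AB: "?A m \<in> K" "?B m \<in> K" for m using b by (auto intro!: K.mem_intros)
    have "(\<lambda>m. u (- ?A m + - ?B m)) \<longlonglongrightarrow> 0"
      using lim1 lim2 AB by (intro U.null_add) (auto simp: U.uminus K.uminus_mem simp del: sum_negf)
    then show "(\<lambda>m. u (- ?A m - ?B m)) \<longlonglongrightarrow> 0" by simp
    show "\<forall>\<^sub>F m in sequentially. u (- ?A m - ?B m) = u (\<Sum>k\<le>s. of_rat (r m k) * inverse \<alpha> ^ k)"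
      using ev
    proof eventually_elim
      case (elim m)
      show ?case by (subst decomp[OF elim]) (rule refl)
    qed
  qed
  have lim4: "(\<lambda>m. u ((\<Sum>k\<le>s. of_rat (r m k) * inverse \<alpha> ^ k) * \<alpha> ^ s)) \<longlonglongrightarrow> 0"
    using lim3 by (intro U.null_mult[where c = "u (\<alpha> ^ s)"]) (auto intro!: K.mem_intros)
  \<comment> \<open>Multiplication by \<alpha>^s and the reversal j = s - k turn a relation in
    1/\<alpha> into one in \<alpha>, which is monic because \<open>r m 0\<close> is 1.\<close>
  have eq: "(\<Sum>k\<le>s. of_rat (r m k) * inverse \<alpha> ^ k) * \<alpha> ^ s
      = \<alpha> ^ s - (\<Sum>j<s. of_rat (- r m (s - j)) * \<alpha> ^ j)" for m
  proof -
    have "(\<Sum>k\<le>s. of_rat (r m k) * inverse \<alpha> ^ k) * \<alpha> ^ s = (\<Sum>k\<le>s. of_rat (r m k) * \<alpha> ^ (s - k))"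
      unfolding sum_distrib_right using nz
      by (intro sum.cong) (auto simp: power_diff power_inverse divide_inverse)
    also have "\<dots> = (\<Sum>j\<le>s. of_rat (r m (s - j)) * \<alpha> ^ j)"
      by (rule sum.reindex_bij_witness[of _ "\<lambda>j. s - j" "\<lambda>k. s - k"]) auto
    also have "\<dots> = (\<Sum>j<s. of_rat (r m (s - j)) * \<alpha> ^ j) + \<alpha> ^ s"
      by (simp add: lessThan_Suc_atMost[symmetric] r0)
    finally show ?thesis by (simp add: of_rat_minus sum_negf)
  qed
  show ?thesis
  proof (rule that[of "\<lambda>m j. - r m (s - j)"])
    show "cauchy_in u (\<lambda>m. of_rat (- r m (s - j)))" for j
      using U.cauchy_uminus[OF _ r_cauchy[of "s - j"]] by (simp add: of_rat_minus)
    show "(\<lambda>m. u (\<alpha> ^ card S - (\<Sum>j<card S. of_rat (- r m (s - j)) * \<alpha> ^ j))) \<longlonglongrightarrow> 0"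
      using lim4 unfolding eq by (simp add: s_def)
  qed
qed

text \<open>Says, in terms of representatives, that the class of \<xi> in the completion is a
  combination of the first card S powers of \<alpha> with coefficients in the closure of
  \<rat>.\<close>

definition spanned :: "(nat \<Rightarrow> complex) \<Rightarrow> bool" where
  "spanned \<xi> \<longleftrightarrow> (\<exists>q :: nat \<Rightarrow> nat \<Rightarrow> rat. (\<forall>j. cauchy_in u (\<lambda>m. of_rat (q m j))) \<and>
     (\<lambda>m. u (\<xi> m - (\<Sum>j<card S. of_rat (q m j) * \<alpha> ^ j))) \<longlonglongrightarrow> 0)"

lemma spannedE:
  assumes "spanned \<xi>"
  obtains q :: "nat \<Rightarrow> nat \<Rightarrow> rat" where "\<And>j. cauchy_in u (\<lambda>m. of_rat (q m j))"
    "(\<lambda>m. u (\<xi> m - (\<Sum>j<card S. of_rat (q m j) * \<alpha> ^ j))) \<longlonglongrightarrow> 0"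
  using assms unfolding spanned_def by blast

lemma spanned_perturb:
  assumes "\<And>m. \<xi> m \<in> K" "\<And>m. \<eta> m \<in> K" "spanned \<xi>" "(\<lambda>m. u (\<eta> m - \<xi> m)) \<longlonglongrightarrow> 0"
  shows "spanned \<eta>"
proof -
  obtain q where q: "\<And>j. cauchy_in u (\<lambda>m. of_rat (q m j))"
    "(\<lambda>m. u (\<xi> m - (\<Sum>j<card S. of_rat (q m j) * \<alpha> ^ j))) \<longlonglongrightarrow> 0"
    using assms(3) by (rule spannedE) (rule that)
  have "(\<lambda>m. u ((\<eta> m - \<xi> m) + (\<xi> m - (\<Sum>j<card S. of_rat (q m j) * \<alpha> ^ j)))) \<longlonglongrightarrow> 0"
    using assms q by (intro U.null_add) (auto intro!: K.mem_intros)
  with q(1) show ?thesis unfolding spanned_def by (intro exI[of _ q]) simp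
qed

lemma spanned_zero: "spanned (\<lambda>_. 0)"
  unfolding spanned_def by (intro exI[of _ "\<lambda>_ _. 0"]) (auto intro: U.cauchy_const)

lemma spanned_add:
  assumes "\<And>m. \<xi> m \<in> K" "\<And>m. \<eta> m \<in> K" "spanned \<xi>" "spanned \<eta>"
  shows "spanned (\<lambda>m. \<xi> m + \<eta> m)"
proof -
  obtain q where q: "\<And>j. cauchy_in u (\<lambda>m. of_rat (q m j))"
    "(\<lambda>m. u (\<xi> m - (\<Sum>j<card S. of_rat (q m j) * \<alpha> ^ j))) \<longlonglongrightarrow> 0"
    using assms(3) by (rule spannedE) (rule that)
  obtain r where r: "\<And>j. cauchy_in u (\<lambda>m. of_rat (r m j))"
    "(\<lambda>m. u (\<eta> m - (\<Sum>j<card S. of_rat (r m j) * \<alpha> ^ j))) \<longlonglongrightarrow> 0"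
    using assms(4) by (rule spannedE) (rule that)
  have "(\<lambda>m. u ((\<xi> m - (\<Sum>j<card S. of_rat (q m j) * \<alpha> ^ j)) +
      (\<eta> m - (\<Sum>j<card S. of_rat (r m j) * \<alpha> ^ j)))) \<longlonglongrightarrow> 0"
    using assms q r by (intro U.null_add) (auto intro!: K.mem_intros)
  moreover have "cauchy_in u (\<lambda>m. of_rat (q m j + r m j))" for j
    using U.cauchy_add[OF _ _ q(1) r(1)] by (simp add: of_rat_add)
  ultimately show ?thesis unfolding spanned_def
    by (intro exI[of _ "\<lambda>m j. q m j + r m j"]) (simp add: of_rat_add distrib_right sum.distrib algebra_simps)
qed

lemma spanned_smult:
  assumes "\<And>m. \<xi> m \<in> K" "spanned \<xi>" "cauchy_in u (\<lambda>m. of_rat (a m))"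
  shows "spanned (\<lambda>m. of_rat (a m) * \<xi> m)"
proof -
  obtain q where q: "\<And>j. cauchy_in u (\<lambda>m. of_rat (q m j))"
    "(\<lambda>m. u (\<xi> m - (\<Sum>j<card S. of_rat (q m j) * \<alpha> ^ j))) \<longlonglongrightarrow> 0"
    using assms(2) by (rule spannedE) (rule that)
  obtain L where L: "(\<lambda>m. u (of_rat (a m))) \<longlonglongrightarrow> L"
    using U.cauchy_abs[OF _ assms(3)] by auto
  have "(\<lambda>m. u ((\<xi> m - (\<Sum>j<card S. of_rat (q m j) * \<alpha> ^ j)) * of_rat (a m))) \<longlonglongrightarrow> 0"
    using assms(1) q by (intro U.null_mult[OF _ _ _ L]) (auto intro!: K.mem_intros)
  moreover have "cauchy_in u (\<lambda>m. of_rat (a m * q m j))" for j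
    using U.cauchy_mult[OF _ _ assms(3) q(1)] by (simp add: of_rat_mult)
  moreover have "of_rat (a m) * \<xi> m - (\<Sum>j<card S. of_rat (a m * q m j) * \<alpha> ^ j) =
     (\<xi> m - (\<Sum>j<card S. of_rat (q m j) * \<alpha> ^ j)) * of_rat (a m)" for m
    by (simp add: of_rat_mult sum_distrib_left algebra_simps)
  ultimately show ?thesis unfolding spanned_def
    by (intro exI[of _ "\<lambda>m j. a m * q m j"]) simp
qed

lemma spanned_sum:
  assumes "finite I" "\<And>i m. i \<in> I \<Longrightarrow> \<xi> i m \<in> K" "\<And>i. i \<in> I \<Longrightarrow> spanned (\<xi> i)"
    "\<And>i. i \<in> I \<Longrightarrow> cauchy_in u (\<lambda>m. of_rat (a m i))"
  shows "spanned (\<lambda>m. \<Sum>i\<in>I. of_rat (a m i) * \<xi> i m)"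
  using assms
proof (induction I rule: finite_induct)
  case (insert i I)
  have "spanned (\<lambda>m. of_rat (a m i) * \<xi> i m + (\<Sum>i\<in>I. of_rat (a m i) * \<xi> i m))"
    using insert by (intro spanned_add spanned_smult insert.IH) (auto intro!: K.mem_intros)
  with insert.hyps show ?case by simp
qed (simp add: spanned_zero)

text \<open>Exponents below card S are immediate and card S itself is \<open>relation\<close>.
  Higher powers follow by multiplying a representation by \<alpha>, which raises the exponents to
  card S at most.\<close>

lemma spanned_power: "spanned (\<lambda>_. \<alpha> ^ i)"
proof (induction i)
  have le: "spanned (\<lambda>_. \<alpha> ^ i)" if "i \<le> card S" for i
  proof (cases "i = card S")
    case True
    obtain g :: "nat \<Rightarrow> nat \<Rightarrow> rat" where "\<And>j. cauchy_in u (\<lambda>m. of_rat (g m j))"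
      "(\<lambda>m. u (\<alpha> ^ card S - (\<Sum>j<card S. of_rat (g m j) * \<alpha> ^ j))) \<longlonglongrightarrow> 0"
      by (rule relation) (rule that)
    with True show ?thesis
      unfolding spanned_def by (intro exI[of _ g]) simp
  next
    case False
    with that have "(\<Sum>j<card S. of_rat (if j = i then 1 else 0) * \<alpha> ^ j) = \<alpha> ^ i"
      by (simp add: if_distrib[of of_rat] if_distrib[of "\<lambda>x. x * _"] cong: if_cong)
    moreover have "cauchy_in u (\<lambda>m. of_rat (if j = i then 1 else 0))" for j
      by (intro U.cauchy_const) auto
    ultimately show ?thesis
      unfolding spanned_def by (intro exI[of _ "\<lambda>m j. if j = i then 1 else 0"]) simp
  qed
  case 0
  show ?case using le[of 0] by simp
  case (Suc i)
  obtain q where q: "\<And>j. cauchy_in u (\<lambda>m. of_rat (q m j))"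
    "(\<lambda>m. u (\<alpha> ^ i - (\<Sum>j<card S. of_rat (q m j) * \<alpha> ^ j))) \<longlonglongrightarrow> 0"
    using Suc by (rule spannedE) (rule that)
  have leS: "spanned (\<lambda>_. \<alpha> ^ Suc j)" if "j < card S" for j
    by (rule le) (use that in simp)
  have sp: "spanned (\<lambda>m. \<Sum>j<card S. of_rat (q m j) * \<alpha> ^ Suc j)"
    using q(1) leS by (intro spanned_sum) (auto intro!: K.mem_intros simp del: power_Suc)
  have "(\<lambda>m. u ((\<alpha> ^ i - (\<Sum>j<card S. of_rat (q m j) * \<alpha> ^ j)) * \<alpha>)) \<longlonglongrightarrow> 0"
    using q(2) by (intro U.null_mult[where c = "u \<alpha>"]) (auto intro!: K.mem_intros)
  moreover have "(\<alpha> ^ i - (\<Sum>j<card S. of_rat (q m j) * \<alpha> ^ j)) * \<alpha>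
      = \<alpha> ^ Suc i - (\<Sum>j<card S. of_rat (q m j) * \<alpha> ^ Suc j)" for m
    by (simp add: sum_distrib_left algebra_simps)
  ultimately have "(\<lambda>m. u (\<alpha> ^ Suc i - (\<Sum>j<card S. of_rat (q m j) * \<alpha> ^ Suc j))) \<longlonglongrightarrow> 0"
    by simp
  with sp show ?case
    by (rule spanned_perturb[rotated 2]) (auto intro!: K.mem_intros)
qed

theorem cauchy_spanned:
  assumes "\<And>m. \<xi> m \<in> K" "cauchy_in u \<xi>"
  shows "spanned \<xi>"
proof -
  obtain q where q: "\<And>j. cauchy_in u (\<lambda>m. of_rat (q m j))"
    "(\<lambda>m. u (\<xi> m - (\<Sum>j<card Z. of_rat (q m j) * \<alpha> ^ j))) \<longlonglongrightarrow> 0"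
    by (rule spanned_by_powers[of \<xi>, OF assms]) (rule that)
  have "spanned (\<lambda>m. \<Sum>j<card Z. of_rat (q m j) * \<alpha> ^ j)"
    using q(1) spanned_power by (intro spanned_sum) (auto intro!: K.mem_intros)
  from this q(2) show ?thesis
    by (rule spanned_perturb[rotated 2]) (use assms in \<open>auto intro!: K.mem_intros\<close>)
qed

text \<open>At each of the card S nodes the polynomial has the same absolute value as at \<alpha>
  under u, so interpolation over S alone bounds every coefficient by a constant multiple of
  it.\<close>

theorem powers_independent:
  assumes lim: "(\<lambda>m. u (\<Sum>j<card S. of_rat (q m j) * \<alpha> ^ j)) \<longlonglongrightarrow> 0" and j: "j < card S"
  shows "(\<lambda>m. u (of_rat (q m j))) \<longlonglongrightarrow> 0"
proof -
  define Q where "Q m = (\<Sum>j<card S. Polynomial.monom (q m j) j)" for m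
  have rp: "rpoly (Q m) z = (\<Sum>j<card S. of_rat (q m j) * z ^ j)" for m z
    by (simp add: Q_def)
  have cf: "coeff (Q m) j = q m j" for m
    using j by (simp add: Q_def coeff_sum coeff_monom)
  have deg: "degree (Q m) < card S" for m
  proof -
    have "degree (Q m) \<le> card S - 1"
      unfolding Q_def by (intro degree_sum_le) (auto intro: order.trans[OF degree_monom_le])
    then show ?thesis using j by linarith
  qed
  have wu: "w (rpoly (Q m) z) = u (rpoly (Q m) \<alpha>)" if "z \<in> S" for m z
    using w_emb[OF that, of "rpoly (Q m) \<alpha>"] emb_rpoly[OF alg] that S_sub rpoly_in_rat_adjoin[OF alg] by auto
  show ?thesis
  proof (rule U.null_comparison)
    show "of_rat (q m j) \<in> K" for m by simp
    show "u (of_rat (q m j)) \<le> (\<Sum>z\<in>S. u (rpoly (Q m) \<alpha>) * w (coeff (lagrange S z) j))" for m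
      using w_coeff_le[OF fin_S S_sub deg, of m j] wu by (simp add: cf u_rat cong: sum.cong)
    have "(\<lambda>m. \<Sum>z\<in>S. u (rpoly (Q m) \<alpha>) * w (coeff (lagrange S z) j)) \<longlonglongrightarrow> (\<Sum>z\<in>S. 0 * w (coeff (lagrange S z) j))"
      using lim unfolding rp by (intro tendsto_sum tendsto_mult tendsto_const)
    then show "(\<lambda>m. \<Sum>z\<in>S. u (rpoly (Q m) \<alpha>) * w (coeff (lagrange S z) j)) \<longlonglongrightarrow> 0" by simp
  qed
qed

text \<open>For empty S the spanning family is empty and the constant sequence 1 would be null.
  Consequently every absolute value over p is the pullback of w along some embedding.\<close>

lemma S_nonempty: "S \<noteq> {}"
proof
  assume "S = {}"
  obtain q where "(\<lambda>m. u (1 - (\<Sum>j<card S. of_rat (q m j) * \<alpha> ^ j))) \<longlonglongrightarrow> 0"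
    using cauchy_spanned[of "\<lambda>_. 1"] U.cauchy_const[of 1] unfolding spanned_def by auto
  then show False using \<open>S = {}\<close> by (simp add: LIMSEQ_const_iff)
qed

end

section \<open>Local degrees\<close>

context valued_field
begin

abbreviation "R \<equiv> cauchy_ring K v"
abbreviation "N \<equiv> null_sequences K v"

lemma cauchy_ring_simps [simp]:
  "x \<otimes>\<^bsub>R\<^esub> y = (\<lambda>n. x n * y n)" "x \<oplus>\<^bsub>R\<^esub> y = (\<lambda>n. x n + y n)"
  "\<one>\<^bsub>R\<^esub> = (\<lambda>n. 1)" "\<zero>\<^bsub>R\<^esub> = (\<lambda>n. 0)"
  by (simp_all add: cauchy_ring_def)

lemma cauchy_carrier: "x \<in> carrier R \<longleftrightarrow> (\<forall>m. x m \<in> K) \<and> cauchy_in v x"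
  by (auto simp: cauchy_ring_def cauchy_in_def)

lemma null_iff: "x \<in> N \<longleftrightarrow> (\<forall>m. x m \<in> K) \<and> (\<lambda>m. v (x m)) \<longlonglongrightarrow> 0"
  using null_imp_cauchy by (auto simp: null_sequences_def cauchy_carrier)

lemma cring_cauchy: "cring R"
proof (rule cringI)
  show "abelian_group R"
  proof (rule abelian_groupI)
    fix x assume x: "x \<in> carrier R"
    then show "\<exists>y\<in>carrier R. y \<oplus>\<^bsub>R\<^esub> x = \<zero>\<^bsub>R\<^esub>"
      by (intro bexI[of _ "\<lambda>n. - x n"]) (auto simp: cauchy_carrier intro: uminus_mem cauchy_uminus)
  qed (auto simp: cauchy_carrier add_mem cauchy_add cauchy_const algebra_simps)
  show "comm_monoid R"
    by (rule comm_monoidI) (auto simp: cauchy_carrier mult_mem cauchy_mult cauchy_const algebra_simps)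
qed (auto simp: algebra_simps)

lemma cauchy_minus:
  assumes "x \<in> carrier R"
  shows "\<ominus>\<^bsub>R\<^esub> x = (\<lambda>n. - x n)"
proof -
  interpret R: cring R by (rule cring_cauchy)
  show ?thesis
    using assms by (intro R.minus_equality) (auto simp: cauchy_carrier intro: uminus_mem cauchy_uminus)
qed

lemma null_ideal: "ideal N R"
proof (rule idealI)
  interpret R: cring R by (rule cring_cauchy)
  show "ring R" by (rule R.ring_axioms)
  show "subgroup N (add_monoid R)"
  proof (rule R.add.subgroupI)
    show "N \<subseteq> carrier R" by (auto simp: null_sequences_def)
    have "(\<lambda>_. 0) \<in> N" by (simp add: null_iff)
    then show "N \<noteq> {}" by blast
    fix a b assume a: "a \<in> N"
    then have "\<ominus>\<^bsub>R\<^esub> a = (\<lambda>n. - a n)"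
      by (intro cauchy_minus) (auto simp: null_sequences_def)
    with a show "\<ominus>\<^bsub>R\<^esub> a \<in> N" by (auto simp: null_iff uminus uminus_mem)
    assume "b \<in> N"
    with a show "a \<oplus>\<^bsub>R\<^esub> b \<in> N" by (auto simp: null_iff intro: add_mem null_add)
  qed
  have *: "(\<lambda>n. a n * x n) \<in> N" if a: "a \<in> N" and x: "x \<in> carrier R" for a x
  proof -
    obtain L where "(\<lambda>m. v (x m)) \<longlonglongrightarrow> L"
      using cauchy_abs[of x] x by (auto simp: cauchy_carrier)
    with a x show ?thesis
      by (auto simp: null_iff cauchy_carrier intro: mult_mem null_mult)
  qed
  fix a x assume "a \<in> N" "x \<in> carrier R"
  from *[OF this] show "x \<otimes>\<^bsub>R\<^esub> a \<in> N" "a \<otimes>\<^bsub>R\<^esub> x \<in> N"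
    by (simp_all add: mult.commute)
qed

abbreviation "Q \<equiv> R Quot N"
abbreviation cls :: "(nat \<Rightarrow> complex) \<Rightarrow> (nat \<Rightarrow> complex) set" where "cls x \<equiv> N +>\<^bsub>R\<^esub> x"

lemma cls_hom: "ring_hom_ring R Q cls"
  by (rule ideal.rcos_ring_hom_ring[OF null_ideal])

lemma carrier_Q: "carrier Q = cls ` carrier R"
  by (auto simp: FactRing_def A_RCOSETS_def' )

lemma cls_eq_iff:
  assumes "x \<in> carrier R" "y \<in> carrier R"
  shows "cls x = cls y \<longleftrightarrow> (\<lambda>m. v (x m - y m)) \<longlonglongrightarrow> 0"
proof -
  interpret R: cring R by (rule cring_cauchy)
  have "x \<ominus>\<^bsub>R\<^esub> y = (\<lambda>n. x n - y n)"
    using assms(2) by (simp add: a_minus_def cauchy_minus)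
  then show ?thesis
    using R.quotient_eq_iff_same_a_r_cos[OF null_ideal assms] assms
    by (auto simp: null_iff cauchy_carrier diff_mem)
qed

lemma cls_ops:
  assumes "x \<in> carrier R" "y \<in> carrier R"
  shows "cls x \<otimes>\<^bsub>Q\<^esub> cls y = cls (\<lambda>n. x n * y n)" "cls x \<oplus>\<^bsub>Q\<^esub> cls y = cls (\<lambda>n. x n + y n)"
    "\<ominus>\<^bsub>Q\<^esub> cls x = cls (\<lambda>n. - x n)"
proof -
  interpret h: ring_hom_ring R Q cls by (rule cls_hom)
  show "cls x \<otimes>\<^bsub>Q\<^esub> cls y = cls (\<lambda>n. x n * y n)" "cls x \<oplus>\<^bsub>Q\<^esub> cls y = cls (\<lambda>n. x n + y n)"
    using h.hom_mult[OF assms] h.hom_add[OF assms] by simp_all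
  show "\<ominus>\<^bsub>Q\<^esub> cls x = cls (\<lambda>n. - x n)"
    using h.hom_a_inv[OF assms(1)] by (simp add: cauchy_minus[OF assms(1)])
qed

lemma cls_one_zero: "\<one>\<^bsub>Q\<^esub> = cls (\<lambda>n. 1)" "\<zero>\<^bsub>Q\<^esub> = cls (\<lambda>n. 0)"
proof -
  interpret h: ring_hom_ring R Q cls by (rule cls_hom)
  show "\<one>\<^bsub>Q\<^esub> = cls (\<lambda>n. 1)" "\<zero>\<^bsub>Q\<^esub> = cls (\<lambda>n. 0)"
    using h.hom_one h.hom_zero by simp_all
qed

lemma const_carrier [simp]: "a \<in> K \<Longrightarrow> (\<lambda>_. a) \<in> carrier R"
  by (simp add: cauchy_carrier cauchy_const)

text \<open>The absolute values of a Cauchy sequence that is not null tend to a positive limit. Only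
  finitely many terms can vanish; they are inverted to 0, which does not affect the class.\<close>

lemma cls_inverse:
  assumes x: "x \<in> carrier R" and nz: "cls x \<noteq> \<zero>\<^bsub>Q\<^esub>"
  shows "(\<lambda>m. inverse (x m)) \<in> carrier R" "cls x \<otimes>\<^bsub>Q\<^esub> cls (\<lambda>m. inverse (x m)) = \<one>\<^bsub>Q\<^esub>"
proof -
  have xK: "x m \<in> K" and xc: "cauchy_in v x" for m
    using x by (auto simp: cauchy_carrier)
  have nn: "\<not> (\<lambda>m. v (x m)) \<longlonglongrightarrow> 0"
    using nz cls_eq_iff[OF x, of "\<lambda>_. 0"] by (simp add: cls_one_zero)
  note inv = cauchy_inverse[OF xK xc nn]
  show ix: "(\<lambda>m. inverse (x m)) \<in> carrier R"
    using inv(1) xK by (auto simp: cauchy_carrier inverse_mem)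
  have "(\<lambda>m. x m * inverse (x m)) \<in> carrier R"
    using xK xc inv(1) by (auto simp: cauchy_carrier intro!: mult_mem inverse_mem cauchy_mult)
  then show "cls x \<otimes>\<^bsub>Q\<^esub> cls (\<lambda>m. inverse (x m)) = \<one>\<^bsub>Q\<^esub>"
    unfolding cls_ops(1)[OF x ix] cls_one_zero using inv(2) by (subst cls_eq_iff) auto
qed

lemma field_Q: "field Q"
proof (rule cring.cring_fieldI2)
  show "cring Q" by (rule ideal.quotient_is_cring[OF null_ideal cring_cauchy])
  show "\<zero>\<^bsub>Q\<^esub> \<noteq> \<one>\<^bsub>Q\<^esub>"
    unfolding cls_one_zero by (subst cls_eq_iff) (auto simp: LIMSEQ_const_iff uminus)
  fix a assume a: "a \<in> carrier Q" "a \<noteq> \<zero>\<^bsub>Q\<^esub>"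
  then obtain x where x: "x \<in> carrier R" "a = cls x" by (auto simp: carrier_Q)
  have nz: "cls x \<noteq> \<zero>\<^bsub>Q\<^esub>" using a(2) x(2) by simp
  show "\<exists>b\<in>carrier Q. a \<otimes>\<^bsub>Q\<^esub> b = \<one>\<^bsub>Q\<^esub>"
    unfolding x(2) carrier_Q using cls_inverse[OF x(1) nz]
    by (intro bexI[of _ "cls (\<lambda>m. inverse (x m))"] imageI)
qed

text \<open>The copy of the completed rationals, \<rat> completed at p, inside the completion; it
  becomes \<open>rat_completion\<close> when v is the \<open>place_norm\<close> of the
  place.\<close>

definition rat_classes :: "(nat \<Rightarrow> complex) set set" where
  "rat_classes = {cls x | x. x \<in> carrier R \<and> range x \<subseteq> \<rat>}"

lemma subfield_rat_classes: "subfield rat_classes Q"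
proof (rule field.subfieldI'[OF field_Q])
  interpret Q: field Q by (rule field_Q)
  show "subring rat_classes Q"
  proof (rule Q.subringI)
    show "rat_classes \<subseteq> carrier Q" by (auto simp: rat_classes_def carrier_Q)
    show "\<one>\<^bsub>Q\<^esub> \<in> rat_classes"
      unfolding rat_classes_def cls_one_zero
      by (intro CollectI exI[of _ "\<lambda>_. 1"] conjI refl const_carrier one_mem) simp
    fix a b assume "a \<in> rat_classes"
    then obtain x where x: "a = cls x" "x \<in> carrier R" "range x \<subseteq> \<rat>" by (auto simp: rat_classes_def)
    show "\<ominus>\<^bsub>Q\<^esub> a \<in> rat_classes"
      unfolding rat_classes_def x(1) cls_ops(3)[OF x(2,2)] using x(2,3)
      by (intro CollectI exI[of _ "\<lambda>n. - x n"]) (auto simp: cauchy_carrier uminus_mem cauchy_uminus)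
    assume "b \<in> rat_classes"
    then obtain y where y: "b = cls y" "y \<in> carrier R" "range y \<subseteq> \<rat>" by (auto simp: rat_classes_def)
    show "a \<otimes>\<^bsub>Q\<^esub> b \<in> rat_classes"
      unfolding rat_classes_def x(1) y(1) cls_ops(1)[OF x(2) y(2)] using x(2,3) y(2,3)
      by (intro CollectI exI[of _ "\<lambda>n. x n * y n"])
        (auto simp: cauchy_carrier mult_mem cauchy_mult image_subset_iff intro!: Rats_mult)
    show "a \<oplus>\<^bsub>Q\<^esub> b \<in> rat_classes"
      unfolding rat_classes_def x(1) y(1) cls_ops(2)[OF x(2) y(2)] using x(2,3) y(2,3)
      by (intro CollectI exI[of _ "\<lambda>n. x n + y n"])
        (auto simp: cauchy_carrier add_mem cauchy_add image_subset_iff intro!: Rats_add)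
  qed
  fix a assume a: "a \<in> rat_classes - {\<zero>\<^bsub>Q\<^esub>}"
  then obtain x where x: "a = cls x" "x \<in> carrier R" "range x \<subseteq> \<rat>" by (auto simp: rat_classes_def)
  note inv = cls_inverse[OF x(2)]
  have "inv\<^bsub>Q\<^esub> a = cls (\<lambda>m. inverse (x m))"
    using inv a x by (intro Q.comm_inv_char) (auto simp: carrier_Q)
  moreover have "(\<lambda>m. inverse (x m)) \<in> carrier R"
    using inv(1) a x(1) by blast
  ultimately show "inv\<^bsub>Q\<^esub> a \<in> rat_classes"
    unfolding rat_classes_def using x(3)
    by (intro CollectI exI[of _ "\<lambda>m. inverse (x m)"]) (auto simp: image_subset_iff)
qed

lemma finsum_R:
  assumes "\<And>j. j < n \<Longrightarrow> f j \<in> carrier R"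
  shows "(\<Oplus>\<^bsub>R\<^esub>j\<in>{..<n::nat}. f j) = (\<lambda>m. \<Sum>j<n. f j m)"
  using assms
proof (induction n)
  case 0
  interpret R: cring R by (rule cring_cauchy)
  show ?case by (simp add: R.finsum_empty)
next
  case (Suc n)
  interpret R: cring R by (rule cring_cauchy)
  have "(\<Oplus>\<^bsub>R\<^esub>j\<in>insert n {..<n}. f j) = f n \<oplus>\<^bsub>R\<^esub> (\<Oplus>\<^bsub>R\<^esub>j\<in>{..<n}. f j)"
    using Suc.prems by (intro R.finsum_insert) auto
  also have "(\<Oplus>\<^bsub>R\<^esub>j\<in>{..<n}. f j) = (\<lambda>m. \<Sum>j<n. f j m)"
    using Suc.prems by (intro Suc.IH) auto
  finally show ?case by (simp add: lessThan_Suc)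
qed

lemma finsum_cls:
  assumes "\<And>j. j < n \<Longrightarrow> c j \<in> carrier R" "\<And>j. j < n \<Longrightarrow> f j \<in> carrier R"
  shows "(\<Oplus>\<^bsub>Q\<^esub>j\<in>{..<n::nat}. cls (c j) \<otimes>\<^bsub>Q\<^esub> cls (f j)) = cls (\<lambda>m. \<Sum>j<n. c j m * f j m)"
    "(\<lambda>m. \<Sum>j<n. c j m * f j m) \<in> carrier R"
proof -
  interpret R: cring R by (rule cring_cauchy)
  interpret Q: field Q by (rule field_Q)
  interpret h: ring_hom_ring R Q cls by (rule cls_hom)
  have mem: "c j \<otimes>\<^bsub>R\<^esub> f j \<in> carrier R" if "j < n" for j
    using that assms by (intro R.m_closed) auto
  then have sum: "(\<Oplus>\<^bsub>R\<^esub>j\<in>{..<n}. c j \<otimes>\<^bsub>R\<^esub> f j) = (\<lambda>m. \<Sum>j<n. c j m * f j m)"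
    by (subst finsum_R) auto
  have "(\<Oplus>\<^bsub>R\<^esub>j\<in>{..<n}. c j \<otimes>\<^bsub>R\<^esub> f j) \<in> carrier R"
    using mem by (intro R.finsum_closed) auto
  then show "(\<lambda>m. \<Sum>j<n. c j m * f j m) \<in> carrier R" by (simp only: sum)
  have "cls (\<Oplus>\<^bsub>R\<^esub>j\<in>{..<n}. c j \<otimes>\<^bsub>R\<^esub> f j) = (\<Oplus>\<^bsub>Q\<^esub>j\<in>{..<n}. (cls \<circ> (\<lambda>j. c j \<otimes>\<^bsub>R\<^esub> f j)) j)"
    using mem by (intro h.hom_finsum) auto
  also have "\<dots> = (\<Oplus>\<^bsub>Q\<^esub>j\<in>{..<n}. cls (c j) \<otimes>\<^bsub>Q\<^esub> cls (f j))"
    using assms by (intro Q.finsum_cong') (auto simp: h.hom_mult simp del: cauchy_ring_simps)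
  finally show "(\<Oplus>\<^bsub>Q\<^esub>j\<in>{..<n}. cls (c j) \<otimes>\<^bsub>Q\<^esub> cls (f j)) = cls (\<lambda>m. \<Sum>j<n. c j m * f j m)"
    unfolding sum ..
qed

end

context conj_place
begin

text \<open>The classes of the powers of \<alpha> below card S are a basis over the rational
  classes: they span by \<open>cauchy_spanned\<close> and are independent by
  \<open>powers_independent\<close>.\<close>

theorem local_degree_eq:
  assumes V: "place_norm V = u"
  shows "local_degree K V = card S"
proof -
  let ?R = "cauchy_ring K u"
  let ?N = "null_sequences K u"
  interpret Q: field "?R Quot ?N" by (rule U.field_Q)
  define f where "f j = U.cls (\<lambda>_. \<alpha> ^ j)" for j
  have pow: "(\<lambda>_. \<alpha> ^ j) \<in> carrier ?R" for j by (simp add: K.power_mem)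
  have mem: "U.cls x \<in> carrier (?R Quot ?N)" if "x \<in> carrier ?R" for x
    using that unfolding U.carrier_Q by blast
  have rat_repr: "\<exists>q :: nat \<Rightarrow> nat \<Rightarrow> rat. \<forall>j<card S. c j = U.cls (\<lambda>m. of_rat (q m j)) \<and> (\<lambda>m. of_rat (q m j)) \<in> carrier ?R"
    if c: "c \<in> {..<card S} \<rightarrow> U.rat_classes" for c
  proof -
    have "\<exists>q :: nat \<Rightarrow> rat. c j = U.cls (\<lambda>m. of_rat (q m)) \<and> (\<lambda>m. of_rat (q m)) \<in> carrier ?R" if "j < card S" for j
    proof -
      have "c j \<in> U.rat_classes" using c that by auto
      then obtain x where x: "c j = U.cls x" "x \<in> carrier ?R" "range x \<subseteq> \<rat>"
        unfolding U.rat_classes_def by blast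
      have "\<forall>m. \<exists>q. x m = of_rat q" using x(3) by (auto elim: Rats_cases)
      then obtain q where "\<And>m. x m = of_rat (q m)" by metis
      then have "x = (\<lambda>m. of_rat (q m))" by blast
      with x show ?thesis by blast
    qed
    then obtain q :: "nat \<Rightarrow> nat \<Rightarrow> rat" where
      "\<And>j. j < card S \<Longrightarrow> c j = U.cls (\<lambda>m. of_rat (q j m)) \<and> (\<lambda>m. of_rat (q j m)) \<in> carrier ?R"
      by metis
    then show ?thesis by (intro exI[of _ "\<lambda>m j. q j m"]) auto
  qed
  have fs: "(\<Oplus>\<^bsub>?R Quot ?N\<^esub>j\<in>{..<card S}. c j \<otimes>\<^bsub>?R Quot ?N\<^esub> f j) = U.cls (\<lambda>m. \<Sum>j<card S. of_rat (q m j) * \<alpha> ^ j)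
      \<and> (\<lambda>m. \<Sum>j<card S. of_rat (q m j) * \<alpha> ^ j) \<in> carrier ?R"
    if q: "\<forall>j<card S. c j = U.cls (\<lambda>m. of_rat (q m j)) \<and> (\<lambda>m. of_rat (q m j)) \<in> carrier ?R" for c q
  proof -
    note fc = U.finsum_cls[of "card S" "\<lambda>j m. of_rat (q m j)" "\<lambda>j _. \<alpha> ^ j"]
    have "(\<Oplus>\<^bsub>?R Quot ?N\<^esub>j\<in>{..<card S}. c j \<otimes>\<^bsub>?R Quot ?N\<^esub> f j) =
        (\<Oplus>\<^bsub>?R Quot ?N\<^esub>j\<in>{..<card S}. U.cls (\<lambda>m. of_rat (q m j)) \<otimes>\<^bsub>?R Quot ?N\<^esub> U.cls (\<lambda>_. \<alpha> ^ j))"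
      using q pow mem by (intro Q.finsum_cong') (auto simp: f_def)
    with fc q pow show ?thesis by simp
  qed
  have "Q.dim U.rat_classes (carrier (?R Quot ?N)) = card S"
  proof (rule Q.dim_eqI)
    show "subfield U.rat_classes (?R Quot ?N)" by (rule U.subfield_rat_classes)
    show "f \<in> {..<card S} \<rightarrow> carrier (?R Quot ?N)" using pow by (auto simp: f_def U.carrier_Q)
  next
    fix x
    show "x \<in> carrier (?R Quot ?N) \<longleftrightarrow>
      (\<exists>c\<in>{..<card S} \<rightarrow> U.rat_classes. x = (\<Oplus>\<^bsub>?R Quot ?N\<^esub>j\<in>{..<card S}. c j \<otimes>\<^bsub>?R Quot ?N\<^esub> f j))"
    proof
      assume "x \<in> carrier (?R Quot ?N)"
      then obtain \<xi> where \<xi>: "x = U.cls \<xi>" "\<xi> \<in> carrier ?R" by (auto simp: U.carrier_Q)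
      then have "spanned \<xi>" by (intro cauchy_spanned) (auto simp: U.cauchy_carrier)
      then obtain q :: "nat \<Rightarrow> nat \<Rightarrow> rat" where q: "\<And>j. cauchy_in u (\<lambda>m. of_rat (q m j))"
        "(\<lambda>m. u (\<xi> m - (\<Sum>j<card S. of_rat (q m j) * \<alpha> ^ j))) \<longlonglongrightarrow> 0"
        by (rule spannedE) (rule that)
      define c where "c j = U.cls (\<lambda>m. of_rat (q m j))" for j
      have qR: "(\<lambda>m. of_rat (q m j)) \<in> carrier ?R" for j
        using q(1) by (simp add: U.cauchy_carrier)
      have "x = U.cls (\<lambda>m. \<Sum>j<card S. of_rat (q m j) * \<alpha> ^ j)"
        unfolding \<xi>(1) using q(2) fs[of c q] qR \<xi>(2) by (subst U.cls_eq_iff) (auto simp: c_def)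
      then have "x = (\<Oplus>\<^bsub>?R Quot ?N\<^esub>j\<in>{..<card S}. c j \<otimes>\<^bsub>?R Quot ?N\<^esub> f j)"
        using fs[of c q] qR by (simp add: c_def)
      moreover have "c \<in> {..<card S} \<rightarrow> U.rat_classes"
        using qR by (auto simp: U.rat_classes_def c_def)
      ultimately show "\<exists>c\<in>{..<card S} \<rightarrow> U.rat_classes. x = (\<Oplus>\<^bsub>?R Quot ?N\<^esub>j\<in>{..<card S}. c j \<otimes>\<^bsub>?R Quot ?N\<^esub> f j)"
        by blast
    next
      assume "\<exists>c\<in>{..<card S} \<rightarrow> U.rat_classes. x = (\<Oplus>\<^bsub>?R Quot ?N\<^esub>j\<in>{..<card S}. c j \<otimes>\<^bsub>?R Quot ?N\<^esub> f j)"
      then obtain c where c: "c \<in> {..<card S} \<rightarrow> U.rat_classes"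
        "x = (\<Oplus>\<^bsub>?R Quot ?N\<^esub>j\<in>{..<card S}. c j \<otimes>\<^bsub>?R Quot ?N\<^esub> f j)" by blast
      obtain q where "\<forall>j<card S. c j = U.cls (\<lambda>m. of_rat (q m j)) \<and> (\<lambda>m. of_rat (q m j)) \<in> carrier ?R"
        using rat_repr[OF c(1)] by blast
      from fs[OF this] show "x \<in> carrier (?R Quot ?N)"
        unfolding c(2) U.carrier_Q by blast
    qed
  next
    fix c assume c: "c \<in> {..<card S} \<rightarrow> U.rat_classes"
      "(\<Oplus>\<^bsub>?R Quot ?N\<^esub>j\<in>{..<card S}. c j \<otimes>\<^bsub>?R Quot ?N\<^esub> f j) = \<zero>\<^bsub>?R Quot ?N\<^esub>"
    obtain q where q: "\<forall>j<card S. c j = U.cls (\<lambda>m. of_rat (q m j)) \<and> (\<lambda>m. of_rat (q m j)) \<in> carrier ?R"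
      using rat_repr[OF c(1)] by blast
    have "U.cls (\<lambda>m. \<Sum>j<card S. of_rat (q m j) * \<alpha> ^ j) = U.cls (\<lambda>_. 0)"
      using fs[OF q] c(2) U.cls_one_zero by simp
    then have "(\<lambda>m. u (\<Sum>j<card S. of_rat (q m j) * \<alpha> ^ j)) \<longlonglongrightarrow> 0"
      using fs[OF q] by (subst (asm) U.cls_eq_iff) auto
    then have "(\<lambda>m. u (of_rat (q m j))) \<longlonglongrightarrow> 0" if "j < card S" for j
      using that by (rule powers_independent)
    then show "\<forall>j<card S. c j = \<zero>\<^bsub>?R Quot ?N\<^esub>"
      using q unfolding U.cls_one_zero by (simp add: U.cls_eq_iff)
  qed
  then show ?thesis
    by (simp add: local_degree_def completion_def rat_completion_def V U.rat_classes_def)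
qed

end

section \<open>The Mahler measure as a product over rational places\<close>

text \<open>At infinity the usual modulus serves. At a prime r the integers are the starting ring,
  since they do not contain 1/r.\<close>

lemma abs_values_over_exist:
  assumes "p \<in> rat_places"
  shows "\<exists>w. w \<in> abs_values_over (Collect algebraic) p"
proof (cases p)
  case Archimedean
  have "abs_value_on (Collect algebraic) (restrict norm (Collect algebraic))"
    unfolding abs_value_on_def
    using ALG.add_mem ALG.mult_mem by (auto simp: norm_mult norm_triangle_ineq)
  moreover have "extends_rat_place Archimedean (restrict norm (Collect algebraic))"
    unfolding extends_rat_place_def
  proof
    fix x
    have "norm (complex_of_rat x) = \<bar>real_of_rat x\<bar>"
      by (cases x) (simp add: of_rat_rat norm_divide)
    then show "restrict norm (Collect algebraic) (complex_of_rat x) = rat_place_abs Archimedean x"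
      using ALG.of_rat_mem[of x] by simp
  qed
  ultimately show ?thesis
    using Archimedean by (auto simp: abs_values_over_def)
next
  case (Padic r)
  then have r: "prime r" using assms by (auto simp: rat_places_def)
  have "1 / complex_of_nat r \<notin> \<int>"
  proof
    assume "1 / complex_of_nat r \<in> \<int>"
    then obtain k where "1 / complex_of_nat r = of_int k" by (elim Ints_cases)
    then have "of_int (k * int r) = (of_int 1 :: complex)"
      using prime_gt_0_nat[OF r] by (simp add: field_simps)
    then have "k * int r = 1" by (simp only: of_int_eq_iff)
    then have "int r dvd 1" by (metis dvd_triv_right)
    then show False using prime_gt_1_nat[OF r] by auto
  qed
  moreover have "is_subring \<int>" by (auto simp: is_subring_def)
  ultimately obtain w where "abs_value_on (Collect algebraic) w" "extends_rat_place (Padic r) w"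
    using padic_extension_exists[OF r, of \<int>] by blast
  then show ?thesis
    using Padic unfolding abs_values_over_def by blast
qed

text \<open>The contribution of one rational place to the Mahler measure. At infinity it is the
  product over the roots in the classical formula; at a prime it is the Gauss norm of the monic
  minimal polynomial, and the finite factors together supply the leading coefficient of the
  classical formula.\<close>

definition local_mahler :: "(complex \<Rightarrow> real) \<Rightarrow> complex \<Rightarrow> real" where
  "local_mahler w \<alpha> = (\<Prod>z\<in>conjs \<alpha>. max 1 (w z))"

lemma local_mahler_ge_1: "local_mahler w \<alpha> \<ge> 1"
  unfolding local_mahler_def by (rule prod_ge_1) auto

lemma local_mahler_eq_1_iff:
  assumes "algebraic \<alpha>"
  shows "local_mahler w \<alpha> = 1 \<longleftrightarrow> (\<forall>z\<in>conjs \<alpha>. w z \<le> 1)"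
proof
  assume *: "local_mahler w \<alpha> = 1"
  show "\<forall>z\<in>conjs \<alpha>. w z \<le> 1"
  proof
    fix z assume z: "z \<in> conjs \<alpha>"
    have "1 = max 1 (w z) * (\<Prod>z\<in>conjs \<alpha> - {z}. max 1 (w z))"
      using * z finite_conjs[OF assms] by (simp add: local_mahler_def prod.remove)
    moreover have "(\<Prod>z\<in>conjs \<alpha> - {z}. max 1 (w z)) \<ge> 1" by (rule prod_ge_1) auto
    then have "max 1 (w z) * 1 \<le> max 1 (w z) * (\<Prod>z\<in>conjs \<alpha> - {z}. max 1 (w z))"
      by (intro mult_left_mono) auto
    ultimately show "w z \<le> 1" by simp
  qed
qed (auto simp: local_mahler_def intro!: prod.neutral)

text \<open>Conjugates are grouped by the absolute value that their embedding induces: all z in the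
  group of u have w(z) = u(\<alpha>), and the group is S. Finiteness holds because each absolute
  value is induced by a conjugate.\<close>

lemma local_product:
  assumes alg: "algebraic \<alpha>" and nz: "\<alpha> \<noteq> 0" and p: "p \<in> rat_places"
    and w: "w \<in> abs_values_over (Collect algebraic) p"
  shows "finite (abs_values_over (rat_adjoin \<alpha>) p)"
    and "(\<Prod>u\<in>abs_values_over (rat_adjoin \<alpha>) p. max 1 (u \<alpha>) ^ card (conj_place.S \<alpha> u w)) = local_mahler w \<alpha>"
proof -
  let ?K = "rat_adjoin \<alpha>"
  define g where "g z = restrict (\<lambda>x. w (emb \<alpha> z x)) ?K" for z
  have cp: "conj_place \<alpha> p u w" if "u \<in> abs_values_over ?K p" for u
    using alg nz p w that by (simp add: conj_place_def)
  have S: "conj_place.S \<alpha> u w = {z \<in> conjs \<alpha>. g z = u}" if u: "u \<in> abs_values_over ?K p" for u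
  proof -
    have "u \<in> extensional ?K" using u by (simp add: abs_values_over_def abs_value_on_def)
    then have "g z = u \<longleftrightarrow> (\<forall>x\<in>?K. w (emb \<alpha> z x) = u x)" for z
      by (auto simp: g_def fun_eq_iff extensional_def restrict_def)
    then show ?thesis by (auto simp: conj_place.S_def[OF cp[OF u]])
  qed
  have g: "g ` conjs \<alpha> \<subseteq> abs_values_over ?K p"
    using abs_value_on_emb[OF alg] extends_emb[OF alg] w by (auto simp: g_def abs_values_over_def)
  have "u \<in> g ` conjs \<alpha>" if u: "u \<in> abs_values_over ?K p" for u
    using conj_place.S_nonempty[OF cp[OF u]] S[OF u] by auto
  with g have eq: "abs_values_over ?K p = g ` conjs \<alpha>" by blast
  then show fin: "finite (abs_values_over ?K p)"
    using finite_conjs[OF alg] by simp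
  have "(\<Prod>u\<in>abs_values_over ?K p. max 1 (u \<alpha>) ^ card (conj_place.S \<alpha> u w)) =
      (\<Prod>u\<in>abs_values_over ?K p. \<Prod>z\<in>{z \<in> conjs \<alpha>. g z = u}. max 1 (w z))"
  proof (rule prod.cong)
    fix u assume u: "u \<in> abs_values_over ?K p"
    have "(\<Prod>z\<in>{z \<in> conjs \<alpha>. g z = u}. max 1 (w z)) = (\<Prod>z\<in>{z \<in> conjs \<alpha>. g z = u}. max 1 (u \<alpha>))"
      using self_in_rat_adjoin[OF alg] emb_self[OF alg] by (intro prod.cong) (auto simp: g_def)
    then show "max 1 (u \<alpha>) ^ card (conj_place.S \<alpha> u w) = (\<Prod>z\<in>{z \<in> conjs \<alpha>. g z = u}. max 1 (w z))"
      by (simp add: S[OF u])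
  qed simp
  also have "\<dots> = (\<Prod>z\<in>conjs \<alpha>. max 1 (w z))"
    by (rule prod.group[OF finite_conjs[OF alg] fin g])
  finally show "(\<Prod>u\<in>abs_values_over ?K p. max 1 (u \<alpha>) ^ card (conj_place.S \<alpha> u w)) = local_mahler w \<alpha>"
    by (simp add: local_mahler_def)
qed

text \<open>Raising the height to the degree of \<alpha> cancels the denominator in the exponents of
  the normalized absolute values and leaves the local degrees. P may be any finite set containing
  all nontrivial factors, so that two numbers can be compared over a common P.\<close>

theorem mahler_measure_eq:
  assumes alg: "algebraic \<alpha>" and nz: "\<alpha> \<noteq> 0"
    and W: "\<And>p. p \<in> rat_places \<Longrightarrow> W p \<in> abs_values_over (Collect algebraic) p"
    and P: "finite P" "P \<subseteq> rat_places"
    and triv: "\<And>p. p \<in> rat_places - P \<Longrightarrow> local_mahler (W p) \<alpha> = 1"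
  shows "mahler_measure \<alpha> = (\<Prod>p\<in>P. local_mahler (W p) \<alpha>)"
proof -
  let ?K = "rat_adjoin \<alpha>"
  define n where "n = card (conjs \<alpha>)"
  have n: "n > 0" using degree_minpoly_pos[OF alg] card_conjs[OF alg] by (simp add: n_def)
  have fd: "field_degree ?K = n" and ad: "alg_degree \<alpha> = n"
    using alg_degree_eq[OF alg] by (simp_all add: alg_degree_def n_def)
  define d where "d p u = card (conj_place.S \<alpha> u (W p))" for p u
  have cp: "conj_place \<alpha> p u (W p)" if "u \<in> abs_values_over ?K p" "p \<in> rat_places" for p u
    using alg nz W that by (simp add: conj_place_def)
  have d_pos: "d p u > 0" if "u \<in> abs_values_over ?K p" "p \<in> rat_places" for p u
    using conj_place.S_nonempty[OF cp[OF that]] conj_place.fin_S[OF cp[OF that]]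
    by (simp add: d_def card_gt_0_iff)
  define F where "F V = max 1 (place_abs ?K V \<alpha>)" for V
  define A where "A = {V \<in> places ?K. \<exists>p\<in>P. place_norm V \<in> abs_values_over ?K p}"
  note bij = place_norm_bij(1)[OF alg]
  have norm: "\<exists>p\<in>rat_places. place_norm V \<in> abs_values_over ?K p" if "V \<in> places ?K" for V
  proof -
    have "place_norm V \<in> normalized_abs_values ?K" using bij that by (auto simp: bij_betw_def)
    then show ?thesis by (auto simp: normalized_abs_values_def abs_values_over_def)
  qed
  \<comment> \<open>The exponent is positive, so taking the maximum with 1 commutes with the
    power.\<close>
  have F_eq: "F V = max 1 (u \<alpha>) powr (real (d p u) / real n)"
    if "place_norm V = u" "u \<in> abs_values_over ?K p" "p \<in> rat_places" for V u p
  proof -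
    have "place_abs ?K V \<alpha> = u \<alpha> powr (real (d p u) / real n)"
      using conj_place.local_degree_eq[OF cp[OF that(2,3)] that(1)]
      by (simp add: place_abs_def that(1) fd d_def)
    moreover have "u \<alpha> \<ge> 0"
      using that self_in_rat_adjoin[OF alg] by (auto simp: abs_values_over_def abs_value_on_def)
    moreover have "real (d p u) / real n > 0" using d_pos[OF that(2,3)] n by simp
    ultimately show ?thesis
      using powr_le1[of "real (d p u) / real n" "u \<alpha>"] ge_one_powr_ge_zero[of "u \<alpha>" "real (d p u) / real n"]
      by (cases "u \<alpha> \<le> 1") (auto simp: F_def max_def)
  qed
  have inj: "inj_on place_norm A"
    using bij by (auto simp: bij_betw_def A_def intro: inj_on_subset)
  have img: "place_norm ` A = (\<Union>p\<in>P. abs_values_over ?K p)"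
  proof
    show "place_norm ` A \<subseteq> (\<Union>p\<in>P. abs_values_over ?K p)" by (auto simp: A_def)
    show "(\<Union>p\<in>P. abs_values_over ?K p) \<subseteq> place_norm ` A"
    proof
      fix u assume "u \<in> (\<Union>p\<in>P. abs_values_over ?K p)"
      then obtain p where p: "p \<in> P" "u \<in> abs_values_over ?K p" by blast
      then have "u \<in> normalized_abs_values ?K"
        using P(2) by (auto simp: normalized_abs_values_def abs_values_over_def)
      then obtain V where "V \<in> places ?K" "u = place_norm V"
        using bij by (auto simp: bij_betw_def)
      with p show "u \<in> place_norm ` A" by (auto simp: A_def)
    qed
  qed
  have fin_over: "finite (abs_values_over ?K p)" if "p \<in> P" for p
    using local_product(1)[OF alg nz _ W] P(2) that by blast
  have finA: "finite A"
    using inj img P(1) fin_over by (metis finite_UN_I finite_image_iff)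
  \<comment> \<open>Some conjugate induces the absolute value at V, and triviality of the local
    factor bounds that conjugate by 1.\<close>
  have F1: "F V = 1" if V: "V \<in> places ?K - A" for V
  proof -
    obtain p where p: "p \<in> rat_places" "place_norm V \<in> abs_values_over ?K p"
      using norm[of V] V by blast
    then have pP: "p \<in> rat_places - P" using V by (auto simp: A_def)
    interpret cp: conj_place \<alpha> p "place_norm V" "W p" by (rule cp[OF p(2,1)])
    obtain z where z: "z \<in> cp.S" using cp.S_nonempty by blast
    have "W p z \<le> 1"
      using triv[OF pP] local_mahler_eq_1_iff[OF alg] z cp.S_sub by blast
    moreover have "W p z = place_norm V \<alpha>"
      using cp.w_emb[OF z cp.\<alpha>_mem] emb_self[OF alg] z cp.S_sub by auto
    ultimately show ?thesis
      using F_eq[OF refl p(2,1)] by (simp add: max_def)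
  qed
  have "weil_height \<alpha> = prod' F (places ?K)"
    by (simp add: weil_height_def weil_height_over_def F_def[abs_def])
  also have "\<dots> = prod F A"
  proof -
    \<comment> \<open>\<open>prod'\<close> multiplies the factors different from 1 and defaults to 1
      if there are infinitely many of them; inclusion in the finite set A excludes that
      case.\<close>
    have sub: "{V \<in> places ?K. F V \<noteq> 1} \<subseteq> A" using F1 by blast
    then have "prod' F (places ?K) = prod F {V \<in> places ?K. F V \<noteq> 1}"
      using finA by (auto simp: prod.G_def dest: finite_subset)
    also have "\<dots> = prod F A"
      using sub finA by (intro prod.mono_neutral_left) (auto simp: A_def)
    finally show ?thesis .
  qed
  finally have H: "weil_height \<alpha> ^ n = (\<Prod>V\<in>A. F V ^ n)"
    by (simp add: prod_power_distrib)
  \<comment> \<open>Each absolute value lies over exactly one rational place, so p can be recovered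
    from u and the exponent becomes a function of u alone.\<close>
  define pl where "pl u = (THE p. p \<in> rat_places \<and> u \<in> abs_values_over ?K p)" for u
  have pl: "pl u = p" if "p \<in> rat_places" "u \<in> abs_values_over ?K p" for u p
    unfolding pl_def
  proof (rule the_equality)
    fix q assume q: "q \<in> rat_places \<and> u \<in> abs_values_over ?K q"
    interpret valued_field ?K u by (rule valued_fieldI[OF rat_field_rat_adjoin[OF alg] that(2)])
    show "q = p"
      using extends_unique[of q u p u 1] q that nonneg by (auto simp: abs_values_over_def)
  qed (use that in auto)
  have "(\<Prod>V\<in>A. F V ^ n) = (\<Prod>V\<in>A. max 1 (place_norm V \<alpha>) ^ d (pl (place_norm V)) (place_norm V))"
  proof (rule prod.cong)
    fix V assume "V \<in> A"
    then obtain p where p: "p \<in> rat_places" "place_norm V \<in> abs_values_over ?K p"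
      using P(2) by (auto simp: A_def)
    have "F V ^ n = max 1 (place_norm V \<alpha>) powr (real (d p (place_norm V)) / real n * real n)"
      unfolding F_eq[OF refl p(2,1)] by (simp add: powr_powr flip: powr_realpow)
    also have "\<dots> = max 1 (place_norm V \<alpha>) ^ d p (place_norm V)"
      using n by (simp add: powr_realpow)
    finally show "F V ^ n = max 1 (place_norm V \<alpha>) ^ d (pl (place_norm V)) (place_norm V)"
      by (simp add: pl[OF p])
  qed simp
  also have "\<dots> = (\<Prod>u\<in>(\<Union>p\<in>P. abs_values_over ?K p). max 1 (u \<alpha>) ^ d (pl u) u)"
    unfolding img[symmetric] by (simp add: prod.reindex[OF inj])
  also have "\<dots> = (\<Prod>p\<in>P. \<Prod>u\<in>abs_values_over ?K p. max 1 (u \<alpha>) ^ d (pl u) u)"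
  proof (rule prod.UNION_disjoint)
    have "p = q" if "p \<in> P" "q \<in> P" "u \<in> abs_values_over ?K p" "u \<in> abs_values_over ?K q" for p q u
      using pl[of p u] pl[of q u] P(2) that by auto
    then show "\<forall>p\<in>P. \<forall>q\<in>P. p \<noteq> q \<longrightarrow> abs_values_over ?K p \<inter> abs_values_over ?K q = {}"
      by blast
  qed (use P(1) fin_over in auto)
  also have "\<dots> = (\<Prod>p\<in>P. local_mahler (W p) \<alpha>)"
  proof (rule prod.cong)
    fix p assume "p \<in> P"
    then have p: "p \<in> rat_places" using P(2) by blast
    have "(\<Prod>u\<in>abs_values_over ?K p. max 1 (u \<alpha>) ^ d (pl u) u) =
        (\<Prod>u\<in>abs_values_over ?K p. max 1 (u \<alpha>) ^ card (conj_place.S \<alpha> u (W p)))"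
      using pl[OF p] by (intro prod.cong) (auto simp: d_def)
    also have "\<dots> = local_mahler (W p) \<alpha>"
      by (rule local_product(2)[OF alg nz p W[OF p]])
    finally show "(\<Prod>u\<in>abs_values_over ?K p. max 1 (u \<alpha>) ^ d (pl u) u) = local_mahler (W p) \<alpha>" .
  qed simp
  finally show ?thesis
    using H by (simp add: mahler_measure_def ad)
qed

section \<open>Gauss's lemma\<close>

lemma padic_abs_of_int_le: "prime r \<Longrightarrow> padic_abs r (of_int a) \<le> 1"
  using prime_gt_0_nat[of r] by (simp add: padic_abs_def power_int_minus inverse_le_1_iff one_le_power)

lemma padic_nonarchimedean:
  assumes r: "prime r" and K: "rat_field K" and w: "w \<in> abs_values_over K (Padic r)"
    and xy: "x \<in> K" "y \<in> K"
  shows "w (x + y) \<le> max (w x) (w y)"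
proof -
  interpret valued_field K w by (rule valued_fieldI[OF K w])
  have "w (of_rat q) = padic_abs r q" for q
    using w by (simp add: abs_values_over_def extends_rat_place_def)
  from this[of "of_nat n" for n] have "w (of_nat n) \<le> 1" for n
    using padic_abs_of_int_le[OF r, of "int n"] unfolding of_rat_of_nat_eq of_int_of_nat_eq by simp
  then show ?thesis using xy by (rule nonarchimedean)
qed

text \<open>Multiplicativity of the Gauss norm, one linear factor X - a at a time. If w(a) \<le> 1,
  the maximum is attained just above the last coefficient of maximal size, where nothing can cancel;
  otherwise a times a maximal coefficient dominates the shifted one.\<close>

lemma gauss_norm:
  assumes r: "prime r" and w: "w \<in> abs_values_over (Collect algebraic) (Padic r)"
    and Z: "finite Z" "Z \<subseteq> Collect algebraic"
  shows "(\<forall>k. w (coeff (\<Prod>z\<in>Z. [:- z, 1:]) k) \<le> (\<Prod>z\<in>Z. max 1 (w z))) \<and>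
    (\<exists>k. w (coeff (\<Prod>z\<in>Z. [:- z, 1:]) k) = (\<Prod>z\<in>Z. max 1 (w z)))"
  using Z
proof (induction Z rule: finite_induct)
  interpret W: valued_field "Collect algebraic" w by (rule valued_fieldI[OF rat_field_algebraic w])
  case empty
  show ?case by (auto simp: coeff_1 intro!: exI[of _ 0])
next
  interpret W: valued_field "Collect algebraic" w by (rule valued_fieldI[OF rat_field_algebraic w])
  case (insert a F)
  define g where "g = (\<Prod>z\<in>F. [:- z, 1:])"
  define G where "G = (\<Prod>z\<in>F. max 1 (w z))"
  have a: "a \<in> Collect algebraic" using insert by auto
  have g_alg: "coeff g k \<in> Collect algebraic" for k
    unfolding g_def using insert.prems by (intro ALG.coeff_prod_mem ALG.coeff_linear_mem ALG.uminus_mem) auto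
  have le: "w (coeff g k) \<le> G" for k
    using insert unfolding g_def G_def by auto
  have ex: "\<exists>k. w (coeff g k) = G"
    using insert unfolding g_def G_def by auto
  have G: "G \<ge> 1" unfolding G_def by (rule prod_ge_1) auto
  have ag: "a * coeff g k \<in> Collect algebraic" and w_ag: "w (- (a * coeff g k)) = w a * w (coeff g k)" for k
    using a g_alg by (simp_all add: W.uminus W.mult ALG.mult_mem del: mem_Collect_eq)
  define h where "h k = (case k of 0 \<Rightarrow> 0 | Suc i \<Rightarrow> coeff g i)" for k
  have h_alg: "h k \<in> Collect algebraic" and h_le: "w (h k) \<le> G" for k
    using g_alg le G by (auto simp: h_def split: nat.split)
  have c: "coeff ([:- a, 1:] * g) k = h k + - (a * coeff g k)" for k
    by (auto simp: h_def coeff_pCons split: nat.split)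
  have ultra: "w (h k + - (a * coeff g k)) \<le> max (w (h k)) (w a * w (coeff g k))" for k
    unfolding w_ag[symmetric]
    by (intro padic_nonarchimedean[OF r rat_field_algebraic w] h_alg ALG.uminus_mem ag)
  have wa: "w a \<ge> 0" by (rule W.nonneg[OF a])
  have bound: "w (coeff ([:- a, 1:] * g) k) \<le> max 1 (w a) * G" for k
  proof -
    have "w (h k) \<le> max 1 (w a) * G"
    proof -
      have "1 * G \<le> max 1 (w a) * G" using G by (intro mult_right_mono) auto
      with h_le[of k] show ?thesis by linarith
    qed
    moreover have "w a * w (coeff g k) \<le> max 1 (w a) * G"
      using le[of k] wa W.nonneg[OF g_alg] by (intro mult_mono) auto
    ultimately show ?thesis using ultra[of k] unfolding c by linarith
  qed
  \<comment> \<open>Ultrametric equality: a strictly smaller summand does not change the absolute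
    value.\<close>
  have eq: "w (x + y) = w x"
    if "x \<in> Collect algebraic" "y \<in> Collect algebraic" "w y < w x" for x y
  proof (rule antisym)
    show "w (x + y) \<le> w x"
      using padic_nonarchimedean[OF r rat_field_algebraic w that(1,2)] that(3) by simp
    have "w (x + y + - y) \<le> max (w (x + y)) (w (- y))"
      using that ALG.add_mem ALG.uminus_mem
      by (intro padic_nonarchimedean[OF r rat_field_algebraic w]) auto
    then show "w x \<le> w (x + y)"
      using that(3) W.uminus[OF that(2)] by (simp add: max_def split: if_splits)
  qed
  have "\<exists>k. w (coeff ([:- a, 1:] * g) k) = max 1 (w a) * G"
  proof (cases "w a \<le> 1")
    case True
    define k where "k = Max {k. w (coeff g k) = G}"
    have fin: "finite {k. w (coeff g k) = G}"
    proof (rule finite_subset)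
      show "{k. w (coeff g k) = G} \<subseteq> {..degree g}"
        using G by (auto intro!: leI dest: coeff_eq_0)
    qed simp
    have k: "w (coeff g k) = G"
      using Max_in[OF fin] ex by (auto simp: k_def)
    have "w (coeff g (Suc k)) \<noteq> G"
      using Max_ge[OF fin, of "Suc k"] by (auto simp: k_def[symmetric])
    then have less: "w (coeff g (Suc k)) < G" using le[of "Suc k"] by simp
    have "w a * w (coeff g (Suc k)) \<le> 1 * w (coeff g (Suc k))"
      using True W.nonneg[OF g_alg] by (intro mult_right_mono) auto
    then have "w (h (Suc k) + - (a * coeff g (Suc k))) = w (h (Suc k))"
      using less k w_ag[of "Suc k"] by (intro eq h_alg ALG.uminus_mem ag) (simp add: h_def)
    then show ?thesis
      using k True by (intro exI[of _ "Suc k"]) (simp only: c, simp add: h_def max_def)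
  next
    case False
    obtain k where k: "w (coeff g k) = G" using ex by blast
    have "w (h k) < w (- (a * coeff g k))"
      unfolding w_ag k using h_le[of k] G False mult_strict_right_mono[of 1 "w a" G] by linarith
    then have "w (- (a * coeff g k) + h k) = w (- (a * coeff g k))"
      by (intro eq h_alg ALG.uminus_mem ag)
    then show ?thesis
      using k False by (intro exI[of _ k]) (simp only: c add.commute[of "h k"], simp add: w_ag max_def del: minus_add_distrib)
  qed
  with bound show ?case
    using insert.hyps by (simp add: g_def G_def)
qed

text \<open>The maximum in the Gauss norm is attained at an actual rational coefficient, so the
  local factor is a power of the prime. This discreteness yields the lower bound r for a factor
  different from 1.\<close>

lemma local_mahler_Padic:
  assumes r: "prime r" and w: "w \<in> abs_values_over (Collect algebraic) (Padic r)"
    and alg: "algebraic \<alpha>"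
  obtains k where "local_mahler w \<alpha> = padic_abs r (coeff (minpoly \<alpha>) k)"
proof -
  obtain k where "w (coeff (\<Prod>z\<in>conjs \<alpha>. [:- z, 1:]) k) = local_mahler w \<alpha>"
    using gauss_norm[OF r w finite_conjs[OF alg]] conj_algebraic[OF alg] unfolding local_mahler_def by blast
  then have "w (of_rat (coeff (minpoly \<alpha>) k)) = local_mahler w \<alpha>"
    unfolding minpoly_eq_prod[OF alg, symmetric] by (simp add: coeff_map_poly)
  with w show ?thesis
    by (intro that[of k]) (simp add: abs_values_over_def extends_rat_place_def)
qed

lemma padic_abs_gt_1:
  assumes r: "prime r" and "padic_abs r c > 1"
  shows "padic_abs r c \<ge> real r" "int r dvd snd (quotient_of c)"
proof -
  obtain a b where ab: "quotient_of c = (a, b)" by (cases "quotient_of c")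
  have r1: "real r > 1" using prime_gt_1_nat[OF r] by simp
  define e where "e = int (multiplicity (int r) b) - int (multiplicity (int r) a)"
  have c: "padic_abs r c = real r powi e"
    using assms(2) ab by (auto simp: padic_abs_def e_def split: if_splits)
  have "e > 0"
  proof (rule ccontr)
    assume "\<not> e > 0"
    then have "real r powi e \<le> real r powi 0"
      using r1 by (intro power_int_increasing) auto
    with c assms(2) show False by simp
  qed
  have "real r powi 1 \<le> real r powi e"
    using \<open>e > 0\<close> r1 by (intro power_int_increasing) auto
  then show "padic_abs r c \<ge> real r" using c by simp
  have "multiplicity (int r) b \<noteq> 0" using \<open>e > 0\<close> by (simp add: e_def)
  then show "int r dvd snd (quotient_of c)"
    using ab not_dvd_imp_multiplicity_0 by (metis snd_conv)
qed

lemma local_mahler_Padic_ge: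
  assumes r: "prime r" and w: "w \<in> abs_values_over (Collect algebraic) (Padic r)"
    and alg: "algebraic \<alpha>" and "local_mahler w \<alpha> \<noteq> 1"
  shows "local_mahler w \<alpha> \<ge> real r"
  using local_mahler_Padic[OF r w alg] padic_abs_gt_1(1)[OF r] local_mahler_ge_1[of w \<alpha>] assms(4)
  by (metis less_le)

text \<open>A finite set containing the places with nontrivial local factor: by Gauss's lemma a
  prime can contribute only if it divides the denominator of a coefficient of the minimal
  polynomial.\<close>

definition bad_places :: "complex \<Rightarrow> rat_place set" where
  "bad_places \<alpha> = insert Archimedean
     (Padic ` {r. prime r \<and> (\<exists>k\<le>degree (minpoly \<alpha>). int r dvd snd (quotient_of (coeff (minpoly \<alpha>) k)))})"

lemma finite_prime_divisors_int:
  assumes "(a :: int) \<noteq> 0" shows "finite {r :: nat. int r dvd a}"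
proof (rule finite_subset)
  show "{r :: nat. int r dvd a} \<subseteq> {..nat \<bar>a\<bar>}"
  proof
    fix r :: nat assume "r \<in> {r. int r dvd a}"
    then have "\<bar>int r\<bar> \<le> \<bar>a\<bar>"
      using assms by (intro dvd_imp_le_int) auto
    then show "r \<in> {..nat \<bar>a\<bar>}" by simp
  qed
qed simp

lemma finite_bad_places: "finite (bad_places \<alpha>)"
proof -
  have "finite (\<Union>k\<le>degree (minpoly \<alpha>). {r :: nat. int r dvd snd (quotient_of (coeff (minpoly \<alpha>) k))})"
  proof (intro finite_UN_I finite_prime_divisors_int)
    show "snd (quotient_of (coeff (minpoly \<alpha>) k)) \<noteq> 0" for k
      using quotient_of_denom_pos'[of "coeff (minpoly \<alpha>) k"] by simp
  qed simp
  then show ?thesis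
    unfolding bad_places_def by (intro finite.insertI finite_imageI) (erule finite_subset[rotated], auto)
qed

lemma bad_places_sub: "bad_places \<alpha> \<subseteq> rat_places"
  by (auto simp: bad_places_def rat_places_def)

lemma local_mahler_good:
  assumes alg: "algebraic \<alpha>" and p: "p \<in> rat_places - bad_places \<alpha>"
    and w: "w \<in> abs_values_over (Collect algebraic) p"
  shows "local_mahler w \<alpha> = 1"
proof (rule ccontr)
  assume ne: "local_mahler w \<alpha> \<noteq> 1"
  obtain r where r: "p = Padic r" "prime r"
    using p by (auto simp: rat_places_def bad_places_def)
  obtain k where k: "local_mahler w \<alpha> = padic_abs r (coeff (minpoly \<alpha>) k)"
    using local_mahler_Padic[OF r(2) _ alg] w r by blast
  have gt: "padic_abs r (coeff (minpoly \<alpha>) k) > 1"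
    using ne k local_mahler_ge_1[of w \<alpha>] by simp
  then have "int r dvd snd (quotient_of (coeff (minpoly \<alpha>) k))"
    by (rule padic_abs_gt_1(2)[OF r(2)])
  moreover have "k \<le> degree (minpoly \<alpha>)"
  proof (rule ccontr)
    assume "\<not> ?thesis"
    then have "coeff (minpoly \<alpha>) k = 0" by (simp add: coeff_eq_0)
    with gt show False by (simp add: padic_abs_def)
  qed
  ultimately show False using p r by (auto simp: bad_places_def)
qed

lemma mahler_measure_eq':
  assumes "algebraic \<alpha>" "\<alpha> \<noteq> 0"
    and "\<And>p. p \<in> rat_places \<Longrightarrow> W p \<in> abs_values_over (Collect algebraic) p"
    and "finite P" "P \<subseteq> rat_places" "bad_places \<alpha> \<subseteq> P"
  shows "mahler_measure \<alpha> = (\<Prod>p\<in>P. local_mahler (W p) \<alpha>)"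
  using assms by (intro mahler_measure_eq local_mahler_good) auto

lemma abs_values_choice:
  assumes "p \<in> rat_places" "w \<in> abs_values_over (Collect algebraic) p"
  obtains W where "\<And>q. q \<in> rat_places \<Longrightarrow> W q \<in> abs_values_over (Collect algebraic) q" "W p = w"
proof -
  obtain W where "\<And>q. q \<in> rat_places \<Longrightarrow> W q \<in> abs_values_over (Collect algebraic) q"
    using abs_values_over_exist by metis
  with assms show ?thesis by (intro that[of "W(p := w)"]) auto
qed

text \<open>All other local factors are at least 1.\<close>

lemma local_mahler_le:
  assumes "algebraic \<alpha>" "\<alpha> \<noteq> 0" and p: "p \<in> rat_places" "w \<in> abs_values_over (Collect algebraic) p"
  shows "local_mahler w \<alpha> \<le> mahler_measure \<alpha>"
proof -
  obtain W where W: "\<And>q. q \<in> rat_places \<Longrightarrow> W q \<in> abs_values_over (Collect algebraic) q" "W p = w"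
    using abs_values_choice[OF p] by blast
  define P where "P = insert p (bad_places \<alpha>)"
  have P: "finite P" "P \<subseteq> rat_places" "bad_places \<alpha> \<subseteq> P"
    using p finite_bad_places bad_places_sub by (auto simp: P_def)
  have "mahler_measure \<alpha> = (\<Prod>q\<in>P. local_mahler (W q) \<alpha>)"
    by (rule mahler_measure_eq'[OF assms(1,2) W(1) P])
  also have "\<dots> = local_mahler w \<alpha> * (\<Prod>q\<in>P - {p}. local_mahler (W q) \<alpha>)"
    using P W(2) by (subst prod.remove[of P p]) (auto simp: P_def)
  finally have "mahler_measure \<alpha> = local_mahler w \<alpha> * (\<Prod>q\<in>P - {p}. local_mahler (W q) \<alpha>)" .
  moreover have "(\<Prod>q\<in>P - {p}. local_mahler (W q) \<alpha>) \<ge> 1"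
    by (intro prod_ge_1 local_mahler_ge_1)
  ultimately show ?thesis
    using local_mahler_ge_1[of w \<alpha>] mult_left_mono[of 1 "\<Prod>q\<in>P - {p}. local_mahler (W q) \<alpha>" "local_mahler w \<alpha>"]
    by simp
qed

section \<open>Mahler measures of roots, inverses and non-units\<close>

text \<open>An embedding preserves rational equations; here the equation is the composition of
  \<open>minpoly x\<close> with a polynomial that expresses x in terms of \<alpha>.\<close>

lemma emb_in_conjs:
  assumes alg: "algebraic \<alpha>" and z: "z \<in> conjs \<alpha>" and x: "x \<in> rat_adjoin \<alpha>"
  shows "emb \<alpha> z x \<in> conjs x"
proof -
  have algx: "algebraic x" using rat_adjoin_algebraic[OF alg] x by auto
  obtain P where P: "x = rpoly P \<alpha>" using x by (auto simp: rat_adjoin_eq[OF alg])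
  have "emb \<alpha> z (rpoly (pcompose (minpoly x) P) \<alpha>) = rpoly (minpoly x) (emb \<alpha> z x)"
    unfolding emb_rpoly[OF alg z] by (simp add: P emb_rpoly[OF alg z])
  moreover have "rpoly (pcompose (minpoly x) P) \<alpha> = of_rat 0"
    using minpoly_props(2)[OF algx] by (simp add: P[symmetric])
  ultimately have "rpoly (minpoly x) (emb \<alpha> z x) = 0"
    using emb_of_rat[OF alg z, of 0] by simp
  then show ?thesis by (simp add: conjs_def)
qed

lemma conj_power:
  assumes alg: "algebraic \<alpha>" and z: "z \<in> conjs \<alpha>"
  shows "z ^ b \<in> conjs (\<alpha> ^ b)"
proof -
  interpret K: rat_field "rat_adjoin \<alpha>" by (rule rat_field_rat_adjoin[OF alg])
  show ?thesis
    using emb_in_conjs[OF alg z, of "\<alpha> ^ b"] emb_power[OF alg z, of \<alpha> b] emb_self[OF alg z]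
      self_in_rat_adjoin[OF alg] K.power_mem by simp
qed

lemma conj_inverse:
  assumes alg: "algebraic \<alpha>" and nz: "\<alpha> \<noteq> 0" and z: "z \<in> conjs \<alpha>"
  shows "inverse z \<in> conjs (inverse \<alpha>)"
proof -
  interpret K: rat_field "rat_adjoin \<alpha>" by (rule rat_field_rat_adjoin[OF alg])
  have mem: "\<alpha> \<in> rat_adjoin \<alpha>" "inverse \<alpha> \<in> rat_adjoin \<alpha>"
    using self_in_rat_adjoin[OF alg] K.inverse_mem by auto
  have "emb \<alpha> z (inverse \<alpha>) * z = emb \<alpha> z (of_rat 1)"
    using emb_mult[OF alg z mem(2,1)] emb_self[OF alg z] nz by simp
  then have "emb \<alpha> z (inverse \<alpha>) * z = 1"
    unfolding emb_of_rat[OF alg z] by simp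
  then have "emb \<alpha> z (inverse \<alpha>) = inverse z"
    by (metis inverse_unique mult.commute)
  then show ?thesis using emb_in_conjs[OF alg z mem(2)] by simp
qed

lemma conjs_inverse:
  assumes "algebraic \<alpha>" "\<alpha> \<noteq> 0"
  shows "conjs (inverse \<alpha>) = inverse ` conjs \<alpha>"
proof
  show "inverse ` conjs \<alpha> \<subseteq> conjs (inverse \<alpha>)"
    using conj_inverse[OF assms] by blast
  show "conjs (inverse \<alpha>) \<subseteq> inverse ` conjs \<alpha>"
  proof
    fix z assume "z \<in> conjs (inverse \<alpha>)"
    then have "inverse z \<in> conjs \<alpha>"
      using conj_inverse[of "inverse \<alpha>" z] assms by auto
    then have "inverse (inverse z) \<in> inverse ` conjs \<alpha>" by (rule imageI)
    then show "z \<in> inverse ` conjs \<alpha>" by simp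
  qed
qed

lemma card_nth_roots_le:
  assumes b: "b > 0" shows "finite {z :: complex. z ^ b = y} \<and> card {z. z ^ b = y} \<le> b"
proof -
  define P where "P = Polynomial.monom 1 b + [:- y:]"
  have deg: "degree P = b"
    using b unfolding P_def by (subst degree_add_eq_left) (auto simp: degree_monom_eq)
  then have "P \<noteq> 0" using b by auto
  moreover have "{z. z ^ b = y} = {z. poly P z = 0}" by (auto simp: P_def poly_monom)
  ultimately show ?thesis
    using poly_roots_finite[of P] card_poly_roots_bound[of P] deg by simp
qed

text \<open>The b-th power maps conjugates of \<gamma> to conjugates of \<gamma>^b, and at most b of
  them share an image, since X^b - y has at most b roots. The local factors are therefore compared
  after raising both to the power b.\<close>

lemma local_mahler_root:
  assumes alg: "algebraic \<gamma>" and b: "b > 0" and w: "w \<in> abs_values_over (Collect algebraic) p"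
  shows "local_mahler w \<gamma> \<le> local_mahler w (\<gamma> ^ b)"
proof -
  interpret W: valued_field "Collect algebraic" w by (rule valued_fieldI[OF rat_field_algebraic w])
  have algb: "algebraic (\<gamma> ^ b)" using ALG.power_mem alg by simp
  have max_pow: "max 1 (w z) ^ b = max 1 (w (z ^ b))" if "z \<in> conjs \<gamma>" for z
  proof -
    have z: "z \<in> Collect algebraic" using conj_algebraic[OF alg that] by simp
    then show ?thesis
      using W.nonneg[OF z] b power_le_one[of "w z" b] one_le_power[of "w z" b]
      by (cases "w z \<le> 1") (auto simp: W.power max_def)
  qed
  have "local_mahler w \<gamma> ^ b = (\<Prod>z\<in>conjs \<gamma>. max 1 (w (z ^ b)))"
    unfolding local_mahler_def prod_power_distrib using max_pow by (intro prod.cong) auto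
  also have "\<dots> = (\<Prod>y\<in>conjs (\<gamma> ^ b). \<Prod>z\<in>{z \<in> conjs \<gamma>. z ^ b = y}. max 1 (w (z ^ b)))"
    using conj_power[OF alg] finite_conjs[OF alg] finite_conjs[OF algb]
    by (intro prod.group[symmetric]) auto
  also have "\<dots> = (\<Prod>y\<in>conjs (\<gamma> ^ b). max 1 (w y) ^ card {z \<in> conjs \<gamma>. z ^ b = y})"
    by (intro prod.cong) auto
  also have "\<dots> \<le> (\<Prod>y\<in>conjs (\<gamma> ^ b). max 1 (w y) ^ b)"
  proof (rule prod_mono)
    fix y assume "y \<in> conjs (\<gamma> ^ b)"
    have "card {z \<in> conjs \<gamma>. z ^ b = y} \<le> card {z. z ^ b = y}"
      using card_nth_roots_le[OF b] by (intro card_mono) auto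
    then have "card {z \<in> conjs \<gamma>. z ^ b = y} \<le> b"
      using card_nth_roots_le[OF b, of y] by linarith
    then show "0 \<le> max 1 (w y) ^ card {z \<in> conjs \<gamma>. z ^ b = y} \<and>
        max 1 (w y) ^ card {z \<in> conjs \<gamma>. z ^ b = y} \<le> max 1 (w y) ^ b"
      by (intro conjI power_increasing zero_le_power) auto
  qed
  also have "\<dots> = local_mahler w (\<gamma> ^ b) ^ b"
    by (simp add: local_mahler_def prod_power_distrib)
  finally show ?thesis
    using b local_mahler_ge_1[of w "\<gamma> ^ b"] by (simp add: power_mono_iff local_mahler_def prod_nonneg)
qed

theorem mahler_measure_root:
  assumes alg: "algebraic \<gamma>" and nz: "\<gamma> \<noteq> 0" and b: "b > 0"
  shows "mahler_measure \<gamma> \<le> mahler_measure (\<gamma> ^ b)"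
proof -
  obtain W where W: "\<And>q. q \<in> rat_places \<Longrightarrow> W q \<in> abs_values_over (Collect algebraic) q"
    using abs_values_over_exist by metis
  have algb: "algebraic (\<gamma> ^ b)" using ALG.power_mem alg by simp
  define P where "P = bad_places \<gamma> \<union> bad_places (\<gamma> ^ b)"
  have P: "finite P" "P \<subseteq> rat_places"
    using finite_bad_places bad_places_sub by (auto simp: P_def)
  have "mahler_measure \<gamma> = (\<Prod>p\<in>P. local_mahler (W p) \<gamma>)"
    using P by (intro mahler_measure_eq' alg nz W) (auto simp: P_def)
  also have "\<dots> \<le> (\<Prod>p\<in>P. local_mahler (W p) (\<gamma> ^ b))"
  proof (rule prod_mono)
    fix p assume "p \<in> P"
    then have "p \<in> rat_places" using P by blast
    from local_mahler_root[OF alg b W[OF this]] local_mahler_ge_1[of "W p" \<gamma>]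
    show "0 \<le> local_mahler (W p) \<gamma> \<and> local_mahler (W p) \<gamma> \<le> local_mahler (W p) (\<gamma> ^ b)"
      by linarith
  qed
  also have "\<dots> = mahler_measure (\<gamma> ^ b)"
    using P nz by (intro mahler_measure_eq'[symmetric] algb W) (auto simp: P_def)
  finally show ?thesis .
qed

section \<open>The product formula over the rationals and Mahler measures of inverses\<close>

lemma prod_multiplicity:
  assumes "a \<noteq> 0" "finite Q" "\<And>r. r \<in> Q \<Longrightarrow> prime r" "\<And>r. prime r \<Longrightarrow> int r dvd a \<Longrightarrow> r \<in> Q"
  shows "(\<Prod>r\<in>Q. real r ^ multiplicity (int r) a) = \<bar>real_of_int a\<bar>"
proof -
  have "(\<Prod>r\<in>Q. int r ^ multiplicity (int r) a) = (\<Prod>x\<in>int ` Q. x ^ multiplicity x a)"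
    by (subst prod.reindex) (auto simp: inj_on_def)
  also have "\<dots> = (\<Prod>x\<in>prime_factors a. x ^ multiplicity x a)"
  proof (rule prod.mono_neutral_right)
    show "prime_factors a \<subseteq> int ` Q"
    proof
      fix x assume "x \<in> prime_factors a"
      then have x: "prime x" "x dvd a" by (auto simp: in_prime_factors_iff)
      then have "x = int (nat x)" using prime_gt_0_int[OF x(1)] by simp
      with x assms(4)[of "nat x"] show "x \<in> int ` Q"
        by (metis image_eqI prime_int_nat_transfer)
    qed
    show "\<forall>x\<in>int ` Q - prime_factors a. x ^ multiplicity x a = 1"
      using assms(1,3) by (auto simp: in_prime_factors_iff not_dvd_imp_multiplicity_0)
  qed (use assms(2) in simp)
  also have "\<dots> = \<bar>a\<bar>"
    using prod_prime_factors[OF assms(1)] by simp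
  finally have "real_of_int (\<Prod>r\<in>Q. int r ^ multiplicity (int r) a) = real_of_int \<bar>a\<bar>" by simp
  then show ?thesis by simp
qed

lemma product_formula_rat:
  assumes "N \<noteq> 0" "finite P" "P \<subseteq> rat_places" "Archimedean \<in> P"
    "\<And>r. prime r \<Longrightarrow> int r dvd fst (quotient_of N) \<Longrightarrow> Padic r \<in> P"
    "\<And>r. prime r \<Longrightarrow> int r dvd snd (quotient_of N) \<Longrightarrow> Padic r \<in> P"
  shows "(\<Prod>p\<in>P. rat_place_abs p N) = 1"
proof -
  obtain a b where ab: "quotient_of N = (a, b)" by (cases "quotient_of N")
  have N: "N = of_int a / of_int b" and b: "b > 0"
    using quotient_of_div[OF ab] quotient_of_denom_pos[OF ab] by auto
  have a: "a \<noteq> 0" using N assms(1) by auto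
  define Q where "Q = {r. Padic r \<in> P}"
  have P: "P = insert Archimedean (Padic ` Q)"
    using assms(3,4) by (auto simp: Q_def rat_places_def)
  have finQ: "finite Q"
    using assms(2) unfolding P by (auto dest: finite_imageD simp: inj_on_def)
  have primeQ: "r \<in> Q \<Longrightarrow> prime r" for r using assms(3) by (auto simp: Q_def rat_places_def)
  have "padic_abs r N = real r ^ multiplicity (int r) b / real r ^ multiplicity (int r) a" if "r \<in> Q" for r
    using assms(1) ab prime_gt_0_nat[OF primeQ[OF that]]
    by (simp add: padic_abs_def power_int_diff)
  then have "(\<Prod>r\<in>Q. padic_abs r N) =
      (\<Prod>r\<in>Q. real r ^ multiplicity (int r) b) / (\<Prod>r\<in>Q. real r ^ multiplicity (int r) a)"
    by (simp add: prod_dividef)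
  also have "\<dots> = \<bar>real_of_int b\<bar> / \<bar>real_of_int a\<bar>"
  proof -
    have "(\<Prod>r\<in>Q. real r ^ multiplicity (int r) b) = \<bar>real_of_int b\<bar>"
      using b assms(6) ab by (intro prod_multiplicity finQ primeQ) (auto simp: Q_def)
    moreover have "(\<Prod>r\<in>Q. real r ^ multiplicity (int r) a) = \<bar>real_of_int a\<bar>"
      using a assms(5) ab by (intro prod_multiplicity finQ primeQ) (auto simp: Q_def)
    ultimately show ?thesis by simp
  qed
  finally have Q: "(\<Prod>r\<in>Q. padic_abs r N) = \<bar>real_of_int b\<bar> / \<bar>real_of_int a\<bar>" .
  have "(\<Prod>p\<in>P. rat_place_abs p N) = \<bar>real_of_rat N\<bar> * (\<Prod>r\<in>Q. padic_abs r N)"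
    unfolding P using finQ by (subst prod.insert) (auto simp: prod.reindex inj_on_def)
  also have "\<dots> = 1"
    unfolding Q using a b by (simp add: N of_rat_divide)
  finally show ?thesis .
qed

text \<open>For each conjugate, max(1, 1/|z|) |z| = max(1, |z|), and the product of all |z| is the
  absolute value of the constant coefficient of the minimal polynomial.\<close>

lemma local_mahler_inverse:
  assumes alg: "algebraic \<alpha>" and nz: "\<alpha> \<noteq> 0" and w: "w \<in> abs_values_over (Collect algebraic) p"
  shows "local_mahler w \<alpha> = local_mahler w (inverse \<alpha>) * rat_place_abs p (coeff (minpoly \<alpha>) 0)"
proof -
  interpret W: valued_field "Collect algebraic" w by (rule valued_fieldI[OF rat_field_algebraic w])
  have zalg: "z \<in> Collect algebraic" "z \<noteq> 0" if "z \<in> conjs \<alpha>" for z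
    using conj_algebraic[OF alg that] conj_nonzero[OF alg nz that] by auto
  have "complex_of_rat (coeff (minpoly \<alpha>) 0) = coeff (\<Prod>z\<in>conjs \<alpha>. [:- z, 1:]) 0"
    unfolding minpoly_eq_prod[OF alg, symmetric] by (simp add: coeff_map_poly)
  also have "\<dots> = (\<Prod>z\<in>conjs \<alpha>. - z)"
    by (simp flip: poly_0_coeff_0 add: poly_prod)
  finally have "w (of_rat (coeff (minpoly \<alpha>) 0)) = (\<Prod>z\<in>conjs \<alpha>. w z)"
    using zalg ALG.uminus_mem by (simp add: W.prod W.uminus del: mem_Collect_eq)
  then have c: "rat_place_abs p (coeff (minpoly \<alpha>) 0) = (\<Prod>z\<in>conjs \<alpha>. w z)"
    using w by (simp add: abs_values_over_def extends_rat_place_def)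
  have "local_mahler w (inverse \<alpha>) = (\<Prod>z\<in>conjs \<alpha>. max 1 (w (inverse z)))"
    unfolding local_mahler_def conjs_inverse[OF alg nz] by (subst prod.reindex) (auto simp: inj_on_def)
  then have "local_mahler w (inverse \<alpha>) * rat_place_abs p (coeff (minpoly \<alpha>) 0) =
      (\<Prod>z\<in>conjs \<alpha>. max 1 (w (inverse z)) * w z)"
    by (simp add: c prod.distrib)
  also have "\<dots> = (\<Prod>z\<in>conjs \<alpha>. max 1 (w z))"
  proof (rule prod.cong)
    fix z assume z: "z \<in> conjs \<alpha>"
    have "w z > 0" using W.pos zalg[OF z] by simp
    then show "max 1 (w (inverse z)) * w z = max 1 (w z)"
      unfolding W.inverse[OF zalg(1)[OF z]] max_mult_distrib_right by (simp add: max.commute)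
  qed simp
  finally show ?thesis by (simp add: local_mahler_def)
qed

text \<open>The local factors of \<alpha> and its inverse differ by the absolute values of one
  nonzero rational number N, which cancel by the product formula.\<close>

theorem mahler_measure_inverse:
  assumes alg: "algebraic \<alpha>" and nz: "\<alpha> \<noteq> 0"
  shows "mahler_measure (inverse \<alpha>) = mahler_measure \<alpha>"
proof -
  obtain W where W: "\<And>q. q \<in> rat_places \<Longrightarrow> W q \<in> abs_values_over (Collect algebraic) q"
    using abs_values_over_exist by metis
  have algi: "algebraic (inverse \<alpha>)" using alg by auto
  define N where "N = coeff (minpoly \<alpha>) 0"
  have "N \<noteq> 0"
  proof
    assume "N = 0"
    then have "rpoly (minpoly \<alpha>) 0 = 0"
      by (simp add: N_def rpoly_def coeff_map_poly poly_0_coeff_0)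
    then have "0 \<in> conjs \<alpha>" by (simp add: conjs_def)
    then show False using conj_nonzero[OF alg nz] by blast
  qed
  define B where "B = Padic ` {r. prime r \<and> (int r dvd fst (quotient_of N) \<or> int r dvd snd (quotient_of N))}"
  have "fst (quotient_of N) \<noteq> 0" "snd (quotient_of N) \<noteq> 0"
    using \<open>N \<noteq> 0\<close> quotient_of_denom_pos'[of N] quotient_of_div[of N]
    by (metis div_by_0 div_0 of_int_0 prod.collapse, simp)
  then have "finite {r :: nat. int r dvd fst (quotient_of N)}" "finite {r :: nat. int r dvd snd (quotient_of N)}"
    by (auto intro: finite_prime_divisors_int)
  then have finB: "finite B"
    unfolding B_def by (intro finite_imageI) (erule (1) finite_subset[rotated, OF finite_UnI], auto)
  \<comment> \<open>One finite set has to carry the local factors of both numbers and all primes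
    dividing the numerator or denominator of N.\<close>
  define P where "P = bad_places \<alpha> \<union> bad_places (inverse \<alpha>) \<union> B"
  have P: "finite P" "P \<subseteq> rat_places"
    using finite_bad_places bad_places_sub finB by (auto simp: P_def B_def rat_places_def)
  have prod1: "(\<Prod>p\<in>P. rat_place_abs p N) = 1"
    by (rule product_formula_rat[OF \<open>N \<noteq> 0\<close> P]) (auto simp: P_def B_def bad_places_def)
  have "mahler_measure \<alpha> = (\<Prod>p\<in>P. local_mahler (W p) \<alpha>)"
    using P by (intro mahler_measure_eq' alg nz W) (auto simp: P_def)
  also have "\<dots> = (\<Prod>p\<in>P. local_mahler (W p) (inverse \<alpha>) * rat_place_abs p N)"
    using P(2) local_mahler_inverse[OF alg nz W] unfolding N_def by (intro prod.cong) auto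
  also have "\<dots> = (\<Prod>p\<in>P. local_mahler (W p) (inverse \<alpha>))"
    by (simp add: prod.distrib prod1)
  also have "\<dots> = mahler_measure (inverse \<alpha>)"
    using P nz by (intro mahler_measure_eq'[symmetric] algi W) (auto simp: P_def)
  finally show ?thesis by simp
qed

lemma mahler_measure_nonneg: "mahler_measure \<alpha> \<ge> 0"
proof -
  have "weil_height \<alpha> \<ge> 0"
    by (auto simp: weil_height_def weil_height_over_def prod.G_def intro!: prod_nonneg)
  then show ?thesis by (simp add: mahler_measure_def)
qed

text \<open>The local factor at r is 1 or at least r, and it is at most the Mahler measure; so it is
  1 and w(\<alpha>) \<le> 1. The inverse has the same Mahler measure, which gives the reverse
  inequality.\<close>

theorem small_mahler_unit:
  assumes alg: "algebraic \<alpha>" and nz: "\<alpha> \<noteq> 0" and r: "prime r"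
    and w: "w \<in> abs_values_over (Collect algebraic) (Padic r)" and small: "mahler_measure \<alpha> < real r"
  shows "w \<alpha> = 1"
proof -
  interpret W: valued_field "Collect algebraic" w by (rule valued_fieldI[OF rat_field_algebraic w])
  have p: "Padic r \<in> rat_places" using r by (auto simp: rat_places_def)
  have *: "w \<beta> \<le> 1" if "algebraic \<beta>" "\<beta> \<noteq> 0" "mahler_measure \<beta> < real r" for \<beta>
  proof -
    have "local_mahler w \<beta> = 1"
      using local_mahler_le[OF that(1,2) p w] local_mahler_Padic_ge[OF r w that(1)] that(3) by linarith
    then show ?thesis
      using local_mahler_eq_1_iff[OF that(1)] self_in_conjs[OF that(1)] by blast
  qed
  have "w \<alpha> \<le> 1" using *[OF alg nz small] .
  moreover have "w (inverse \<alpha>) \<le> 1"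
    using alg nz small mahler_measure_inverse[OF alg nz] by (intro *) auto
  ultimately show ?thesis
    using W.inverse[of \<alpha>] W.pos[of \<alpha>] alg nz by (simp add: inverse_le_1_iff)
qed

section \<open>The strong metric Mahler measure\<close>

text \<open>Finite lists in place of sequences, and a bound on the measures in place of their
  maximum, so that products, inverses and roots act entrywise or by concatenation. Bounds attained
  by sequences are at least the measure of 1, because a sequence always has entries 1.\<close>

definition generated :: "real \<Rightarrow> complex \<Rightarrow> bool" where
  "generated t x \<longleftrightarrow> (\<exists>xs. set xs \<subseteq> alg_units \<and> (\<forall>y\<in>set xs. mahler_measure y \<le> t) \<and> prod_list xs = x)"

lemma alg_units_iff: "x \<in> alg_units \<longleftrightarrow> algebraic x \<and> x \<noteq> 0"
  by (simp add: alg_units_def)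

lemma generated_mult: "generated t x \<Longrightarrow> generated t y \<Longrightarrow> generated t (x * y)"
  unfolding generated_def
proof (elim exE)
  fix xs ys
  assume "set xs \<subseteq> alg_units \<and> (\<forall>y\<in>set xs. mahler_measure y \<le> t) \<and> prod_list xs = x"
    "set ys \<subseteq> alg_units \<and> (\<forall>y\<in>set ys. mahler_measure y \<le> t) \<and> prod_list ys = y"
  then show "\<exists>xs. set xs \<subseteq> alg_units \<and> (\<forall>y\<in>set xs. mahler_measure y \<le> t) \<and> prod_list xs = x * y"
    by (intro exI[of _ "xs @ ys"]) auto
qed

lemma generated_single: "x \<in> alg_units \<Longrightarrow> mahler_measure x \<le> t \<Longrightarrow> generated t x"
  unfolding generated_def by (intro exI[of _ "[x]"]) auto

lemma generated_one: "generated t 1"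
  unfolding generated_def by (intro exI[of _ "[]"]) auto

lemma generated_power: "generated t x \<Longrightarrow> generated t (x ^ n)"
  by (induction n) (auto intro: generated_mult generated_one)

lemma generated_inverse:
  assumes "generated t x" shows "generated t (inverse x)"
proof -
  obtain xs where xs: "set xs \<subseteq> alg_units" "\<forall>y\<in>set xs. mahler_measure y \<le> t" "prod_list xs = x"
    using assms by (auto simp: generated_def)
  have "prod_list (map inverse xs) = inverse (prod_list xs)" by (induction xs) auto
  moreover have "mahler_measure (inverse y) \<le> t \<and> inverse y \<in> alg_units" if "y \<in> set xs" for y
  proof -
    have "algebraic y" "y \<noteq> 0" using xs(1) that by (auto simp: alg_units_def)
    then show ?thesis
      using xs(2) that mahler_measure_inverse[of y] by (simp add: alg_units_iff algebraic_inverse)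
  qed
  ultimately show ?thesis
    unfolding generated_def using xs(3) by (intro exI[of _ "map inverse xs"]) auto
qed

lemma complex_root_exists:
  fixes y :: complex
  assumes "y \<noteq> 0" "b > 0"
  obtains c where "c ^ b = y"
proof -
  have "exp (Ln y / of_nat b) ^ b = y"
    using assms by (simp flip: exp_of_nat_mult)
  with that show ?thesis by blast
qed

lemma algebraic_of_power:
  assumes "algebraic (c ^ b)" "b > 0" shows "algebraic (c :: complex)"
proof -
  obtain P where P: "P \<noteq> 0" "rpoly P (c ^ b) = 0"
    using assms by (auto simp: algebraic_iff_rpoly)
  have "pcompose P (Polynomial.monom 1 b) \<noteq> 0"
  proof
    assume "pcompose P (Polynomial.monom 1 b) = 0"
    then have "degree P * degree (Polynomial.monom 1 b :: rat poly) = 0"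
      by (metis degree_0 degree_pcompose)
    then have "degree P = 0" using assms(2) by (simp add: degree_monom_eq)
    then obtain a where "P = [:a:]" by (auto elim: degree_eq_zeroE)
    with P show False by simp
  qed
  then show ?thesis
    using P by (auto simp: algebraic_iff_rpoly intro!: exI[of _ "pcompose P (Polynomial.monom 1 b)"])
qed

text \<open>Replacing each factor by some b-th root does not increase its measure, but the product
  agrees with \<beta> only up to a root of unity \<zeta>. This becomes one more factor: as \<zeta>^b
  = 1, its measure is at most that of 1.\<close>

lemma generated_root:
  assumes gen: "generated t x" and b: "b > 0" and t: "mahler_measure 1 \<le> t" and \<beta>: "\<beta> ^ b = x"
  shows "generated t \<beta>"
proof -
  obtain xs where xs: "set xs \<subseteq> alg_units" "\<forall>y\<in>set xs. mahler_measure y \<le> t" "prod_list xs = x"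
    using gen by (auto simp: generated_def)
  define c where "c y = (SOME c :: complex. c ^ b = y)" for y
  have c: "c y ^ b = y" if ne: "y \<noteq> 0" for y
  proof -
    obtain c0 where "c0 ^ b = y" by (rule complex_root_exists[OF ne b])
    then show ?thesis unfolding c_def by (rule someI)
  qed
  have cy: "c y \<in> alg_units \<and> mahler_measure (c y) \<le> t" if "y \<in> set xs" for y
  proof -
    have y: "algebraic y" "y \<noteq> 0" "mahler_measure y \<le> t" using xs that by (auto simp: alg_units_iff)
    have "c y \<noteq> 0" using c[OF y(2)] b y(2) by (metis power_eq_0_iff)
    moreover have alg: "algebraic (c y)" using algebraic_of_power[of "c y" b] c[OF y(2)] y b by simp
    ultimately show ?thesis
      using mahler_measure_root[OF alg _ b] c[OF y(2)] y(3) by (simp add: alg_units_iff)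
  qed
  define \<gamma> where "\<gamma> = prod_list (map c xs)"
  have gen\<gamma>: "generated t \<gamma>"
    unfolding generated_def \<gamma>_def using cy by (intro exI[of _ "map c xs"]) auto
  have "\<forall>y\<in>set xs. y \<noteq> 0" using xs(1) by (auto simp: alg_units_iff)
  then have \<gamma>b: "\<gamma> ^ b = x" and x0: "x \<noteq> 0"
    unfolding \<gamma>_def xs(3)[symmetric] using c by (induction xs) (auto simp: power_mult_distrib)
  then have \<gamma>0: "\<gamma> \<noteq> 0" using b by (auto simp: zero_power)
  define \<zeta> where "\<zeta> = \<beta> / \<gamma>"
  have \<zeta>b: "\<zeta> ^ b = 1" using \<beta> \<gamma>b x0 by (simp add: \<zeta>_def power_divide)
  have "algebraic \<zeta>" using algebraic_of_power[of \<zeta> b] \<zeta>b b by simp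
  moreover have "\<zeta> \<noteq> 0" using \<zeta>b b by (auto simp: zero_power)
  ultimately have "generated t \<zeta>"
    using mahler_measure_root[of \<zeta> b] \<zeta>b b t by (intro generated_single) (auto simp: alg_units_iff)
  then have "generated t (\<zeta> * \<gamma>)" using gen\<gamma> by (rule generated_mult)
  then show ?thesis using \<gamma>0 by (simp add: \<zeta>_def)
qed

lemma finite_range_fin_sequences:
  assumes "A \<in> fin_sequences"
  shows "finite (range (\<lambda>n. mahler_measure (A n)))"
proof -
  have "finite {n. A n \<noteq> 1}" using assms by (simp add: fin_sequences_def)
  then have "finite (insert (mahler_measure 1) ((\<lambda>n. mahler_measure (A n)) ` {n. A n \<noteq> 1}))"
    by simp
  then show ?thesis by (rule finite_subset[rotated]) auto
qed

text \<open>Makes the maximum over a sequence at least the measure of 1, the side condition under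
  which roots are taken and lists are padded to sequences.\<close>

lemma fin_sequences_eq_1:
  assumes "A \<in> fin_sequences" obtains n where "A n = 1"
proof -
  have "finite {n. A n \<noteq> 1}" using assms by (simp add: fin_sequences_def)
  then have "{n. A n \<noteq> 1} \<noteq> UNIV" by (metis infinite_UNIV_nat)
  with that show ?thesis by blast
qed

lemma seq_product_eq: "A \<in> fin_sequences \<Longrightarrow> seq_product A = prod A {n. A n \<noteq> 1}"
  by (simp add: seq_product_def prod.G_def fin_sequences_def)

lemma seq_imp_generated:
  assumes A: "A \<in> fin_sequences" and "\<And>n. mahler_measure (A n) \<le> t"
  shows "generated t (seq_product A)"
proof -
  have "generated t (prod A F)" if "finite F" for F
    using that
  proof (induction F rule: finite_induct)
    case (insert n F)
    have "generated t (A n)"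
      using assms by (intro generated_single) (auto simp: fin_sequences_def)
    with insert show ?case by (simp add: generated_mult)
  qed (simp add: generated_one)
  then show ?thesis
    using A by (simp add: seq_product_eq fin_sequences_def)
qed

lemma generated_imp_seq:
  assumes "generated t x" and t: "mahler_measure 1 \<le> t"
  obtains A where "A \<in> fin_sequences" "seq_product A = x" "\<And>n. mahler_measure (A n) \<le> t"
proof -
  obtain xs where xs: "set xs \<subseteq> alg_units" "\<forall>y\<in>set xs. mahler_measure y \<le> t" "prod_list xs = x"
    using assms by (auto simp: generated_def)
  define A where "A n = (if n < length xs then xs ! n else 1)" for n
  have sub: "{n. A n \<noteq> 1} \<subseteq> {..<length xs}" by (auto simp: A_def)
  have A: "A \<in> fin_sequences"
    using finite_subset[OF sub] xs(1) by (auto simp: fin_sequences_def A_def alg_units_iff)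
  have "seq_product A = prod A {n. A n \<noteq> 1}" by (rule seq_product_eq[OF A])
  also have "\<dots> = prod A {..<length xs}"
    using sub by (intro prod.mono_neutral_left) auto
  also have "\<dots> = (\<Prod>i<length xs. xs ! i)"
    by (intro prod.cong) (auto simp: A_def)
  also have "\<dots> = x"
    using xs(3) prod.list_conv_set_nth[of xs] by (simp add: atLeast0LessThan)
  finally have "seq_product A = x" .
  moreover have "mahler_measure (A n) \<le> t" for n using xs(2) t by (auto simp: A_def)
  ultimately show ?thesis using that A by blast
qed

section \<open>Comparing infima over factorizations\<close>

definition mahler_maxima :: "complex \<Rightarrow> real set" where
  "mahler_maxima \<alpha> = {Max (range (\<lambda>n. mahler_measure (A n))) | A. A \<in> fin_sequences \<and> seq_product A = \<alpha>}"

lemma strong_metric_mahler_eq: "strong_metric_mahler \<alpha> = Inf (mahler_maxima \<alpha>)"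
  by (simp add: strong_metric_mahler_def mahler_maxima_def)

lemma mahler_maxima_nonempty:
  assumes "\<alpha> \<in> alg_units" shows "mahler_maxima \<alpha> \<noteq> {}"
proof -
  define t where "t = max (mahler_measure 1) (mahler_measure \<alpha>)"
  have "generated t \<alpha>" using assms by (intro generated_single) (auto simp: t_def)
  then obtain A where "A \<in> fin_sequences" "seq_product A = \<alpha>"
    by (rule generated_imp_seq) (auto simp: t_def)
  then show ?thesis by (auto simp: mahler_maxima_def)
qed

lemma mahler_maxima_bdd: "bdd_below (mahler_maxima \<alpha>)"
proof (rule bdd_belowI)
  fix m assume "m \<in> mahler_maxima \<alpha>"
  then obtain A where A: "A \<in> fin_sequences" "m = Max (range (\<lambda>n. mahler_measure (A n)))"
    by (auto simp: mahler_maxima_def)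
  have "mahler_measure (A 0) \<le> m"
    unfolding A(2) using finite_range_fin_sequences[OF A(1)] by (intro Max_ge) auto
  with mahler_measure_nonneg[of "A 0"] show "0 \<le> m" by linarith
qed

text \<open>A bound attained by a factorization of \<alpha> carries over to its integer powers, of
  either sign thanks to inverses, and from there to every b-th root.\<close>

lemma strong_metric_mahler_le:
  assumes \<alpha>: "\<alpha> \<in> alg_units" and ab: "b > 0" and eq: "\<beta> ^ b = \<alpha> powi a"
  shows "strong_metric_mahler \<beta> \<le> strong_metric_mahler \<alpha>"
  unfolding strong_metric_mahler_eq
proof (rule cInf_mono[OF mahler_maxima_nonempty[OF \<alpha>] mahler_maxima_bdd])
  fix m assume "m \<in> mahler_maxima \<alpha>"
  then obtain A where A: "A \<in> fin_sequences" "seq_product A = \<alpha>" "m = Max (range (\<lambda>n. mahler_measure (A n)))"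
    by (auto simp: mahler_maxima_def)
  have le: "mahler_measure (A n) \<le> m" for n
    unfolding A(3) using finite_range_fin_sequences[OF A(1)] by (intro Max_ge) auto
  obtain n0 where "A n0 = 1" by (rule fin_sequences_eq_1[OF A(1)])
  then have m1: "mahler_measure 1 \<le> m" using le[of n0] by simp
  have "generated m \<alpha>" using seq_imp_generated[OF A(1) le] A(2) by simp
  then have "generated m (\<alpha> powi a)"
    by (auto simp: power_int_def intro: generated_power generated_inverse)
  then have "generated m \<beta>" using ab m1 eq by (rule generated_root)
  then obtain B where B: "B \<in> fin_sequences" "seq_product B = \<beta>" "\<And>n. mahler_measure (B n) \<le> m"
    using m1 by (rule generated_imp_seq) (rule that)
  have "Max (range (\<lambda>n. mahler_measure (B n))) \<le> m"
    using finite_range_fin_sequences[OF B(1)] B(3) by (subst Max_le_iff) auto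
  with B(1,2) show "\<exists>m'\<in>mahler_maxima \<beta>. m' \<le> m"
    unfolding mahler_maxima_def by blast
qed

lemma strong_metric_mahler_rat_power:
  assumes \<alpha>: "\<alpha> \<in> alg_units" and r: "r \<noteq> 0" and pow: "is_rat_power \<alpha> r \<beta>"
  shows "strong_metric_mahler \<beta> = strong_metric_mahler \<alpha>"
proof -
  obtain a b where ab: "\<beta> \<in> alg_units" "b > 0" "r = of_int a / of_nat b" "\<beta> ^ b = \<alpha> powi a"
    using pow by (auto simp: is_rat_power_def)
  have a: "a \<noteq> 0" using ab(3) r by auto
  \<comment> \<open>The relation read backwards: \<alpha> is an |a|-th root of an integer power of
    \<beta>, the sign of a being moved to the exponent of \<beta>. Here r \<noteq> 0 enters, as it
    makes |a| positive.\<close>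
  have "\<alpha> ^ nat \<bar>a\<bar> = \<beta> powi (sgn a * int b)"
  proof (cases "a > 0")
    case True
    then have "\<alpha> ^ nat \<bar>a\<bar> = \<alpha> powi a" by (simp add: power_int_def)
    with ab(4) True show ?thesis by simp
  next
    case False
    with a have "\<alpha> ^ nat \<bar>a\<bar> = inverse (\<alpha> powi a)" by (simp add: power_int_def power_inverse)
    with ab(4) False a show ?thesis by (simp add: power_int_minus)
  qed
  then have "strong_metric_mahler \<alpha> \<le> strong_metric_mahler \<beta>"
    using a ab(1) by (intro strong_metric_mahler_le) auto
  moreover have "strong_metric_mahler \<beta> \<le> strong_metric_mahler \<alpha>"
    by (rule strong_metric_mahler_le[OF \<alpha> ab(2,4)])
  ultimately show ?thesis by simp
qed

text \<open>An absolute value of the field of \<open>\<alpha>\<close> is extended to all algebraic numbers, so that it can be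
  evaluated at the factors of \<open>\<alpha>\<close>, which need not lie in that field.\<close>

lemma padic_extend:
  assumes alg: "algebraic \<alpha>" and r: "prime r" and u: "u \<in> abs_values_over (rat_adjoin \<alpha>) (Padic r)"
  obtains w where "w \<in> abs_values_over (Collect algebraic) (Padic r)" "\<And>x. x \<in> rat_adjoin \<alpha> \<Longrightarrow> w x = u x"
proof -
  let ?K = "rat_adjoin \<alpha>"
  note K = rat_field_rat_adjoin[OF alg]
  interpret U: valued_field ?K u by (rule valued_fieldI[OF K u])
  \<comment> \<open>The valuation ring of u. Starting from it, w is at most 1 wherever u is, and
    this one-sided comparison already forces w = u on the field.\<close>
  define R where "R = {x \<in> ?K. u x \<le> 1}"
  have "is_subring R"
    unfolding is_subring_def
  proof (intro conjI ballI)
    show "1 \<in> R" by (simp add: R_def)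
    fix x y assume xy: "x \<in> R" "y \<in> R"
    then have "u (x + y) \<le> max (u x) (u y)"
      by (intro padic_nonarchimedean[OF r K u]) (auto simp: R_def)
    with xy show "x + y \<in> R" by (auto simp: R_def U.add_mem)
    show "x * y \<in> R" using xy by (auto simp: R_def U.mult_mem U.mult U.nonneg mult_le_one)
    show "- x \<in> R" using xy by (auto simp: R_def U.uminus_mem U.uminus)
  qed
  moreover have "1 / of_nat r \<notin> R"
  proof -
    have "u (of_rat q) = padic_abs r q" for q
      using u by (simp add: abs_values_over_def extends_rat_place_def)
    from this[of "of_nat r"] have "u (of_nat r) = 1 / real r"
      using padic_abs_of_nat(1)[OF r] unfolding of_rat_of_nat_eq by simp
    then have "u (1 / of_nat r) = real r" by (simp add: U.divide)
    then show ?thesis using prime_gt_1_nat[OF r] by (simp add: R_def)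
  qed
  ultimately obtain w where w: "abs_value_on (Collect algebraic) w" "extends_rat_place (Padic r) w"
    "\<And>x. algebraic x \<Longrightarrow> x \<in> R \<Longrightarrow> w x \<le> 1"
    using padic_extension_exists[OF r] by metis
  have "w x = u x" if "x \<in> ?K" for x
  proof (rule abs_value_dominated[OF K _ rat_field_algebraic w(1) rat_adjoin_algebraic[OF alg] _ _ w(2)])
    show "abs_value_on ?K u" "extends_rat_place (Padic r) u" using u by (auto simp: abs_values_over_def)
    show "Padic r \<in> rat_places" using r by (auto simp: rat_places_def)
    show "w x \<le> 1" if "x \<in> ?K" "u x < 1" for x
      using w(3)[of x] that rat_adjoin_algebraic[OF alg] by (auto simp: R_def)
  qed (fact that)
  with w(1,2) show ?thesis by (intro that[of w]) (auto simp: abs_values_over_def)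
qed

text \<open>Let u be an absolute value above r at which \<alpha> is not a unit, and w an extension
  of it. If all factors had measure below r, each would have value 1 at w, and so would their
  product \<alpha>.\<close>

lemma strong_metric_mahler_ge:
  assumes \<alpha>: "\<alpha> \<in> alg_units" and r: "prime r" and nonunit: "\<not> padic_unit r \<alpha>"
  shows "strong_metric_mahler \<alpha> \<ge> real r"
  unfolding strong_metric_mahler_eq
proof (rule cInf_greatest[OF mahler_maxima_nonempty[OF \<alpha>]])
  have alg: "algebraic \<alpha>" using \<alpha> by (simp add: alg_units_iff)
  let ?K = "rat_adjoin \<alpha>"
  note K = rat_field_rat_adjoin[OF alg]
  have pr: "Padic r \<in> rat_places" using r by (auto simp: rat_places_def)
  fix m assume "m \<in> mahler_maxima \<alpha>"
  then obtain A where A: "A \<in> fin_sequences" "seq_product A = \<alpha>" "m = Max (range (\<lambda>n. mahler_measure (A n)))"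
    by (auto simp: mahler_maxima_def)
  show "real r \<le> m"
  proof (rule ccontr)
    assume "\<not> real r \<le> m"
    have small: "mahler_measure (A n) < real r" for n
    proof -
      have "mahler_measure (A n) \<le> m"
        unfolding A(3) using finite_range_fin_sequences[OF A(1)] by (intro Max_ge) auto
      with \<open>\<not> real r \<le> m\<close> show ?thesis by simp
    qed
    obtain V where V: "V \<in> places ?K" "place_divides V (Padic r)" "place_abs ?K V \<alpha> \<noteq> 1"
      using nonunit by (auto simp: padic_unit_def padic_unit_in_def)
    obtain u where u: "u \<in> V" "extends_rat_place (Padic r) u"
      using V(2) by (auto simp: place_divides_def)
    have pn: "place_norm V = u" by (rule place_norm_eq[OF K V(1) u(1) pr u(2)])
    have "V \<subseteq> nontrivial_abs_values ?K"
      using V(1) in_quotient_imp_subset[OF equiv_abs_value_equiv[OF K]] by (simp add: places_def)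
    then have "u \<in> abs_values_over ?K (Padic r)"
      using u by (auto simp: abs_values_over_def nontrivial_abs_values_def)
    then obtain w where w: "w \<in> abs_values_over (Collect algebraic) (Padic r)" "\<And>x. x \<in> ?K \<Longrightarrow> w x = u x"
      using padic_extend[OF alg r] by blast
    interpret W: valued_field "Collect algebraic" w by (rule valued_fieldI[OF rat_field_algebraic w(1)])
    have An: "algebraic (A n)" "A n \<noteq> 0" for n
      using A(1) by (auto simp: fin_sequences_def alg_units_iff image_subset_iff)
    have "w \<alpha> = (\<Prod>n\<in>{n. A n \<noteq> 1}. w (A n))"
      unfolding A(2)[symmetric] seq_product_eq[OF A(1)] using An by (intro W.prod) auto
    also have "\<dots> = 1"
      using small_mahler_unit[OF An r w(1) small] by simp
    finally have "u \<alpha> = 1" using w(2)[OF self_in_rat_adjoin[OF alg]] by simp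
    \<comment> \<open>\<open>place_abs\<close> is a power of u(\<alpha>), so it would be 1 as
      well.\<close>
    then show False using V(3) by (simp add: place_abs_def pn)
  qed
qed

theorem theorem1p3:
  fixes \<alpha> :: complex
  assumes "\<alpha> \<in> alg_units"
  shows "(\<forall>(r::rat) \<beta>. r \<noteq> 0 \<and> is_rat_power \<alpha> r \<beta> \<longrightarrow>
            strong_metric_mahler \<beta> = strong_metric_mahler \<alpha>) \<and>
         (\<forall>p::nat. prime p \<and> \<not> padic_unit p \<alpha> \<and>
              (\<forall>q. prime q \<and> \<not> padic_unit q \<alpha> \<longrightarrow> q \<le> p) \<longrightarrow>
            strong_metric_mahler \<alpha> \<ge> real p)"
  using strong_metric_mahler_rat_power[OF assms] strong_metric_mahler_ge[OF assms] by blast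

end
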